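(* Let $\nu,\nu_1,\nu_2>0$ with $\nu=\nu_1+\nu_2$. Let $Z=X+Y=I_{q_1}(f)+I_{q_2}(h)$, where $q_1,q_2\ge2$ are integers, $X=I_{q_1}(f)$, $Y=I_{q_2}(h)$, and $f\in L^2(T^{q_1})$, $h\in L^2(T^{q_2})$ are symmetric, be such that $X$ and $Y$ are independent and $$\mathbf{E}(Z^2)=2\nu,\qquad \mathbf{E}(X^2)=q_1!\,\|f\|^2_{L^2(T^{q_1})}=2\nu_1,\qquad \mathbf{E}(Y^2)=q_2!\,\|h\|^2_{L^2(T^{q_2})}=2\nu_2.$$ Assume that $Z\sim F(\nu)$. Then $X\sim F(\nu_1)$ and $Y\sim F(\nu_2)$.
   Context: $(W_t)_{t\in T}$ is a classical Wiener process on a time interval $T$ (with Lebesgue measure), defined on a standard Wiener space $(\Omega,\mathcal{F},\mathbf{P})$. For $f\in L^2(T^n)$, $n\ge1$, $I_n(f)$ denotes the multiple Wiener–Itô integral of $f$ with respect to $W$, normalized so that $\mathbf{E}(I_n(f)I_n(g))=n!\langle f,g\rangle_{L^2(T^n)}$ for symmetric $f,g$. The centered Gamma law $F(\nu)$, $\nu>0$, is the law of $2G(\nu/2)-\nu$, where $G(\nu/2)$ has density $\frac{x^{\nu/2-1}e^{-x}}{\Gamma(\nu/2)}\mathbf{1}_{(0,\infty)}(x)$; its characteristic function is $\lambda\mapsto\left(\frac{e^{-i\lambda}}{\sqrt{1-2i\lambda}}\right)^{\nu}$. *)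

theory Defs
  imports "HOL-Probability.Probability"
begin

text \<open>
  The process is normalised by \<open>W 0 = 0\<close> whenever \<open>0\<close> belongs to the time interval, so for
  \<open>T = [0, a]\<close> or \<open>T = [0, \<infinity>)\<close> this is standard Brownian motion.  For an interval that does not
  contain \<open>0\<close> only the increments are constrained; stochastic integrals over \<open>T\<close> see nothing else.
\<close>

locale wiener_process = prob_space M
  for M :: "'w measure" and T :: "real set" and W :: "real \<Rightarrow> 'w \<Rightarrow> real" +
  assumes interval: "is_interval T"
    and measurable_W: "\<And>t. t \<in> T \<Longrightarrow> W t \<in> borel_measurable M"
    and start: "0 \<in> T \<Longrightarrow> AE \<omega> in M. W 0 \<omega> = 0"
    and gaussian_increments:
      "\<And>s t. s \<in> T \<Longrightarrow> t \<in> T \<Longrightarrow> s < t \<Longrightarrow>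
        distributed M lborel (\<lambda>\<omega>. W t \<omega> - W s \<omega>)
          (\<lambda>x. ennreal (normal_density 0 (sqrt (t - s)) x))"
    and independent_increments:
      "\<And>m p. strict_mono_on {..m} p \<Longrightarrow> p ` {..m} \<subseteq> T \<Longrightarrow>
        indep_vars (\<lambda>_. borel) (\<lambda>i \<omega>. W (p (Suc i)) \<omega> - W (p i) \<omega>) {..<m::nat}"
    and continuous_paths: "AE \<omega> in M. continuous_on T (\<lambda>t. W t \<omega>)"

text \<open>
  A point of \<open>T\<^sup>n\<close> is an extensional function on \<open>{..<n}\<close>.  Elements of \<open>L\<^sup>2(T\<^sup>n)\<close> are given by
  representatives, hence symmetry is required almost everywhere.
\<close>

definition cube_measure :: "real set \<Rightarrow> nat \<Rightarrow> (nat \<Rightarrow> real) measure" where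
  "cube_measure T n = Pi\<^sub>M {..<n} (\<lambda>_. restrict_space lborel T)"

definition square_integrable :: "'a measure \<Rightarrow> ('a \<Rightarrow> real) \<Rightarrow> bool" where
  "square_integrable N f \<longleftrightarrow> f \<in> borel_measurable N \<and> integrable N (\<lambda>x. (f x)\<^sup>2)"

definition L2_norm :: "'a measure \<Rightarrow> ('a \<Rightarrow> real) \<Rightarrow> real" where
  "L2_norm N f = sqrt (\<integral>x. (f x)\<^sup>2 \<partial>N)"

definition symmetric_kernel :: "real set \<Rightarrow> nat \<Rightarrow> ((nat \<Rightarrow> real) \<Rightarrow> real) \<Rightarrow> bool" where
  "symmetric_kernel T n f \<longleftrightarrow>
    (\<forall>\<pi>. \<pi> permutes {..<n} \<longrightarrow> (AE t in cube_measure T n. f (t \<circ> \<pi>) = f t))"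

text \<open>
  Ito's construction.  A grid \<open>p 0 < \<dots> < p m\<close> in \<open>T\<close> and coefficients \<open>a \<sigma>\<close> determine an elementary
  kernel, a linear combination of indicators of the boxes
  \<open>(p (\<sigma> 0), p (\<sigma> 0 + 1)] \<times> \<dots> \<times> (p (\<sigma> (n - 1)), p (\<sigma> (n - 1) + 1)]\<close>.  Only injective \<open>\<sigma>\<close> occur, so the
  kernel vanishes on all diagonals.  Its integral replaces each box by the product of the increments
  of \<open>W\<close>, and the general integral is the extension by \<open>L\<^sup>2\<close> limits.  The integral of \<open>f\<close> is only
  determined up to null sets, so it is rendered as a relation: \<open>X\<close> is a version of \<open>I\<^sub>n(f)\<close>.
\<close>

definition off_diagonal_indices :: "nat \<Rightarrow> nat \<Rightarrow> (nat \<Rightarrow> nat) set" where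
  "off_diagonal_indices n m = {\<sigma> \<in> {..<n} \<rightarrow>\<^sub>E {..<m}. inj_on \<sigma> {..<n}}"

definition elementary_kernel ::
  "nat \<Rightarrow> nat \<Rightarrow> (nat \<Rightarrow> real) \<Rightarrow> ((nat \<Rightarrow> nat) \<Rightarrow> real) \<Rightarrow> (nat \<Rightarrow> real) \<Rightarrow> real" where
  "elementary_kernel n m p a t =
    (\<Sum>\<sigma>\<in>off_diagonal_indices n m. a \<sigma> * (\<Prod>j<n. indicator {p (\<sigma> j)<..p (Suc (\<sigma> j))} (t j)))"

definition elementary_integral ::
  "(real \<Rightarrow> 'w \<Rightarrow> real) \<Rightarrow> nat \<Rightarrow> nat \<Rightarrow> (nat \<Rightarrow> real) \<Rightarrow> ((nat \<Rightarrow> nat) \<Rightarrow> real) \<Rightarrow> 'w \<Rightarrow> real" where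
  "elementary_integral W n m p a \<omega> =
    (\<Sum>\<sigma>\<in>off_diagonal_indices n m. a \<sigma> * (\<Prod>j<n. W (p (Suc (\<sigma> j))) \<omega> - W (p (\<sigma> j)) \<omega>))"

definition L2_tendsto :: "'a measure \<Rightarrow> (nat \<Rightarrow> 'a \<Rightarrow> real) \<Rightarrow> ('a \<Rightarrow> real) \<Rightarrow> bool" where
  "L2_tendsto N g f \<longleftrightarrow> (\<lambda>k. \<integral>\<^sup>+x. ennreal ((g k x - f x)\<^sup>2) \<partial>N) \<longlonglongrightarrow> 0"

definition is_multiple_integral ::
  "'w measure \<Rightarrow> real set \<Rightarrow> (real \<Rightarrow> 'w \<Rightarrow> real) \<Rightarrow> nat \<Rightarrow> ((nat \<Rightarrow> real) \<Rightarrow> real) \<Rightarrow> ('w \<Rightarrow> real) \<Rightarrow> bool"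
where
  "is_multiple_integral M T W n f X \<longleftrightarrow>
    X \<in> borel_measurable M \<and>
    (\<exists>(m :: nat \<Rightarrow> nat) p a.
      (\<forall>k. strict_mono_on {..m k} (p k) \<and> p k ` {..m k} \<subseteq> T) \<and>
      L2_tendsto (cube_measure T n) (\<lambda>k. elementary_kernel n (m k) (p k) (a k)) f \<and>
      L2_tendsto M (\<lambda>k. elementary_integral W n (m k) (p k) (a k)) X)"

definition gamma_density :: "real \<Rightarrow> real \<Rightarrow> real" where
  "gamma_density \<alpha> x = (if x > 0 then x powr (\<alpha> - 1) * exp (- x) / Gamma \<alpha> else 0)"

text \<open>The law \<open>F(\<nu>)\<close> of \<open>2 G(\<nu>/2) - \<nu>\<close>.\<close>

definition centered_gamma :: "real \<Rightarrow> real measure" where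
  "centered_gamma \<nu> =
    distr (density lborel (\<lambda>x. ennreal (gamma_density (\<nu> / 2) x))) borel (\<lambda>x. 2 * x - \<nu>)"

end

theory Submission
  imports Defs "HOL-Real_Asymp.Real_Asymp"
begin

text \<open>
  By construction, a multiple integral of order \<open>q\<close> is an \<open>L\<^sup>2\<close> limit of values \<open>P(\<xi>)\<close>, where \<open>P\<close> is a homogeneous multilinear polynomial of degree \<open>q\<close> and \<open>\<xi>\<close>
  is a finite family of independent standard normal variables (the normalised increments of \<open>W\<close>);
  multilinearity is what the removal of the diagonals gives.

  For such a \<open>P\<close> put \<open>\<Gamma> = \<bar>\<nabla>P\<bar>\<^sup>2 / q\<close>.  Gaussian integration by parts gives \<open>E[P \<phi>(P)] = E[\<Gamma> \<phi>'(P)]\<close>,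
  and the law \<open>F(\<nu>)\<close> is the one for which the same identity holds with \<open>2 x + 2 \<nu>\<close> in the place of \<open>\<Gamma>\<close>.
  So \<open>E[(\<Gamma> - 2 P - 2 \<nu>)\<^sup>2]\<close>, with \<open>2 \<nu> = E[P\<^sup>2]\<close>, measures how far \<open>P\<close> is from \<open>F(\<nu>)\<close>.  The decisive
  inequality, \<open>stein_discrepancy_bound\<close>, bounds three times this number by the combination of cumulants
  \<open>K = \<kappa>\<^sub>4 - 12 \<kappa>\<^sub>3 + 24 \<kappa>\<^sub>2\<close>.  Hence \<open>K \<ge> 0\<close> for every multiple integral.  On the other hand \<open>K\<close> is
  additive over independent summands and vanishes for \<open>F(\<nu>)\<close>.  If \<open>X + Y\<close> has the law \<open>F(\<nu>)\<close>, then
  \<open>K(X) + K(Y) = 0\<close> with both terms nonnegative, so both vanish, the discrepancies of the polynomials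
  that approximate \<open>X\<close> and \<open>Y\<close> tend to \<open>0\<close>, and the integration by parts formula becomes, in the limit
  and for \<open>\<phi>(x) = exp(i s x)\<close>, a linear differential equation whose only solution
  with value \<open>1\<close> at \<open>0\<close> is the characteristic function of the Gamma law (\<open>char_gamma_stein\<close>).

  The inequality rests on one spectral fact, \<open>number_op_bound\<close>: the number operator \<open>N\<close> is bounded by
  the degree.  It is applied to \<open>U = P\<^sup>2 - 4 P\<close>, of degree at most \<open>2 q\<close>, for which \<open>N U\<close> can be written
  with \<open>\<Gamma>\<close> because \<open>N P = q P\<close>.  Passing to the limit in moments of order up to four needs more than
  \<open>L\<^sup>2\<close> convergence; \<open>multilinear_sixth_moment\<close>, an elementary form of hypercontractivity, gives the
  uniform integrability.
\<close>

section \<open>Polynomial functions of finitely many variables\<close>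

definition monomial :: "nat \<Rightarrow> (nat \<Rightarrow> nat) \<Rightarrow> (nat \<Rightarrow> real) \<Rightarrow> real" where
  "monomial m \<alpha> x = (\<Prod>i<m. x i ^ \<alpha> i)"

text \<open>
  Polynomials are represented as functions, so that sums, products and derivatives are those of
  functions.  A set of admissible exponent vectors describes degree bounds, homogeneity,
  multilinearity and independence of a coordinate in the same way, and a linear statement about
  polynomials needs to be checked on monomials only.
\<close>

inductive poly_span :: "nat \<Rightarrow> (nat \<Rightarrow> nat) set \<Rightarrow> ((nat \<Rightarrow> real) \<Rightarrow> real) \<Rightarrow> bool"
  for m :: nat and A :: "(nat \<Rightarrow> nat) set"
where
  zero: "poly_span m A (\<lambda>_. 0)"
| add_monomial: "\<alpha> \<in> A \<Longrightarrow> poly_span m A F \<Longrightarrow> poly_span m A (\<lambda>x. c * monomial m \<alpha> x + F x)"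

definition exponents_upto :: "nat \<Rightarrow> nat \<Rightarrow> (nat \<Rightarrow> nat) set" where
  "exponents_upto m d = {\<alpha>. sum \<alpha> {..<m} \<le> d}"

abbreviation is_poly :: "nat \<Rightarrow> ((nat \<Rightarrow> real) \<Rightarrow> real) \<Rightarrow> bool" where
  "is_poly m \<equiv> poly_span m UNIV"

abbreviation poly_deg :: "nat \<Rightarrow> nat \<Rightarrow> ((nat \<Rightarrow> real) \<Rightarrow> real) \<Rightarrow> bool" where
  "poly_deg m d \<equiv> poly_span m (exponents_upto m d)"

definition partial :: "nat \<Rightarrow> ((nat \<Rightarrow> real) \<Rightarrow> real) \<Rightarrow> (nat \<Rightarrow> real) \<Rightarrow> real" where
  "partial i F x = deriv (\<lambda>t. F (x(i := t))) (x i)"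

lemma poly_span_mono: "poly_span m A F \<Longrightarrow> A \<subseteq> B \<Longrightarrow> poly_span m B F"
  by (induction rule: poly_span.induct) (auto intro: poly_span.intros)

lemma poly_span_is_poly: "poly_span m A F \<Longrightarrow> is_poly m F"
  by (erule poly_span_mono) simp

lemma poly_span_monomial: "\<alpha> \<in> A \<Longrightarrow> poly_span m A (\<lambda>x. c * monomial m \<alpha> x)"
  using poly_span.add_monomial[OF _ poly_span.zero, of \<alpha> A m c] by simp

lemma poly_span_add:
  "poly_span m A F \<Longrightarrow> poly_span m A G \<Longrightarrow> poly_span m A (\<lambda>x. F x + G x)"
proof (induction rule: poly_span.induct)
  case (add_monomial \<alpha> F c)
  then show ?case using poly_span.add_monomial[of \<alpha> A m "\<lambda>x. F x + G x" c]
    by (simp add: add.assoc)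
qed simp

lemma poly_span_scale: "poly_span m A F \<Longrightarrow> poly_span m A (\<lambda>x. c * F x)"
proof (induction rule: poly_span.induct)
  case zero
  show ?case by (simp add: poly_span.zero)
next
  case (add_monomial \<alpha> F b)
  then show ?case using poly_span.add_monomial[of \<alpha> A m "\<lambda>x. c * F x" "c * b"]
    by (simp add: algebra_simps)
qed

lemma poly_span_diff:
  "poly_span m A F \<Longrightarrow> poly_span m A G \<Longrightarrow> poly_span m A (\<lambda>x. F x - G x)"
  using poly_span_add[of m A F "\<lambda>x. (-1) * G x"] poly_span_scale[of m A G "-1"] by simp

lemma poly_span_sum:
  "(\<And>j. j \<in> J \<Longrightarrow> poly_span m A (F j)) \<Longrightarrow> poly_span m A (\<lambda>x. \<Sum>j\<in>J. F j x)"
  by (induction J rule: infinite_finite_induct) (auto intro: poly_span.zero poly_span_add)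

lemma monomial_mult: "monomial m \<alpha> x * monomial m \<beta> x = monomial m (\<lambda>i. \<alpha> i + \<beta> i) x"
  by (simp add: monomial_def power_add prod.distrib)

lemma poly_span_mult:
  assumes "poly_span m A F" "poly_span m B G"
    and C: "\<And>\<alpha> \<beta>. \<alpha> \<in> A \<Longrightarrow> \<beta> \<in> B \<Longrightarrow> (\<lambda>i. \<alpha> i + \<beta> i) \<in> C"
  shows "poly_span m C (\<lambda>x. F x * G x)"
  using assms(1)
proof (induction rule: poly_span.induct)
  case zero
  show ?case by (simp add: poly_span.zero)
next
  case (add_monomial \<alpha> F c)
  have "poly_span m C (\<lambda>x. c * monomial m \<alpha> x * G x)"
    using assms(2)
  proof (induction rule: poly_span.induct)
    case zero
    show ?case by (simp add: poly_span.zero)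
  next
    case (add_monomial \<beta> G b)
    then show ?case
      using poly_span.add_monomial[OF C[OF \<open>\<alpha> \<in> A\<close> \<open>\<beta> \<in> B\<close>], of m "\<lambda>x. c * monomial m \<alpha> x * G x" "c * b"]
      by (simp add: monomial_mult[symmetric] algebra_simps)
  qed
  from poly_span_add[OF this add_monomial.IH] show ?case by (simp add: algebra_simps)
qed

lemma poly_deg_mult:
  "poly_deg m d F \<Longrightarrow> poly_deg m e G \<Longrightarrow> poly_deg m (d + e) (\<lambda>x. F x * G x)"
  by (erule (1) poly_span_mult) (auto simp: exponents_upto_def sum.distrib)

lemma is_poly_mult: "is_poly m F \<Longrightarrow> is_poly m G \<Longrightarrow> is_poly m (\<lambda>x. F x * G x)"
  by (erule (1) poly_span_mult) auto

lemma is_poly_const: "is_poly m (\<lambda>_. c)"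
  using poly_span_monomial[of "\<lambda>_. 0" UNIV m c] by (simp add: monomial_def)

lemma is_poly_power: "is_poly m F \<Longrightarrow> is_poly m (\<lambda>x. F x ^ k)"
  by (induction k) (auto intro: is_poly_const is_poly_mult)

lemma monomial_remove:
  fixes x :: "nat \<Rightarrow> real"
  assumes "i < m"
  shows "monomial m \<alpha> x = x i ^ \<alpha> i * (\<Prod>j\<in>{..<m} - {i}. x j ^ \<alpha> j)"
  using assms unfolding monomial_def by (subst prod.remove[of _ i]) auto

lemma coord_times_monomial:
  assumes "i < m" shows "x i * monomial m \<alpha> x = monomial m (\<alpha>(i := Suc (\<alpha> i))) x"
proof -
  have "(\<Prod>j\<in>{..<m} - {i}. x j ^ (\<alpha>(i := Suc (\<alpha> i))) j) = (\<Prod>j\<in>{..<m} - {i}. x j ^ \<alpha> j)"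
    by (rule prod.cong) auto
  then show ?thesis using assms by (simp add: monomial_remove)
qed

lemma is_poly_coord: assumes "i < m" shows "is_poly m (\<lambda>x. x i)"
proof -
  have "(\<lambda>x. x i * monomial m (\<lambda>_. 0) x) = (\<lambda>x. 1 * monomial m ((\<lambda>_. 0)(i := Suc 0)) x)"
    using assms by (simp add: coord_times_monomial)
  then have "(\<lambda>x. x i) = (\<lambda>x. 1 * monomial m ((\<lambda>_. 0)(i := Suc 0)) x)"
    by (simp add: monomial_def)
  then show ?thesis by (metis UNIV_I poly_span_monomial)
qed

lemma monomial_has_partial:
  assumes "i < m"
  shows "((\<lambda>t. monomial m \<alpha> (x(i := t))) has_real_derivative
           real (\<alpha> i) * monomial m (\<alpha>(i := \<alpha> i - 1)) x) (at (x i))"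
proof -
  let ?R = "\<Prod>j\<in>{..<m} - {i}. x j ^ \<alpha> j"
  have "(\<Prod>j\<in>{..<m} - {i}. (x(i := t)) j ^ \<alpha> j) = ?R" for t
    by (rule prod.cong) auto
  then have 1: "(\<lambda>t. monomial m \<alpha> (x(i := t))) = (\<lambda>t. t ^ \<alpha> i * ?R)"
    using assms by (simp add: monomial_remove)
  have "(\<Prod>j\<in>{..<m} - {i}. x j ^ (\<alpha>(i := \<alpha> i - 1)) j) = ?R"
    by (rule prod.cong) auto
  then have 2: "monomial m (\<alpha>(i := \<alpha> i - 1)) x = x i ^ (\<alpha> i - 1) * ?R"
    using assms by (simp add: monomial_remove)
  show ?thesis unfolding 1 2 by (auto intro!: derivative_eq_intros)
qed

lemma has_partial:
  assumes "poly_span m A F" "i < m"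
  shows "((\<lambda>t. F (x(i := t))) has_real_derivative partial i F x) (at (x i))"
proof -
  have "\<exists>D. ((\<lambda>t. F (x(i := t))) has_real_derivative D) (at (x i))"
    using assms(1)
  proof (induction rule: poly_span.induct)
    case zero
    show ?case by (intro exI[of _ 0]) simp
  next
    case (add_monomial \<alpha> F c)
    then obtain D where "((\<lambda>t. F (x(i := t))) has_real_derivative D) (at (x i))" by blast
    from DERIV_add[OF DERIV_cmult[OF monomial_has_partial[OF assms(2), of \<alpha> x], of c] this]
    show ?case by blast
  qed
  then show ?thesis by (auto simp: partial_def DERIV_imp_deriv)
qed

lemma partialI: "((\<lambda>t. F (x(i := t))) has_real_derivative D) (at (x i)) \<Longrightarrow> partial i F x = D"
  by (simp add: partial_def DERIV_imp_deriv)

lemma partial_const: "partial i (\<lambda>_. c) x = 0"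
  by (rule partialI) simp

lemma partial_monomial:
  "i < m \<Longrightarrow> partial i (\<lambda>x. c * monomial m \<alpha> x) x = c * (real (\<alpha> i) * monomial m (\<alpha>(i := \<alpha> i - 1)) x)"
  by (intro partialI DERIV_cmult monomial_has_partial)

lemma partial_add:
  assumes "is_poly m F" "is_poly m G" "i < m"
  shows "partial i (\<lambda>x. F x + G x) x = partial i F x + partial i G x"
  by (intro partialI DERIV_add has_partial[OF assms(1,3)] has_partial[OF assms(2,3)])

lemma partial_diff:
  assumes "is_poly m F" "is_poly m G" "i < m"
  shows "partial i (\<lambda>x. F x - G x) x = partial i F x - partial i G x"
  by (intro partialI DERIV_diff has_partial[OF assms(1,3)] has_partial[OF assms(2,3)])

lemma partial_cmult:
  assumes "is_poly m F" "i < m"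
  shows "partial i (\<lambda>x. c * F x) x = c * partial i F x"
  by (intro partialI DERIV_cmult has_partial[OF assms])

lemma partial_sum:
  assumes "\<And>j. j \<in> J \<Longrightarrow> is_poly m (F j)" "i < m"
  shows "partial i (\<lambda>x. \<Sum>j\<in>J. F j x) x = (\<Sum>j\<in>J. partial i (F j) x)"
  by (intro partialI DERIV_sum has_partial[OF assms])

lemma partial_mult:
  assumes "is_poly m F" "is_poly m G" "i < m"
  shows "partial i (\<lambda>x. F x * G x) x = partial i F x * G x + F x * partial i G x"
  using DERIV_mult[OF has_partial[OF assms(1,3), of x] has_partial[OF assms(2,3), of x]]
  by (intro partialI) (simp add: algebra_simps)

lemma partial_power:
  assumes "is_poly m F" "i < m"
  shows "partial i (\<lambda>x. F x ^ k) x = real k * F x ^ (k - 1) * partial i F x"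
  using DERIV_power[OF has_partial[OF assms, of x], of k]
  by (intro partialI) (simp add: algebra_simps)

lemma partial_coord: "partial i (\<lambda>x. x j) x = (if i = j then 1 else 0)"
  by (rule partialI) (auto intro!: derivative_eq_intros)

lemma poly_span_partial:
  assumes "poly_span m A F" "i < m"
    and B: "\<And>\<alpha>. \<alpha> \<in> A \<Longrightarrow> \<alpha> i \<noteq> 0 \<Longrightarrow> \<alpha>(i := \<alpha> i - 1) \<in> B"
  shows "poly_span m B (partial i F)"
  using assms(1)
proof (induction rule: poly_span.induct)
  case zero
  have "partial i (\<lambda>_. 0) = (\<lambda>_. 0)" by (simp add: partial_const fun_eq_iff)
  then show ?case by (simp add: poly_span.zero)
next
  case (add_monomial \<alpha> F c)
  have *: "partial i (\<lambda>x. c * monomial m \<alpha> x + F x)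
      = (\<lambda>x. (c * real (\<alpha> i)) * monomial m (\<alpha>(i := \<alpha> i - 1)) x + partial i F x)"
    using add_monomial.hyps assms(2)
    by (auto simp: fun_eq_iff partial_monomial
        intro!: trans[OF partial_add[OF poly_span_monomial poly_span_is_poly]])
  show ?case
  proof (cases "\<alpha> i = 0")
    case True
    then show ?thesis using add_monomial.IH by (simp add: *)
  next
    case False
    then show ?thesis unfolding *
      by (intro poly_span.add_monomial B add_monomial)
  qed
qed

lemma is_poly_partial: "is_poly m F \<Longrightarrow> i < m \<Longrightarrow> is_poly m (partial i F)"
  by (rule poly_span_partial) auto

lemma poly_deg_partial:
  assumes "poly_deg m (Suc d) F" "i < m" shows "poly_deg m d (partial i F)"
proof (rule poly_span_partial[OF assms])
  fix \<alpha> assume \<alpha>: "\<alpha> \<in> exponents_upto m (Suc d)" "\<alpha> i \<noteq> 0"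
  have "sum \<alpha> {..<m} = \<alpha> i + sum \<alpha> ({..<m} - {i})"
    using assms(2) by (subst sum.remove[of _ i]) auto
  moreover have "sum (\<alpha>(i := \<alpha> i - 1)) {..<m} = (\<alpha> i - 1) + sum \<alpha> ({..<m} - {i})"
    using assms(2) by (subst sum.remove[of _ i]) (auto intro!: sum.cong)
  ultimately show "\<alpha>(i := \<alpha> i - 1) \<in> exponents_upto m d"
    using \<alpha> by (auto simp: exponents_upto_def)
qed

lemma partial_commute:
  assumes "is_poly m F" "i < m" "j < m"
  shows "partial i (partial j F) x = partial j (partial i F) x"
  using assms(1)
proof (induction arbitrary: x rule: poly_span.induct)
  case zero
  have "partial k (\<lambda>_. 0) = (\<lambda>_. 0)" for k by (simp add: partial_const fun_eq_iff)
  then show ?case by simp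
next
  case (add_monomial \<alpha> F c)
  have 1: "partial k (\<lambda>x. c * monomial m \<alpha> x + F x)
      = (\<lambda>x. (c * real (\<alpha> k)) * monomial m (\<alpha>(k := \<alpha> k - 1)) x + partial k F x)" if "k < m" for k
    using that add_monomial.hyps
    by (auto simp: fun_eq_iff partial_monomial intro!: trans[OF partial_add[OF poly_span_monomial]])
  have 2: "partial l (partial k (\<lambda>x. c * monomial m \<alpha> x + F x)) x
      = (c * real (\<alpha> k)) * (real ((\<alpha>(k := \<alpha> k - 1)) l)
          * monomial m ((\<alpha>(k := \<alpha> k - 1))(l := (\<alpha>(k := \<alpha> k - 1)) l - 1)) x)
        + partial l (partial k F) x" if "k < m" "l < m" for k l
    unfolding 1[OF that(1)] using that add_monomial.hyps
    by (subst partial_add[OF poly_span_monomial])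
       (auto simp: partial_monomial intro: is_poly_partial)
  show ?case using assms(2,3) add_monomial.IH
    by (cases "i = j") (simp_all add: 2 fun_upd_twist)
qed

lemmas is_poly_intros = is_poly_const is_poly_coord is_poly_mult is_poly_power is_poly_partial
  poly_span_add poly_span_diff poly_span_sum

section \<open>Gaussian integration by parts\<close>

definition normal_moment :: "nat \<Rightarrow> real" where
  "normal_moment k = (\<integral>x. std_normal_density x * x ^ k \<partial>lborel)"

text \<open>
  This is integration by parts for the powers of one standard normal variable; together with
  independence it yields the formula for all polynomials.
\<close>

lemma normal_moment_recursion: "normal_moment (Suc k) = real k * normal_moment (k - 1)"
proof (cases "even k")
  case True
  then obtain l where "k = 2 * l" by (elim evenE)
  moreover have "even k \<Longrightarrow> k \<noteq> 0 \<Longrightarrow> odd (k - 1)" by simp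
  ultimately show ?thesis
    using integral_std_normal_moment_odd[of l] integral_std_normal_moment_odd[of "l - 1"]
    by (cases l) (simp_all add: normal_moment_def)
next
  case False
  then obtain l where l: "k = Suc (2 * l)" using oddE by fastforce
  have "Suc k = 2 * Suc l" "k - 1 = 2 * l" using l by simp_all
  then have "normal_moment (Suc k) = fact (2 * Suc l) / (2 ^ Suc l * fact (Suc l))"
    "normal_moment (k - 1) = fact (2 * l) / (2 ^ l * fact l)"
    unfolding normal_moment_def using integral_std_normal_moment_even by metis+
  moreover have "fact (2 * Suc l) = 2 * real (Suc l) * real (Suc (2 * l)) * fact (2 * l)"
    by (simp add: algebra_simps)
  moreover have "fact (Suc l) = real (Suc l) * fact l" by simp
  ultimately show ?thesis by (simp add: l del: fact_Suc of_nat_Suc)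
qed

locale gaussian_family = prob_space M for M :: "'w measure" +
  fixes m :: nat and \<xi> :: "nat \<Rightarrow> 'w \<Rightarrow> real"
  assumes indep: "indep_vars (\<lambda>_. borel) \<xi> {..<m}"
    and normal: "\<And>i. i < m \<Longrightarrow> distributed M lborel (\<xi> i) (\<lambda>x. ennreal (std_normal_density x))"
begin

abbreviation \<Xi> :: "'w \<Rightarrow> nat \<Rightarrow> real" where "\<Xi> \<omega> i \<equiv> \<xi> i \<omega>"

definition \<E> :: "((nat \<Rightarrow> real) \<Rightarrow> real) \<Rightarrow> real" where
  "\<E> F = expectation (\<lambda>\<omega>. F (\<Xi> \<omega>))"

lemma measurable_xi [measurable]: "i < m \<Longrightarrow> \<xi> i \<in> borel_measurable M"
  using indep by (auto simp: indep_vars_def)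

lemma moment_xi:
  assumes "i < m"
  shows "integrable M (\<lambda>\<omega>. \<xi> i \<omega> ^ k)" "expectation (\<lambda>\<omega>. \<xi> i \<omega> ^ k) = normal_moment k"
  using distributed_integrable[OF normal[OF assms], of "\<lambda>x. x ^ k"]
    distributed_integral[OF normal[OF assms], of "\<lambda>x. x ^ k"] integrable_std_normal_moment[of k]
  by (simp_all add: normal_moment_def)

lemma monomial_moment:
  shows integrable_monomial: "integrable M (\<lambda>\<omega>. monomial m \<alpha> (\<Xi> \<omega>))"
    and Ex_monomial: "\<E> (monomial m \<alpha>) = (\<Prod>i<m. normal_moment (\<alpha> i))"
proof -
  have "indep_vars (\<lambda>_. borel) (\<lambda>i \<omega>. \<xi> i \<omega> ^ \<alpha> i) {..<m}"
    by (rule indep_vars_compose2[OF indep]) simp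
  then show "integrable M (\<lambda>\<omega>. monomial m \<alpha> (\<Xi> \<omega>))"
    and "\<E> (monomial m \<alpha>) = (\<Prod>i<m. normal_moment (\<alpha> i))"
    unfolding monomial_def \<E>_def
    using indep_vars_lebesgue_integral[where I="{..<m}" and X="\<lambda>i \<omega>. \<xi> i \<omega> ^ \<alpha> i"]
      indep_vars_integrable[where I="{..<m}" and X="\<lambda>i \<omega>. \<xi> i \<omega> ^ \<alpha> i"]
    by (simp_all add: moment_xi)
qed

lemma integrable_poly: "is_poly m F \<Longrightarrow> integrable M (\<lambda>\<omega>. F (\<Xi> \<omega>))"
  by (induction rule: poly_span.induct) (auto intro!: integrable_monomial Bochner_Integration.integrable_add)

lemma measurable_poly: "is_poly m F \<Longrightarrow> (\<lambda>\<omega>. F (\<Xi> \<omega>)) \<in> borel_measurable M"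
  using integrable_poly by blast

lemma Ex_add: "is_poly m F \<Longrightarrow> is_poly m G \<Longrightarrow> \<E> (\<lambda>x. F x + G x) = \<E> F + \<E> G"
  and Ex_diff: "is_poly m F \<Longrightarrow> is_poly m G \<Longrightarrow> \<E> (\<lambda>x. F x - G x) = \<E> F - \<E> G"
  unfolding \<E>_def by (simp_all add: integrable_poly)

lemma Ex_sum: "(\<And>j. j \<in> J \<Longrightarrow> is_poly m (F j)) \<Longrightarrow> \<E> (\<lambda>x. \<Sum>j\<in>J. F j x) = (\<Sum>j\<in>J. \<E> (F j))"
  unfolding \<E>_def by (simp add: integrable_poly)

lemma Ex_cmult: "\<E> (\<lambda>x. c * F x) = c * \<E> F"
  unfolding \<E>_def by simp

lemma Ex_const: "\<E> (\<lambda>x. c) = c"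
  unfolding \<E>_def by (simp add: prob_space)

lemma Ex_nonneg: "(\<And>x. F x \<ge> 0) \<Longrightarrow> \<E> F \<ge> 0"
  unfolding \<E>_def by simp

lemma Ex_mono: "is_poly m F \<Longrightarrow> is_poly m G \<Longrightarrow> (\<And>x. F x \<le> G x) \<Longrightarrow> \<E> F \<le> \<E> G"
  unfolding \<E>_def by (intro integral_mono integrable_poly)

lemma Ex_monomial_remove:
  "i < m \<Longrightarrow> \<E> (monomial m \<alpha>) = normal_moment (\<alpha> i) * (\<Prod>j\<in>{..<m} - {i}. normal_moment (\<alpha> j))"
  unfolding Ex_monomial by (subst prod.remove[of _ i]) auto

text \<open>
  Both sides are linear in \<open>F\<close>.  On a monomial the expectation factorises, and only the factor of the
  coordinate \<open>i\<close> differs on the two sides.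
\<close>

lemma Ex_partial:
  assumes "is_poly m F" "i < m"
  shows "\<E> (partial i F) = \<E> (\<lambda>x. x i * F x)"
  using assms(1)
proof (induction rule: poly_span.induct)
  case zero
  then show ?case by (simp add: \<E>_def partial_const)
next
  case (add_monomial \<alpha> F c)
  note poly = add_monomial.hyps(2) poly_span_monomial[of _ UNIV m, simplified]
  have "(\<Prod>j\<in>{..<m} - {i}. normal_moment ((\<alpha>(i := k)) j))
      = (\<Prod>j\<in>{..<m} - {i}. normal_moment (\<alpha> j))" for k
    by (rule prod.cong) auto
  then have mon: "real (\<alpha> i) * \<E> (monomial m (\<alpha>(i := \<alpha> i - 1)))
      = \<E> (monomial m (\<alpha>(i := Suc (\<alpha> i))))"
    using assms(2) by (simp add: Ex_monomial_remove normal_moment_recursion)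
  have "\<E> (partial i (\<lambda>x. c * monomial m \<alpha> x + F x))
      = \<E> (\<lambda>x. (c * real (\<alpha> i)) * monomial m (\<alpha>(i := \<alpha> i - 1)) x + partial i F x)"
    using assms(2) poly by (simp add: partial_add[where m=m] partial_monomial \<E>_def mult.assoc)
  also have "\<dots> = c * (real (\<alpha> i) * \<E> (monomial m (\<alpha>(i := \<alpha> i - 1)))) + \<E> (partial i F)"
    using assms(2) poly by (subst Ex_add) (auto simp: Ex_cmult intro: is_poly_partial)
  also have "\<dots> = c * \<E> (monomial m (\<alpha>(i := Suc (\<alpha> i)))) + \<E> (\<lambda>x. x i * F x)"
    unfolding mon add_monomial.IH ..
  also have "\<dots> = \<E> (\<lambda>x. c * monomial m (\<alpha>(i := Suc (\<alpha> i))) x + x i * F x)"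
    using assms(2) poly by (subst Ex_add) (auto simp: Ex_cmult intro: is_poly_intros)
  also have "\<dots> = \<E> (\<lambda>x. x i * (c * monomial m \<alpha> x + F x))"
    using assms(2) by (simp add: coord_times_monomial[symmetric] algebra_simps)
  finally show ?case .
qed

lemma Ex_partial_mult:
  assumes "is_poly m F" "is_poly m G" "i < m"
  shows "\<E> (\<lambda>x. partial i F x * G x) = \<E> (\<lambda>x. F x * (x i * G x - partial i G x))"
proof -
  have "\<E> (\<lambda>x. partial i F x * G x + F x * partial i G x) = \<E> (\<lambda>x. x i * (F x * G x))"
    using Ex_partial[of "\<lambda>x. F x * G x" i] assms
    by (simp add: is_poly_mult partial_mult[where m=m] \<E>_def)
  moreover have "\<E> (\<lambda>x. partial i F x * G x + F x * partial i G x)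
      = \<E> (\<lambda>x. partial i F x * G x) + \<E> (\<lambda>x. F x * partial i G x)"
    using assms by (intro Ex_add is_poly_intros)
  moreover have "\<E> (\<lambda>x. F x * (x i * G x) - F x * partial i G x)
      = \<E> (\<lambda>x. F x * (x i * G x)) - \<E> (\<lambda>x. F x * partial i G x)"
    using assms by (intro Ex_diff is_poly_intros)
  ultimately show ?thesis by (simp add: algebra_simps)
qed

end

section \<open>The number operator\<close>

text \<open>
  The negative Ornstein-Uhlenbeck generator.  By Gaussian integration by parts it is the operator of
  the Dirichlet form \<open>\<Sum>\<^sub>i E[\<partial>\<^sub>i F \<partial>\<^sub>i G]\<close>, and its eigenspace for the eigenvalue \<open>k\<close> is the Wiener chaos of
  order \<open>k\<close>.
\<close>

definition number_op :: "nat \<Rightarrow> ((nat \<Rightarrow> real) \<Rightarrow> real) \<Rightarrow> (nat \<Rightarrow> real) \<Rightarrow> real" where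
  "number_op m F x = (\<Sum>i<m. x i * partial i F x - partial i (partial i F) x)"

lemma is_poly_number_op: "is_poly m F \<Longrightarrow> is_poly m (number_op m F)"
  unfolding number_op_def [abs_def]
  by (intro poly_span_sum poly_span_diff is_poly_mult is_poly_coord is_poly_partial) auto

lemma number_op_diff:
  assumes "is_poly m F" "is_poly m G"
  shows "number_op m (\<lambda>x. F x - G x) x = number_op m F x - number_op m G x"
proof -
  have "partial i (\<lambda>x. F x - G x) = (\<lambda>x. partial i F x - partial i G x)" if "i < m" for i
    using assms that by (simp add: fun_eq_iff partial_diff[where m=m])
  then show ?thesis using assms
    by (simp add: number_op_def partial_diff[where m=m] is_poly_partial sum_subtractf[symmetric] algebra_simps)
qed

lemma number_op_cmult:
  assumes "is_poly m F"
  shows "number_op m (\<lambda>x. c * F x) x = c * number_op m F x"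
proof -
  have "partial i (\<lambda>x. c * F x) = (\<lambda>x. c * partial i F x)" if "i < m" for i
    using assms that by (simp add: fun_eq_iff partial_cmult[where m=m])
  then show ?thesis using assms
    by (simp add: number_op_def partial_cmult[where m=m] is_poly_partial sum_distrib_left algebra_simps)
qed

lemma number_op_square:
  assumes "is_poly m F"
  shows "number_op m (\<lambda>x. (F x)\<^sup>2) x = 2 * F x * number_op m F x - 2 * (\<Sum>i<m. (partial i F x)\<^sup>2)"
proof -
  have 1: "partial i (\<lambda>x. (F x)\<^sup>2) = (\<lambda>x. 2 * (F x * partial i F x))" if "i < m" for i
    using assms that by (simp add: fun_eq_iff partial_power[where m=m])
  have 2: "partial i (\<lambda>x. 2 * (F x * partial i F x)) x
      = 2 * (partial i F x * partial i F x + F x * partial i (partial i F) x)" if "i < m" for i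
    using assms that
    by (subst partial_cmult[where m=m]) (auto simp: partial_mult[where m=m] is_poly_partial is_poly_mult)
  show ?thesis
    unfolding number_op_def sum_distrib_left sum_subtractf[symmetric]
    by (rule sum.cong, simp, simp add: 1 2) (simp add: algebra_simps power2_eq_square)
qed

lemma partial_number_op:
  assumes "is_poly m F" "j < m"
  shows "partial j (number_op m F) x = number_op m (partial j F) x + partial j F x"
proof -
  have "partial j (number_op m F) x
      = (\<Sum>i<m. partial j (\<lambda>x. x i * partial i F x - partial i (partial i F) x) x)"
    unfolding number_op_def [abs_def] using assms
    by (intro partial_sum[where m=m]) (auto intro!: is_poly_intros)
  also have "\<dots> = (\<Sum>i<m. (x i * partial i (partial j F) x - partial i (partial i (partial j F)) x)
      + (if j = i then partial j F x else 0))"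
  proof (rule sum.cong)
    fix i assume "i \<in> {..<m}"
    then have i: "i < m" by simp
    have comm: "partial j (partial i F) = partial i (partial j F)"
      using assms i by (auto simp: fun_eq_iff intro: partial_commute[where m=m])
    have "partial j (partial i (partial i F)) x = partial i (partial j (partial i F)) x"
      using assms i by (intro partial_commute[where m=m] is_poly_partial)
    then have comm2: "partial j (partial i (partial i F)) x = partial i (partial i (partial j F)) x"
      by (simp add: comm)
    have "partial j (\<lambda>x. x i * partial i F x - partial i (partial i F) x) x
        = (partial j (\<lambda>x. x i) x * partial i F x + x i * partial j (partial i F) x)
          - partial j (partial i (partial i F)) x"
      using assms i
      by (subst partial_diff[where m=m]) (auto intro!: is_poly_intros partial_mult[where m=m])
    then show "partial j (\<lambda>x. x i * partial i F x - partial i (partial i F) x) x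
        = (x i * partial i (partial j F) x - partial i (partial i (partial j F)) x)
          + (if j = i then partial j F x else 0)"
      by (simp add: partial_coord comm comm2)
  qed simp
  also have "\<dots> = number_op m (partial j F) x + partial j F x"
    using assms(2) by (simp add: sum.distrib number_op_def)
  finally show ?thesis .
qed

context gaussian_family
begin

lemma Ex_number_op:
  assumes "is_poly m F" "is_poly m G"
  shows "\<E> (\<lambda>x. F x * number_op m G x) = (\<Sum>i<m. \<E> (\<lambda>x. partial i F x * partial i G x))"
proof -
  have "\<E> (\<lambda>x. F x * number_op m G x)
      = \<E> (\<lambda>x. \<Sum>i<m. F x * (x i * partial i G x - partial i (partial i G) x))"
    by (simp add: number_op_def sum_distrib_left)
  also have "\<dots> = (\<Sum>i<m. \<E> (\<lambda>x. F x * (x i * partial i G x - partial i (partial i G) x)))"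
    using assms by (intro Ex_sum) (auto intro!: is_poly_intros)
  also have "\<dots> = (\<Sum>i<m. \<E> (\<lambda>x. partial i F x * partial i G x))"
    using assms by (intro sum.cong) (auto simp: Ex_partial_mult is_poly_partial)
  finally show ?thesis .
qed

text \<open>
  The number operator acts on the chaos of order \<open>k\<close> as multiplication by \<open>k\<close>, so it is bounded by
  \<open>d\<close> on polynomials of degree at most \<open>d\<close>.  A chaos expansion can be avoided: by the commutation rule
  \<open>\<partial>\<^sub>j N = (N + 1) \<partial>\<^sub>j\<close>, the left-hand side is a sum over the partial derivatives, whose degree is
  smaller; the induction hypothesis implies that their Dirichlet forms are at most the degree bound
  times their second moments.
\<close>

lemma number_op_bound:
  "poly_deg m d F \<Longrightarrow> \<E> (\<lambda>x. (number_op m F x)\<^sup>2) \<le> real d * \<E> (\<lambda>x. F x * number_op m F x)"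
proof (induction d arbitrary: F)
  case 0
  have "partial i F x = 0" if "i < m" for i x
    using 0
  proof (induction rule: poly_span.induct)
    case (add_monomial \<alpha> F c)
    then have "\<alpha> i = 0" using that by (auto simp: exponents_upto_def)
    have "partial i (\<lambda>x. c * monomial m \<alpha> x + F x) x
        = partial i (\<lambda>x. c * monomial m \<alpha> x) x + partial i F x"
      using add_monomial that
      by (intro partial_add[where m=m] poly_span_monomial) (auto intro: poly_span_is_poly)
    then show ?case using add_monomial.IH that \<open>\<alpha> i = 0\<close> by (simp add: partial_monomial)
  qed (simp add: partial_const)
  then have "partial i F = (\<lambda>_. 0)" if "i < m" for i using that by auto
  then have "number_op m F x = 0" for x by (simp add: number_op_def partial_const)
  then show ?case by (simp add: \<E>_def)
next
  case (Suc d)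
  have F: "is_poly m F" using Suc.prems by (rule poly_span_is_poly)
  have dirichlet: "\<E> (\<lambda>x. G x * number_op m G x) \<le> real d * \<E> (\<lambda>x. (G x)\<^sup>2)"
    if G: "poly_deg m d G" for G
  proof -
    have pG: "is_poly m G" using G by (rule poly_span_is_poly)
    note pN = is_poly_number_op[OF pG]
    have "\<E> (\<lambda>x. (number_op m G x - real d * G x)\<^sup>2) =
        \<E> (\<lambda>x. (number_op m G x)\<^sup>2 + ((real d)\<^sup>2 * (G x)\<^sup>2 - (2 * real d) * (G x * number_op m G x)))"
      by (simp add: power2_eq_square algebra_simps)
    also have "\<dots> = \<E> (\<lambda>x. (number_op m G x)\<^sup>2)
        + ((real d)\<^sup>2 * \<E> (\<lambda>x. (G x)\<^sup>2) - (2 * real d) * \<E> (\<lambda>x. G x * number_op m G x))"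
      unfolding Ex_cmult[symmetric]
      by (subst Ex_diff[symmetric], (intro is_poly_intros poly_span_scale pG pN)+)
         (intro Ex_add is_poly_intros poly_span_scale pG pN)
    finally have "0 \<le> \<E> (\<lambda>x. (number_op m G x)\<^sup>2)
        + ((real d)\<^sup>2 * \<E> (\<lambda>x. (G x)\<^sup>2) - (2 * real d) * \<E> (\<lambda>x. G x * number_op m G x))"
      using Ex_nonneg[of "\<lambda>x. (number_op m G x - real d * G x)\<^sup>2"] by simp
    with Suc.IH[OF G] have *: "real d * \<E> (\<lambda>x. G x * number_op m G x) \<le> real d * (real d * \<E> (\<lambda>x. (G x)\<^sup>2))"
      by (simp add: power2_eq_square algebra_simps)
    show ?thesis
    proof (cases "d = 0")
      case True
      have "\<E> (\<lambda>x. (number_op m G x)\<^sup>2) = 0"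
        using Suc.IH[OF G] Ex_nonneg[of "\<lambda>x. (number_op m G x)\<^sup>2"] True by simp
      then have "AE \<omega> in M. (number_op m G (\<Xi> \<omega>))\<^sup>2 = 0"
        unfolding \<E>_def using pN
        by (subst (asm) integral_nonneg_eq_0_iff_AE) (auto intro!: integrable_poly[of "\<lambda>x. (number_op m G x)\<^sup>2"] is_poly_intros)
      then have "\<E> (\<lambda>x. G x * number_op m G x) = 0"
        unfolding \<E>_def by (intro integral_eq_zero_AE) auto
      then show ?thesis using True by simp
    qed (use * in simp)
  qed
  have "\<E> (\<lambda>x. (number_op m F x)\<^sup>2) = \<E> (\<lambda>x. number_op m F x * number_op m F x)"
    by (simp add: power2_eq_square)
  also have "\<dots> = (\<Sum>i<m. \<E> (\<lambda>x. partial i (number_op m F) x * partial i F x))"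
    by (intro Ex_number_op is_poly_number_op F)
  also have "\<dots> = (\<Sum>i<m. \<E> (\<lambda>x. partial i F x * number_op m (partial i F) x + (partial i F x)\<^sup>2))"
    by (intro sum.cong) (auto simp: partial_number_op[OF F] algebra_simps power2_eq_square)
  also have "\<dots> = (\<Sum>i<m. \<E> (\<lambda>x. partial i F x * number_op m (partial i F) x) + \<E> (\<lambda>x. (partial i F x)\<^sup>2))"
    using F by (intro sum.cong Ex_add) (auto intro!: is_poly_intros is_poly_number_op)
  also have "\<dots> \<le> (\<Sum>i<m. real d * \<E> (\<lambda>x. (partial i F x)\<^sup>2) + \<E> (\<lambda>x. (partial i F x)\<^sup>2))"
    using Suc.prems by (intro sum_mono add_mono dirichlet order_refl poly_deg_partial) auto
  also have "\<dots> = real (Suc d) * (\<Sum>i<m. \<E> (\<lambda>x. partial i F x * partial i F x))"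
    by (simp add: sum_distrib_left algebra_simps power2_eq_square sum.distrib)
  also have "\<dots> = real (Suc d) * \<E> (\<lambda>x. F x * number_op m F x)"
    by (simp add: Ex_number_op F)
  finally show ?case .
qed

end

section \<open>Distance of a chaos element to the Gamma law\<close>

text \<open>
  If \<open>N P = q P\<close>, the integration by parts formula reads \<open>E[P \<phi>(P)] = E[\<Gamma> \<phi>'(P)]\<close> with this function
  as \<open>\<Gamma>\<close>.
\<close>

definition stein_kernel :: "nat \<Rightarrow> nat \<Rightarrow> ((nat \<Rightarrow> real) \<Rightarrow> real) \<Rightarrow> (nat \<Rightarrow> real) \<Rightarrow> real" where
  "stein_kernel m q P x = (\<Sum>i<m. (partial i P x)\<^sup>2) / real q"

lemma is_poly_stein_kernel:
  assumes "is_poly m P" shows "is_poly m (stein_kernel m q P)"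
proof -
  have "is_poly m (\<lambda>x. \<Sum>i<m. (partial i P x)\<^sup>2)"
    using assms by (intro is_poly_intros) auto
  from poly_span_scale[OF this, of "1 / real q"] show ?thesis
    by (simp add: stein_kernel_def [abs_def])
qed

context gaussian_family
begin

text \<open>
  The case \<open>\<phi>(x) = x\<^sup>k\<close> of \<open>E[P \<phi>(P)] = E[\<Gamma> \<phi>'(P)]\<close>.
\<close>

lemma Ex_power_Suc:
  assumes P: "is_poly m P" and eigen: "\<And>x. number_op m P x = real q * P x" and "q > 0"
  shows "\<E> (\<lambda>x. P x ^ Suc k) = real k * \<E> (\<lambda>x. P x ^ (k - 1) * stein_kernel m q P x)"
proof -
  have "real q * \<E> (\<lambda>x. P x ^ Suc k) = \<E> (\<lambda>x. P x ^ k * number_op m P x)"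
    by (simp add: eigen Ex_cmult[symmetric] algebra_simps)
  also have "\<dots> = (\<Sum>i<m. \<E> (\<lambda>x. partial i (\<lambda>x. P x ^ k) x * partial i P x))"
    using P by (intro Ex_number_op is_poly_power)
  also have "\<dots> = (\<Sum>i<m. \<E> (\<lambda>x. real k * (P x ^ (k - 1) * (partial i P x)\<^sup>2)))"
    using P by (intro sum.cong) (auto simp: partial_power[where m=m] power2_eq_square algebra_simps)
  also have "\<dots> = \<E> (\<lambda>x. \<Sum>i<m. real k * (P x ^ (k - 1) * (partial i P x)\<^sup>2))"
    using P by (intro Ex_sum[symmetric]) (auto intro!: is_poly_intros)
  also have "\<dots> = \<E> (\<lambda>x. (real q * real k) * (P x ^ (k - 1) * stein_kernel m q P x))"
    using \<open>q > 0\<close>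
    by (intro arg_cong[where f=\<E>] ext) (simp add: stein_kernel_def sum_distrib_left[symmetric])
  also have "\<dots> = real q * (real k * \<E> (\<lambda>x. P x ^ (k - 1) * stein_kernel m q P x))"
    unfolding Ex_cmult by simp
  finally show ?thesis using \<open>q > 0\<close> by simp
qed

text \<open>
  Since \<open>N(P\<^sup>2) = 2 q (P\<^sup>2 - \<Gamma>)\<close>, the function \<open>B = P\<^sup>2 - \<Gamma> - 2 P\<close> is \<open>N U / (2 q)\<close> for \<open>U = P\<^sup>2 - 4 P\<close>,
  and \<open>U - B = \<Gamma> - 2 P\<close>.  The spectral bound for \<open>U\<close> says \<open>E[B (U - B)] \<ge> 0\<close>.  By the moment identities
  for \<open>E[P\<^sup>k \<Gamma>]\<close>, the left-hand side below plus \<open>E[B (U - B)]\<close> is exactly the right-hand side, because the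
  terms with \<open>\<Gamma>\<^sup>2\<close> cancel.
\<close>

theorem stein_discrepancy_bound:
  assumes deg: "poly_deg m q P" and eigen: "\<And>x. number_op m P x = real q * P x" and "q > 0"
  shows "\<E> (\<lambda>x. (stein_kernel m q P x - 2 * P x - \<E> (\<lambda>x. (P x)\<^sup>2))\<^sup>2)
    \<le> (\<E> (\<lambda>x. P x ^ 4) - 3 * (\<E> (\<lambda>x. (P x)\<^sup>2))\<^sup>2 - 12 * \<E> (\<lambda>x. P x ^ 3) + 24 * \<E> (\<lambda>x. (P x)\<^sup>2)) / 3"
proof -
  have P: "is_poly m P" using deg by (rule poly_span_is_poly)
  let ?G = "stein_kernel m q P"
  have G: "is_poly m ?G" using P by (rule is_poly_stein_kernel)
  note PG = P G is_poly_const
  note poly = is_poly_intros PG poly_span_scale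
  define s where "s = \<E> (\<lambda>x. (P x)\<^sup>2)"
  note moment = Ex_power_Suc[OF P eigen \<open>q > 0\<close>]
  have m1: "\<E> P = 0" using moment[of 0] by simp
  have m2: "\<E> ?G = s" using moment[of 1] by (simp add: s_def power2_eq_square)
  have m3: "\<E> (\<lambda>x. P x * ?G x) = \<E> (\<lambda>x. P x ^ 3) / 2"
    using moment[of 2] by (simp add: power3_eq_cube algebra_simps numeral_eq_Suc)
  have m4: "\<E> (\<lambda>x. (P x)\<^sup>2 * ?G x) = \<E> (\<lambda>x. P x ^ 4) / 3"
    using moment[of 3] by (simp add: numeral_eq_Suc)
  define B where "B x = (P x)\<^sup>2 - ?G x - 2 * P x" for x
  have B: "is_poly m B" unfolding B_def [abs_def] by (intro poly)
  define U where "U x = (P x)\<^sup>2 - 4 * P x" for x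
  have NU: "number_op m U x = 2 * real q * B x" for x
  proof -
    have "number_op m U x = number_op m (\<lambda>x. (P x)\<^sup>2) x - number_op m (\<lambda>x. 4 * P x) x"
      unfolding U_def [abs_def] by (intro number_op_diff poly)
    also have "\<dots> = 2 * P x * (real q * P x) - 2 * (real q * ?G x) - 4 * (real q * P x)"
      using \<open>q > 0\<close> by (simp add: number_op_square[OF P] number_op_cmult[OF P] eigen stein_kernel_def)
    finally show ?thesis by (simp add: B_def power2_eq_square algebra_simps)
  qed
  have "poly_deg m (q + q) P"
    using deg by (rule poly_span_mono) (auto simp: exponents_upto_def)
  from poly_span_diff[OF poly_deg_mult[OF deg deg] poly_span_scale[OF this, of 4]]
  have "poly_deg m (2 * q) U"
    by (simp add: U_def [abs_def] power2_eq_square mult_2)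
  from number_op_bound[OF this]
  have "\<E> (\<lambda>x. (2 * real q)\<^sup>2 * (B x)\<^sup>2) \<le> (2 * real q) * \<E> (\<lambda>x. (2 * real q) * (U x * B x))"
    by (simp add: NU power_mult_distrib algebra_simps)
  then have "(2 * real q)\<^sup>2 * \<E> (\<lambda>x. (B x)\<^sup>2) \<le> (2 * real q)\<^sup>2 * \<E> (\<lambda>x. U x * B x)"
    unfolding Ex_cmult by (simp add: power2_eq_square algebra_simps)
  then have "\<E> (\<lambda>x. (B x)\<^sup>2) \<le> \<E> (\<lambda>x. U x * B x)" using \<open>q > 0\<close> by simp
  moreover have "\<E> (\<lambda>x. U x * B x - (B x)\<^sup>2) = \<E> (\<lambda>x. U x * B x) - \<E> (\<lambda>x. (B x)\<^sup>2)"
    unfolding U_def by (intro Ex_diff poly B)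
  ultimately have pos: "0 \<le> \<E> (\<lambda>x. U x * B x - (B x)\<^sup>2)" by simp
  have "\<E> (\<lambda>x. (?G x - 2 * P x - s)\<^sup>2) + \<E> (\<lambda>x. U x * B x - (B x)\<^sup>2)
      = \<E> (\<lambda>x. (?G x - 2 * P x - s)\<^sup>2 + (U x * B x - (B x)\<^sup>2))"
    unfolding U_def by (intro Ex_add[symmetric] poly B)
  also have "\<dots> = \<E> (\<lambda>x. (P x)\<^sup>2 * ?G x - 4 * (P x * ?G x) - 2 * P x ^ 3 + 8 * (P x)\<^sup>2
      - 2 * s * ?G x + 4 * s * P x + s\<^sup>2)"
    by (simp add: U_def B_def power2_eq_square power3_eq_cube algebra_simps)
  also have "\<dots> = \<E> (\<lambda>x. (P x)\<^sup>2 * ?G x) - 4 * \<E> (\<lambda>x. P x * ?G x) - 2 * \<E> (\<lambda>x. P x ^ 3)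
      + 8 * \<E> (\<lambda>x. (P x)\<^sup>2) - 2 * s * \<E> ?G + 4 * s * \<E> P + s\<^sup>2"
    by (subst Ex_add Ex_diff, (intro poly; fail), (intro poly; fail))+
       (simp add: Ex_cmult Ex_const)
  also have "\<dots> = (\<E> (\<lambda>x. P x ^ 4) - 3 * s\<^sup>2 - 12 * \<E> (\<lambda>x. P x ^ 3) + 24 * s) / 3"
    unfolding m1 m2 m3 m4 s_def[symmetric] by (simp add: power2_eq_square)
  finally show ?thesis using pos by (simp add: s_def)
qed

end

section \<open>Multilinear polynomials\<close>

definition multilinear_upto :: "nat \<Rightarrow> nat \<Rightarrow> (nat \<Rightarrow> nat) set" where
  "multilinear_upto n q = {\<alpha>. (\<forall>i. \<alpha> i \<le> 1) \<and> (\<forall>i\<ge>n. \<alpha> i = 0) \<and> sum \<alpha> {..<n} \<le> q}"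

definition multilinear_homogeneous :: "nat \<Rightarrow> nat \<Rightarrow> (nat \<Rightarrow> nat) set" where
  "multilinear_homogeneous n q = {\<alpha>. (\<forall>i. \<alpha> i \<le> 1) \<and> (\<forall>i\<ge>n. \<alpha> i = 0) \<and> sum \<alpha> {..<n} = q}"

lemma multilinear_homogeneous_subset: "multilinear_homogeneous n q \<subseteq> multilinear_upto n q"
  by (auto simp: multilinear_homogeneous_def multilinear_upto_def)

lemma poly_span_cong:
  assumes "poly_span m A F" and eq: "\<And>\<alpha> j. \<alpha> \<in> A \<Longrightarrow> j < m \<Longrightarrow> \<alpha> j \<noteq> 0 \<Longrightarrow> x j = y j"
  shows "F x = F y"
  using assms(1)
proof (induction rule: poly_span.induct)
  case (add_monomial \<alpha> F c)
  have "monomial m \<alpha> x = monomial m \<alpha> y"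
    unfolding monomial_def
  proof (rule prod.cong)
    fix j assume "j \<in> {..<m}"
    then show "x j ^ \<alpha> j = y j ^ \<alpha> j"
      using eq[OF add_monomial.hyps(1), of j] by (cases "\<alpha> j = 0") auto
  qed simp
  then show ?case using add_monomial.IH by simp
qed simp

lemma partial_independent:
  assumes "poly_span m {\<alpha>. \<alpha> i = 0} F"
  shows "partial i F x = 0"
proof -
  have "F (x(i := t)) = F x" for t
    by (rule poly_span_cong[OF assms]) auto
  then show ?thesis by (simp add: partial_def)
qed

lemma poly_span_partial_multilinear:
  assumes "poly_span m {\<alpha>. \<alpha> i \<le> 1} F" "i < m"
  shows "poly_span m {\<alpha>. \<alpha> i = 0} (partial i F)"
  by (rule poly_span_partial[OF assms]) auto

text \<open>
  A multilinear polynomial is affine in each variable.  This allows the exact computation of the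
  Gaussian integral over one variable in \<open>stein_coordinate\<close>.
\<close>

lemma affine_in_coordinate:
  assumes "poly_span m {\<alpha>. \<alpha> i \<le> 1} F" "i < m"
  shows "F x = F (x(i := 0)) + x i * partial i F x"
  using assms(1)
proof (induction rule: poly_span.induct)
  case zero
  show ?case by (simp add: partial_const)
next
  case (add_monomial \<alpha> F c)
  have "partial i (\<lambda>x. c * monomial m \<alpha> x + F x) x
      = partial i (\<lambda>x. c * monomial m \<alpha> x) x + partial i F x"
    using add_monomial.hyps assms(2)
    by (intro partial_add[where m=m] poly_span_monomial) (auto intro: poly_span_is_poly)
  also have "partial i (\<lambda>x. c * monomial m \<alpha> x) x = c * (real (\<alpha> i) * monomial m (\<alpha>(i := \<alpha> i - 1)) x)"
    using assms(2) by (rule partial_monomial)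
  finally have 1: "partial i (\<lambda>x. c * monomial m \<alpha> x + F x) x
    = c * (real (\<alpha> i) * monomial m (\<alpha>(i := \<alpha> i - 1)) x) + partial i F x" .
  have 2: "monomial m \<alpha> x = monomial m \<alpha> (x(i := 0)) + x i * (real (\<alpha> i) * monomial m (\<alpha>(i := \<alpha> i - 1)) x)"
  proof (cases "\<alpha> i = 0")
    case True
    have "poly_span m {\<alpha>} (\<lambda>x. 1 * monomial m \<alpha> x)" by (intro poly_span_monomial) simp
    then have "1 * monomial m \<alpha> x = 1 * monomial m \<alpha> (x(i := 0))"
      by (rule poly_span_cong) (use True in auto)
    then show ?thesis using True by simp
  next
    case False
    with add_monomial.hyps have "\<alpha> i = 1" by auto
    then have "\<alpha> = (\<alpha>(i := 0))(i := Suc ((\<alpha>(i := 0)) i))" by auto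
    then have "monomial m \<alpha> x = x i * monomial m (\<alpha>(i := 0)) x"
      using coord_times_monomial[OF assms(2), of x "\<alpha>(i := 0)"] by metis
    moreover have "monomial m \<alpha> (x(i := 0)) = 0"
      using assms(2) \<open>\<alpha> i = 1\<close> by (simp add: monomial_remove)
    ultimately show ?thesis using \<open>\<alpha> i = 1\<close> by simp
  qed
  show ?case unfolding 1 by (subst 2, subst add_monomial.IH) (simp add: algebra_simps)
qed

text \<open>
  Euler's identity for homogeneous functions.  As the second derivatives \<open>\<partial>\<^sub>i\<^sub>i\<close> of a multilinear
  polynomial vanish, it shows that homogeneous multilinear polynomials are eigenfunctions of \<open>N\<close>.
\<close>

lemma euler_homogeneous:
  assumes "poly_span m {\<alpha>. sum \<alpha> {..<m} = q} F"
  shows "(\<Sum>i<m. x i * partial i F x) = real q * F x"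
  using assms
proof (induction rule: poly_span.induct)
  case zero
  show ?case by (simp add: partial_const)
next
  case (add_monomial \<alpha> F c)
  have "x i * partial i (\<lambda>x. c * monomial m \<alpha> x + F x) x
      = real (\<alpha> i) * (c * monomial m \<alpha> x) + x i * partial i F x" if "i < m" for i
  proof -
    have "partial i (\<lambda>x. c * monomial m \<alpha> x + F x) x
        = c * (real (\<alpha> i) * monomial m (\<alpha>(i := \<alpha> i - 1)) x) + partial i F x"
      unfolding partial_monomial[OF that, symmetric] using that add_monomial.hyps
      by (intro partial_add[where m=m] poly_span_monomial) (auto intro: poly_span_is_poly)
    moreover have "real (\<alpha> i) * (x i * monomial m (\<alpha>(i := \<alpha> i - 1)) x) = real (\<alpha> i) * monomial m \<alpha> x"
      unfolding coord_times_monomial[OF that] by (cases "\<alpha> i = 0") auto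
    ultimately show ?thesis by (simp add: algebra_simps)
  qed
  then have "(\<Sum>i<m. x i * partial i (\<lambda>x. c * monomial m \<alpha> x + F x) x)
      = real (sum \<alpha> {..<m}) * (c * monomial m \<alpha> x) + (\<Sum>i<m. x i * partial i F x)"
    by (simp add: sum.distrib sum_distrib_right)
  moreover have "sum \<alpha> {..<m} = q" using add_monomial.hyps by simp
  ultimately show ?case using add_monomial.IH by (simp only: distrib_left)
qed

lemma multilinear_number_op:
  assumes "poly_span m (multilinear_homogeneous m q) F"
  shows "number_op m F x = real q * F x"
proof -
  have "partial i (partial i F) x = 0" if "i < m" for i
    by (intro partial_independent[where m=m] poly_span_partial_multilinear that poly_span_mono[OF assms])
      (auto simp: multilinear_homogeneous_def)
  moreover have "(\<Sum>i<m. x i * partial i F x) = real q * F x"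
    by (intro euler_homogeneous poly_span_mono[OF assms]) (auto simp: multilinear_homogeneous_def)
  ultimately show ?thesis by (simp add: number_op_def)
qed

section \<open>Equivalence of moments for multilinear polynomials\<close>

lemma multilinear_split:
  assumes "poly_span m (multilinear_upto (Suc n) (Suc q)) F" "n < m"
  shows "\<exists>A B. poly_span m (multilinear_upto n (Suc q)) A \<and> poly_span m (multilinear_upto n q) B
    \<and> F = (\<lambda>x. A x + x n * B x)"
  using assms(1)
proof (induction rule: poly_span.induct)
  case zero
  show ?case by (intro exI[of _ "\<lambda>_. 0"]) (simp add: poly_span.zero)
next
  case (add_monomial \<alpha> F c)
  then obtain A B where AB: "poly_span m (multilinear_upto n (Suc q)) A"
    "poly_span m (multilinear_upto n q) B" "F = (\<lambda>x. A x + x n * B x)" by blast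
  have \<alpha>: "\<forall>i. \<alpha> i \<le> 1" "\<forall>i\<ge>Suc n. \<alpha> i = 0" "sum \<alpha> {..<n} + \<alpha> n \<le> Suc q"
    using add_monomial.hyps by (auto simp: multilinear_upto_def)
  have ge: "\<alpha> i = 0" if "i \<ge> n" "i \<noteq> n" for i using \<alpha>(2) that by auto
  show ?case
  proof (cases "\<alpha> n = 0")
    case True
    have "\<alpha> i = 0" if "i \<ge> n" for i using ge[of i] that True by (cases "i = n") auto
    then have "\<alpha> \<in> multilinear_upto n (Suc q)" using \<alpha> True by (auto simp: multilinear_upto_def)
    then show ?thesis
      using AB by - (rule exI[of _ "\<lambda>x. c * monomial m \<alpha> x + A x"], rule exI[of _ B],
        auto intro: poly_span.add_monomial)
  next
    case False
    with \<alpha>(1) have "\<alpha> n = 1" by (metis le_antisym less_one not_le)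
    let ?\<beta> = "\<alpha>(n := 0)"
    have "\<alpha> = ?\<beta>(n := Suc (?\<beta> n))" using \<open>\<alpha> n = 1\<close> by auto
    then have mon: "monomial m \<alpha> x = x n * monomial m ?\<beta> x" for x
      using coord_times_monomial[OF assms(2), of x ?\<beta>] by metis
    have "sum ?\<beta> {..<n} = sum \<alpha> {..<n}" by (rule sum.cong) auto
    then have \<beta>: "?\<beta> \<in> multilinear_upto n q"
      using \<alpha> \<open>\<alpha> n = 1\<close> ge by (auto simp: multilinear_upto_def)
    then show ?thesis
      using poly_span.add_monomial[OF \<beta> AB(2), of c] AB(1,3)
      by - (rule exI[of _ A], rule exI[of _ "\<lambda>x. c * monomial m ?\<beta> x + B x"],
        simp add: mon algebra_simps fun_eq_iff)
  qed
qed

lemma young_cubic: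
  fixes u v l :: real
  assumes "u \<ge> 0" "v \<ge> 0" "l > 0"
  shows "u\<^sup>2 * v \<le> (2 * l * u ^ 3 + v ^ 3 / l\<^sup>2) / 3"
proof -
  define w where "w = v / l"
  have v: "v = l * w" and "w \<ge> 0" using assms by (auto simp: w_def)
  have "0 \<le> (u - w)\<^sup>2 * (2 * u + w)" using assms \<open>w \<ge> 0\<close> by simp
  then have "3 * (u\<^sup>2 * w) \<le> 2 * u ^ 3 + w ^ 3"
    by (simp add: power2_eq_square power3_eq_cube algebra_simps)
  then have "l * (3 * (u\<^sup>2 * w)) \<le> l * (2 * u ^ 3 + w ^ 3)" using assms by simp
  moreover have "v ^ 3 / l\<^sup>2 = l * w ^ 3"
    using assms by (simp add: v power2_eq_square power3_eq_cube)
  ultimately show ?thesis by (simp add: v algebra_simps)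
qed

lemma normal_moment_values:
  "normal_moment 0 = 1" "normal_moment 1 = 0" "normal_moment 2 = 1" "normal_moment 3 = 0"
  "normal_moment 4 = 3" "normal_moment 5 = 0" "normal_moment 6 = 15"
proof -
  show 0: "normal_moment 0 = 1"
    unfolding normal_moment_def using integral_std_normal_moment_even[of 0] by simp
  show 1: "normal_moment 1 = 0" using normal_moment_recursion[of 0] by simp
  show 2: "normal_moment 2 = 1" using normal_moment_recursion[of 1] 0 by (simp add: numeral_eq_Suc)
  show 3: "normal_moment 3 = 0" using normal_moment_recursion[of 2] 1 by (simp add: numeral_eq_Suc)
  show 4: "normal_moment 4 = 3" using normal_moment_recursion[of 3] 2 by (simp add: numeral_eq_Suc)
  show "normal_moment 5 = 0" using normal_moment_recursion[of 4] 3 by (simp add: numeral_eq_Suc)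
  show "normal_moment 6 = 15" using normal_moment_recursion[of 5] 4 by (simp add: numeral_eq_Suc)
qed

context gaussian_family
begin

lemma Ex_coord_power_mult:
  assumes "poly_span m {\<alpha>. \<alpha> i = 0} F" "i < m"
  shows "\<E> (\<lambda>x. x i ^ k * F x) = normal_moment k * \<E> F"
  using assms(1)
proof (induction rule: poly_span.induct)
  case zero
  show ?case by (simp add: \<E>_def)
next
  case (add_monomial \<alpha> F c)
  let ?\<beta> = "\<alpha>(i := k)"
  have "(\<Prod>j\<in>{..<m} - {i}. x j ^ ?\<beta> j) = (\<Prod>j\<in>{..<m} - {i}. x j ^ \<alpha> j)" for x :: "nat \<Rightarrow> real"
    by (rule prod.cong) auto
  then have mon: "x i ^ k * monomial m \<alpha> x = monomial m ?\<beta> x" for x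
    using assms(2) add_monomial.hyps by (simp add: monomial_remove)
  have "(\<Prod>j\<in>{..<m} - {i}. normal_moment (?\<beta> j)) = (\<Prod>j\<in>{..<m} - {i}. normal_moment (\<alpha> j))"
    by (rule prod.cong) auto
  then have 1: "\<E> (monomial m ?\<beta>) = normal_moment k * \<E> (monomial m \<alpha>)"
    using assms(2) add_monomial.hyps by (simp add: Ex_monomial_remove normal_moment_values)
  have F: "is_poly m F" using add_monomial.hyps by (blast intro: poly_span_is_poly)
  have "\<E> (\<lambda>x. x i ^ k * (c * monomial m \<alpha> x + F x))
      = \<E> (\<lambda>x. c * monomial m ?\<beta> x + x i ^ k * F x)"
    by (simp add: mon[symmetric] algebra_simps)
  also have "\<dots> = c * \<E> (monomial m ?\<beta>) + \<E> (\<lambda>x. x i ^ k * F x)"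
    unfolding Ex_cmult[symmetric] using F assms(2)
    by (intro Ex_add poly_span_monomial is_poly_intros) auto
  also have "\<dots> = normal_moment k * (c * \<E> (monomial m \<alpha>) + \<E> F)"
    unfolding 1 add_monomial.IH by (simp add: algebra_simps)
  also have "c * \<E> (monomial m \<alpha>) + \<E> F = \<E> (\<lambda>x. c * monomial m \<alpha> x + F x)"
    unfolding Ex_cmult[symmetric] using F by (intro Ex_add[symmetric] poly_span_monomial) auto
  finally show ?case .
qed

text \<open>
  Used for the degenerate case of the moment comparison, in which Young's inequality has no optimal
  weight.
\<close>

lemma Ex_square_eq_0:
  assumes "is_poly m F" "\<E> (\<lambda>x. (F x)\<^sup>2) = 0" "\<And>x. F x = 0 \<Longrightarrow> G x = 0"
  shows "\<E> G = 0"
proof -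
  have "integrable M (\<lambda>\<omega>. (F (\<Xi> \<omega>))\<^sup>2)"
    using integrable_poly[OF is_poly_power[OF assms(1)]] .
  then have "AE \<omega> in M. (F (\<Xi> \<omega>))\<^sup>2 = 0"
    using assms(2) unfolding \<E>_def by (subst (asm) integral_nonneg_eq_0_iff_AE) auto
  then show ?thesis
    unfolding \<E>_def by (intro integral_eq_zero_AE) (use assms(3) in auto)
qed

text \<open>
  Induction on the number of variables, as in the proof of Bonami's lemma.  Write \<open>F = A + x\<^sub>n B\<close>, where
  \<open>A\<close> and \<open>B\<close> do not depend on \<open>x\<^sub>n\<close> and \<open>B\<close> has smaller degree.  The odd moments of \<open>x\<^sub>n\<close> vanish, the mixed
  terms \<open>A\<^sup>4 B\<^sup>2\<close> and \<open>A\<^sup>2 B\<^sup>4\<close> are estimated by Young's inequality, and the result is compared with the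
  binomial expansion of \<open>(E[A\<^sup>2] + E[B\<^sup>2])\<^sup>3\<close>.  The constant is dictated by the term \<open>15 E[A\<^sup>4 B\<^sup>2]\<close>, which
  has to be at most \<open>3 \<cdot> 125\<^sup>q E[A\<^sup>2]\<^sup>2 E[B\<^sup>2]\<close>.
\<close>

lemma multilinear_sixth_moment:
  "n \<le> m \<Longrightarrow> poly_span m (multilinear_upto n q) F \<Longrightarrow>
    \<E> (\<lambda>x. F x ^ 6) \<le> 125 ^ q * \<E> (\<lambda>x. (F x)\<^sup>2) ^ 3"
proof (induction n arbitrary: q F)
  case 0
  have "F x = F (\<lambda>_. 0)" for x
    by (rule poly_span_cong[OF 0(2)]) (auto simp: multilinear_upto_def)
  then have "F = (\<lambda>_. F (\<lambda>_. 0))" by blast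
  then obtain c where F: "F = (\<lambda>_. c)" by blast
  have "1 * c ^ 6 \<le> 125 ^ q * c ^ 6" by (intro mult_right_mono one_le_power) auto
  then show ?case by (simp add: F Ex_const power_mult[symmetric])
next
  case (Suc n)
  then have "n < m" "n \<le> m" by auto
  show ?case
  proof (cases q)
    case 0
    have "multilinear_upto (Suc n) 0 \<subseteq> multilinear_upto n 0"
      by (auto simp: multilinear_upto_def Suc_le_eq) (metis le_neq_implies_less)
    with Suc.prems 0 have "poly_span m (multilinear_upto n q) F" by (auto intro: poly_span_mono)
    then show ?thesis using Suc.IH[OF \<open>n \<le> m\<close>] by blast
  next
    case (Suc q')
    obtain A B where A: "poly_span m (multilinear_upto n (Suc q')) A"
      and B: "poly_span m (multilinear_upto n q') B" and F: "F = (\<lambda>x. A x + x n * B x)"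
      using multilinear_split[OF Suc.prems(2)[unfolded Suc] \<open>n < m\<close>] by blast
    define C :: real where "C = 125 ^ q'"
    define a where "a = \<E> (\<lambda>x. (A x)\<^sup>2)"
    define b where "b = \<E> (\<lambda>x. (B x)\<^sup>2)"
    have "C \<ge> 0" by (simp add: C_def)
    have "a \<ge> 0" "b \<ge> 0" unfolding a_def b_def by (auto intro: Ex_nonneg)
    have A6: "\<E> (\<lambda>x. A x ^ 6) \<le> 125 * C * a ^ 3" and B6: "\<E> (\<lambda>x. B x ^ 6) \<le> C * b ^ 3"
      using Suc.IH[OF \<open>n \<le> m\<close> A] Suc.IH[OF \<open>n \<le> m\<close> B] by (simp_all add: a_def b_def C_def)
    have A0: "poly_span m {\<alpha>. \<alpha> n = 0} A" and B0: "poly_span m {\<alpha>. \<alpha> n = 0} B"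
      using A B by (auto elim!: poly_span_mono simp: multilinear_upto_def)
    have pA: "is_poly m A" and pB: "is_poly m B" using A B by (auto intro: poly_span_is_poly)
    note poly = is_poly_intros poly_span_scale pA pB \<open>n < m\<close>
    have pow0: "poly_span m {\<alpha>. \<alpha> n = 0} (\<lambda>x. G x ^ k)"
      if "poly_span m {\<alpha>. \<alpha> n = 0} G" for G k
    proof (induction k)
      case 0
      have "poly_span m {\<alpha>. \<alpha> n = 0} (\<lambda>x. 1 * monomial m (\<lambda>_. 0) x)"
        by (rule poly_span_monomial) simp
      then show ?case by (simp add: monomial_def)
    qed (use that in \<open>auto intro: poly_span_mult\<close>)
    have coord: "\<E> (\<lambda>x. x n ^ k * (A x ^ i * B x ^ j)) = normal_moment k * \<E> (\<lambda>x. A x ^ i * B x ^ j)"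
      for k i j
      by (intro Ex_coord_power_mult \<open>n < m\<close> poly_span_mult[OF pow0[OF A0] pow0[OF B0]]) auto
    have "\<E> (\<lambda>x. (F x)\<^sup>2) = \<E> (\<lambda>x. x n ^ 0 * (A x ^ 2 * B x ^ 0) + 2 * (x n ^ 1 * (A x ^ 1 * B x ^ 1))
        + x n ^ 2 * (A x ^ 0 * B x ^ 2))"
      by (simp add: F power2_eq_square algebra_simps)
    also have "\<dots> = \<E> (\<lambda>x. x n ^ 0 * (A x ^ 2 * B x ^ 0)) + 2 * \<E> (\<lambda>x. x n ^ 1 * (A x ^ 1 * B x ^ 1))
        + \<E> (\<lambda>x. x n ^ 2 * (A x ^ 0 * B x ^ 2))"
      unfolding Ex_cmult[symmetric]
      by (subst Ex_add, (intro poly; fail), (intro poly; fail))+ (rule refl)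
    also have "\<dots> = a + b"
      unfolding coord normal_moment_values by (simp add: a_def b_def)
    finally have F2: "\<E> (\<lambda>x. (F x)\<^sup>2) = a + b" .
    have "F x ^ 6 = x n ^ 0 * (A x ^ 6 * B x ^ 0) + 6 * (x n ^ 1 * (A x ^ 5 * B x ^ 1))
        + 15 * (x n ^ 2 * (A x ^ 4 * B x ^ 2)) + 20 * (x n ^ 3 * (A x ^ 3 * B x ^ 3))
        + 15 * (x n ^ 4 * (A x ^ 2 * B x ^ 4)) + 6 * (x n ^ 5 * (A x ^ 1 * B x ^ 5))
        + x n ^ 6 * (A x ^ 0 * B x ^ 6)" for x
      unfolding F by (simp add: numeral_eq_Suc algebra_simps)
    then have "\<E> (\<lambda>x. F x ^ 6) = \<E> (\<lambda>x. x n ^ 0 * (A x ^ 6 * B x ^ 0) + 6 * (x n ^ 1 * (A x ^ 5 * B x ^ 1))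
        + 15 * (x n ^ 2 * (A x ^ 4 * B x ^ 2)) + 20 * (x n ^ 3 * (A x ^ 3 * B x ^ 3))
        + 15 * (x n ^ 4 * (A x ^ 2 * B x ^ 4)) + 6 * (x n ^ 5 * (A x ^ 1 * B x ^ 5))
        + x n ^ 6 * (A x ^ 0 * B x ^ 6))" by simp
    also have "\<dots> = \<E> (\<lambda>x. x n ^ 0 * (A x ^ 6 * B x ^ 0)) + 6 * \<E> (\<lambda>x. x n ^ 1 * (A x ^ 5 * B x ^ 1))
        + 15 * \<E> (\<lambda>x. x n ^ 2 * (A x ^ 4 * B x ^ 2)) + 20 * \<E> (\<lambda>x. x n ^ 3 * (A x ^ 3 * B x ^ 3))
        + 15 * \<E> (\<lambda>x. x n ^ 4 * (A x ^ 2 * B x ^ 4)) + 6 * \<E> (\<lambda>x. x n ^ 5 * (A x ^ 1 * B x ^ 5))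
        + \<E> (\<lambda>x. x n ^ 6 * (A x ^ 0 * B x ^ 6))"
      unfolding Ex_cmult[symmetric]
      by (subst Ex_add, (intro poly; fail), (intro poly; fail))+ (rule refl)
    also have "\<dots> = \<E> (\<lambda>x. A x ^ 6) + 15 * \<E> (\<lambda>x. A x ^ 4 * (B x)\<^sup>2)
        + 45 * \<E> (\<lambda>x. (A x)\<^sup>2 * B x ^ 4) + 15 * \<E> (\<lambda>x. B x ^ 6)"
      unfolding coord normal_moment_values by simp
    finally have F6: "\<E> (\<lambda>x. F x ^ 6) = \<E> (\<lambda>x. A x ^ 6) + 15 * \<E> (\<lambda>x. A x ^ 4 * (B x)\<^sup>2)
        + 45 * \<E> (\<lambda>x. (A x)\<^sup>2 * B x ^ 4) + 15 * \<E> (\<lambda>x. B x ^ 6)" .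
    have young: "\<E> (\<lambda>x. G x ^ 4 * (H x)\<^sup>2) \<le> (2 * l * \<E> (\<lambda>x. G x ^ 6) + \<E> (\<lambda>x. H x ^ 6) / l\<^sup>2) / 3"
      if "is_poly m G" "is_poly m H" "l > 0" for G H l
    proof -
      have pw: "G x ^ 4 * (H x)\<^sup>2 \<le> (2 * l / 3) * G x ^ 6 + (1 / (3 * l\<^sup>2)) * H x ^ 6" for x
        using young_cubic[of "(G x)\<^sup>2" "(H x)\<^sup>2" l] \<open>l > 0\<close>
        by (simp add: power_mult[symmetric] add_divide_distrib)
      have "\<E> (\<lambda>x. G x ^ 4 * (H x)\<^sup>2) \<le> \<E> (\<lambda>x. (2 * l / 3) * G x ^ 6 + (1 / (3 * l\<^sup>2)) * H x ^ 6)"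
        by (rule Ex_mono[OF _ _ pw]) (intro is_poly_intros poly_span_scale that)+
      also have "\<dots> = (2 * l / 3) * \<E> (\<lambda>x. G x ^ 6) + (1 / (3 * l\<^sup>2)) * \<E> (\<lambda>x. H x ^ 6)"
        unfolding Ex_cmult[symmetric] by (intro Ex_add is_poly_intros poly_span_scale that)
      finally show ?thesis by (simp add: add_divide_distrib)
    qed
    have AB: "\<E> (\<lambda>x. A x ^ 4 * (B x)\<^sup>2) \<le> 25 * C * a\<^sup>2 * b \<and> \<E> (\<lambda>x. (A x)\<^sup>2 * B x ^ 4) \<le> 5 * C * a * b\<^sup>2"
    proof (cases "a = 0 \<or> b = 0")
      case True
      have "\<E> (\<lambda>x. A x ^ 4 * (B x)\<^sup>2) = 0 \<and> \<E> (\<lambda>x. (A x)\<^sup>2 * B x ^ 4) = 0"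
        using True
      proof
        assume "a = 0"
        show ?thesis
          by (intro conjI Ex_square_eq_0[OF pA \<open>a = 0\<close>[unfolded a_def]]) simp_all
      next
        assume "b = 0"
        show ?thesis
          by (intro conjI Ex_square_eq_0[OF pB \<open>b = 0\<close>[unfolded b_def]]) simp_all
      qed
      then show ?thesis using \<open>C \<ge> 0\<close> \<open>a \<ge> 0\<close> \<open>b \<ge> 0\<close> by simp
    next
      case False
      with \<open>a \<ge> 0\<close> \<open>b \<ge> 0\<close> have pos: "a > 0" "b > 0" by auto
      \<comment> \<open>The weights balance the two terms of the Young inequality: both become multiples of \<open>C a\<^sup>2 b\<close>, respectively \<open>C a b\<^sup>2\<close>.\<close>
      have "\<E> (\<lambda>x. A x ^ 4 * (B x)\<^sup>2)
          \<le> (2 * (b / (5 * a)) * \<E> (\<lambda>x. A x ^ 6) + \<E> (\<lambda>x. B x ^ 6) / (b / (5 * a))\<^sup>2) / 3"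
        using pos by (intro young pA pB) simp
      also have "\<dots> \<le> (2 * (b / (5 * a)) * (125 * C * a ^ 3) + (C * b ^ 3) / (b / (5 * a))\<^sup>2) / 3"
        using pos by (intro divide_right_mono add_mono mult_left_mono A6 B6) auto
      also have "\<dots> = 25 * C * a\<^sup>2 * b"
        using pos by (simp add: field_simps power2_eq_square power3_eq_cube)
      finally have 1: "\<E> (\<lambda>x. A x ^ 4 * (B x)\<^sup>2) \<le> 25 * C * a\<^sup>2 * b" .
      have "\<E> (\<lambda>x. (A x)\<^sup>2 * B x ^ 4)
          \<le> (2 * (5 * a / b) * \<E> (\<lambda>x. B x ^ 6) + \<E> (\<lambda>x. A x ^ 6) / (5 * a / b)\<^sup>2) / 3"
        using young[OF pB pA, of "5 * a / b"] pos by (simp add: mult.commute)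
      also have "\<dots> \<le> (2 * (5 * a / b) * (C * b ^ 3) + (125 * C * a ^ 3) / (5 * a / b)\<^sup>2) / 3"
        using pos by (intro divide_right_mono add_mono mult_left_mono A6 B6) auto
      also have "\<dots> = 5 * C * a * b\<^sup>2"
        using pos by (simp add: field_simps power2_eq_square power3_eq_cube)
      finally show ?thesis using 1 by simp
    qed
    have "\<E> (\<lambda>x. F x ^ 6) \<le> 125 * C * a ^ 3 + 15 * (25 * C * a\<^sup>2 * b) + 45 * (5 * C * a * b\<^sup>2) + 15 * (C * b ^ 3)"
      unfolding F6 using AB A6 B6 by linarith
    also have "\<dots> \<le> 125 * C * (a + b) ^ 3"
    proof -
      have "0 \<le> 150 * (C * (a * b\<^sup>2)) + 110 * (C * b ^ 3)"
        using \<open>C \<ge> 0\<close> \<open>a \<ge> 0\<close> \<open>b \<ge> 0\<close> by simp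
      then show ?thesis by (simp add: power2_eq_square power3_eq_cube algebra_simps)
    qed
    finally show ?thesis by (simp add: F2 Suc C_def)
  qed
qed

end

section \<open>Characteristic functions and Stein's identity\<close>

text \<open>
  The Taylor remainder of \<open>exp(i h x)\<close> is at most \<open>(h x)\<^sup>2 / 2\<close>, so a finite second moment gives an error
  of order \<open>h\<^sup>2\<close>.
\<close>

lemma (in real_distribution) char_has_vector_derivative:
  assumes int: "integrable M (\<lambda>x. x\<^sup>2)"
  shows "(char M has_vector_derivative (CLINT x|M. \<i> * complex_of_real x * iexp (t * x))) (at t)"
proof -
  have int1: "integrable M (\<lambda>x. x)"
    by (rule square_integrable_imp_integrable[OF _ int]) simp
  have intD: "integrable M (\<lambda>x. \<i> * complex_of_real x * iexp (t * x))"
    by (rule Bochner_Integration.integrable_bound[OF int1]) (auto simp: norm_mult)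
  have inte: "integrable M (\<lambda>x. iexp (s * x))" for s by (rule integrable_iexp) auto
  define D where "D = (CLINT x|M. \<i> * complex_of_real x * iexp (t * x))"
  define C where "C = (\<integral>x. x\<^sup>2 \<partial>M) / 2"
  have bound: "norm (char M (t + h) - char M t - h *\<^sub>R D) \<le> h\<^sup>2 * C" for h
  proof -
    have "char M (t + h) - char M t - h *\<^sub>R D
        = (CLINT x|M. iexp ((t + h) * x) - iexp (t * x) - h *\<^sub>R (\<i> * complex_of_real x * iexp (t * x)))"
      unfolding char_def D_def
      by (simp only: Bochner_Integration.integral_diff Bochner_Integration.integrable_diff
          integral_scaleR_right integrable_scaleR_right inte intD)
    also have "norm \<dots> \<le> (\<integral>x. h\<^sup>2 * x\<^sup>2 / 2 \<partial>M)"
    proof (rule order_trans[OF integral_norm_bound], rule integral_mono)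
      show "integrable M (\<lambda>x. norm (iexp ((t + h) * x) - iexp (t * x) - h *\<^sub>R (\<i> * complex_of_real x * iexp (t * x))))"
        by (intro integrable_norm Bochner_Integration.integrable_diff integrable_scaleR_right inte intD)
      show "integrable M (\<lambda>x. h\<^sup>2 * x\<^sup>2 / 2)" using int by simp
      fix x
      have "iexp ((t + h) * x) - iexp (t * x) - h *\<^sub>R (\<i> * complex_of_real x * iexp (t * x))
          = iexp (t * x) * (iexp (h * x) - (\<Sum>k\<le>1. (\<i> * complex_of_real (h * x)) ^ k / fact k))"
      proof -
        have "iexp ((t + h) * x) = iexp (t * x) * iexp (h * x)"
          by (simp add: exp_add[symmetric] distrib_left distrib_right)
        then show ?thesis by (simp add: scaleR_conv_of_real algebra_simps)
      qed
      also have "norm \<dots> = norm (iexp (h * x) - (\<Sum>k\<le>1. (\<i> * complex_of_real (h * x)) ^ k / fact k))"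
        by (simp add: norm_mult)
      also have "\<dots> \<le> \<bar>h * x\<bar> ^ Suc 1 / fact (Suc 1)" by (rule iexp_approx1)
      also have "\<dots> = h\<^sup>2 * x\<^sup>2 / 2" by (simp add: power2_eq_square abs_mult_self_eq)
      finally show "norm (iexp ((t + h) * x) - iexp (t * x) - h *\<^sub>R (\<i> * complex_of_real x * iexp (t * x)))
          \<le> h\<^sup>2 * x\<^sup>2 / 2" .
    qed
    also have "\<dots> = h\<^sup>2 * C" by (simp add: C_def)
    finally show ?thesis .
  qed
  have "(\<lambda>h. norm (char M (t + h) - char M t - h *\<^sub>R D) / norm h) \<midarrow>0\<rightarrow> 0"
  proof (rule tendsto_sandwich)
    show "\<forall>\<^sub>F h in at 0. 0 \<le> norm (char M (t + h) - char M t - h *\<^sub>R D) / norm h"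
      by (intro always_eventually allI divide_nonneg_nonneg norm_ge_zero)
    have "norm (char M (t + h) - char M t - h *\<^sub>R D) / norm h \<le> \<bar>h\<bar> * C" if "h \<noteq> 0" for h
    proof -
      have "h\<^sup>2 * C = \<bar>h\<bar> * C * \<bar>h\<bar>"
        by (metis mult.assoc mult.commute power2_abs power2_eq_square)
      with bound[of h] that show ?thesis by (simp add: divide_le_eq)
    qed
    then show "\<forall>\<^sub>F h in at 0. norm (char M (t + h) - char M t - h *\<^sub>R D) / norm h \<le> \<bar>h\<bar> * C"
      by (auto simp: eventually_at_filter)
    have "((\<lambda>h. \<bar>h\<bar> * C) \<longlongrightarrow> \<bar>0\<bar> * C) (at 0)" by (intro tendsto_intros)
    then show "((\<lambda>h. \<bar>h\<bar> * C) \<longlongrightarrow> 0) (at 0)" by simp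
  qed simp
  then show ?thesis
    unfolding has_vector_derivative_def has_derivative_at D_def[symmetric] by (simp add: bounded_linear_scaleR_left)
qed

text \<open>
  The derivative of the characteristic function \<open>exp(- s\<^sup>2 / 2)\<close>, computed in two ways.
\<close>

lemma std_normal_stein:
  "(CLINT x|std_normal_distribution. complex_of_real x * iexp (s * x))
    = \<i> * complex_of_real s * char std_normal_distribution s"
proof -
  interpret real_distribution std_normal_distribution by (rule real_dist_normal_dist)
  have 1: "(char std_normal_distribution has_vector_derivative
      (CLINT x|std_normal_distribution. \<i> * complex_of_real x * iexp (s * x))) (at s)"
    by (rule char_has_vector_derivative) (rule integrable_std_normal_distribution_moment)
  have "((\<lambda>t. complex_of_real (exp (- t\<^sup>2 / 2))) has_vector_derivative
      complex_of_real (- s * exp (- s\<^sup>2 / 2))) (at s)"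
    by (rule has_vector_derivative_of_real)
       (auto intro!: derivative_eq_intros simp: has_real_derivative_iff_has_vector_derivative[symmetric])
  then have 2: "(char std_normal_distribution has_vector_derivative
      - complex_of_real s * char std_normal_distribution s) (at s)"
    by (simp add: char_std_normal_distribution)
  have "(CLINT x|std_normal_distribution. \<i> * complex_of_real x * iexp (s * x))
      = - complex_of_real s * char std_normal_distribution s"
    using vector_derivative_unique_at[OF 1 2] .
  then have "\<i> * (CLINT x|std_normal_distribution. complex_of_real x * iexp (s * x))
      = \<i> * (\<i> * complex_of_real s * char std_normal_distribution s)"
    by (simp add: mult.assoc)
  then show ?thesis by (simp only: mult_cancel_left complex_i_not_zero) simp
qed

lemma poly_span_set_coordinate:
  assumes "poly_span m A F" "i < m"
  shows "poly_span m {\<alpha>. \<alpha> i = 0} (\<lambda>x. F (x(i := 0)))"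
  using assms(1)
proof (induction rule: poly_span.induct)
  case zero
  show ?case by (rule poly_span.zero)
next
  case (add_monomial \<alpha> F c)
  show ?case
  proof (cases "\<alpha> i = 0")
    case True
    have "monomial m \<alpha> (x(i := 0)) = monomial m \<alpha> x" for x :: "nat \<Rightarrow> real"
      unfolding monomial_def using True by (intro prod.cong) auto
    then have eq: "(\<lambda>x. c * monomial m \<alpha> (x(i := 0)) + F (x(i := 0)))
        = (\<lambda>x. c * monomial m \<alpha> x + F (x(i := 0)))" by (intro ext) metis
    show ?thesis unfolding eq by (intro poly_span.add_monomial add_monomial.IH) (simp add: True)
  next
    case False
    then have "monomial m \<alpha> (x(i := 0)) = 0" for x :: "nat \<Rightarrow> real"
      using assms(2) by (simp add: monomial_remove)
    then have eq: "(\<lambda>x. c * monomial m \<alpha> (x(i := 0)) + F (x(i := 0))) = (\<lambda>x. F (x(i := 0)))"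
      by (intro ext) (metis add_0 mult_zero_right)
    show ?thesis unfolding eq by (rule add_monomial.IH)
  qed
qed

lemma poly_span_measurable_PiM:
  assumes "poly_span m {\<alpha>. \<alpha> i = 0} F" "i < m"
  shows "F \<in> borel_measurable (Pi\<^sub>M ({..<m} - {i}) (\<lambda>_. borel))"
  using assms(1)
proof (induction rule: poly_span.induct)
  case zero
  show ?case by simp
next
  case (add_monomial \<alpha> F c)
  have "monomial m \<alpha> = (\<lambda>x. \<Prod>j\<in>{..<m} - {i}. x j ^ \<alpha> j)"
    using add_monomial.hyps assms(2) by (simp add: fun_eq_iff monomial_remove)
  moreover have "(\<lambda>x :: nat \<Rightarrow> real. \<Prod>j\<in>{..<m} - {i}. x j ^ \<alpha> j) \<in> borel_measurable (Pi\<^sub>M ({..<m} - {i}) (\<lambda>_. borel))"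
    by (rule borel_measurable_prod, rule borel_measurable_power, erule measurable_component_singleton)
  ultimately show ?case using add_monomial.IH by simp
qed

context gaussian_family
begin

lemma distr_xi: "i < m \<Longrightarrow> distr M borel (\<xi> i) = std_normal_distribution"
  using distributed_distr_eq_density[OF normal, of i] by (simp cong: distr_cong)

text \<open>
  By \<open>affine_in_coordinate\<close>, \<open>P = A + x\<^sub>i B\<close> with \<open>A\<close> and \<open>B\<close> functions of the other variables.  Given these,
  the integral over \<open>x\<^sub>i\<close> is the one-dimensional identity \<open>std_normal_stein\<close> at the point \<open>s B\<close>.
\<close>

lemma stein_coordinate:
  assumes P: "poly_span m {\<alpha>. \<alpha> i \<le> 1} P" and i: "i < m"
  shows "(CLINT \<omega>|M. complex_of_real (\<xi> i \<omega> * partial i P (\<Xi> \<omega>)) * iexp (s * P (\<Xi> \<omega>)))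
    = (CLINT \<omega>|M. \<i> * complex_of_real (s * (partial i P (\<Xi> \<omega>))\<^sup>2) * iexp (s * P (\<Xi> \<omega>)))"
proof -
  let ?J = "{..<m} - {i}"
  let ?N = "Pi\<^sub>M ?J (\<lambda>_. borel) :: (nat \<Rightarrow> real) measure"
  define V where "V \<omega> = restrict (\<Xi> \<omega>) ?J" for \<omega>
  define A where "A x = P (x(i := 0))" for x
  define B where "B = partial i P"
  have A0: "poly_span m {\<alpha>. \<alpha> i = 0} A"
    unfolding A_def [abs_def] by (rule poly_span_set_coordinate[OF P i])
  have B0: "poly_span m {\<alpha>. \<alpha> i = 0} B"
    unfolding B_def by (rule poly_span_partial_multilinear[OF P i])
  note [measurable] = poly_span_measurable_PiM[OF A0 i] poly_span_measurable_PiM[OF B0 i]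
  have AV: "A (\<Xi> \<omega>) = A (V \<omega>)" and BV: "B (\<Xi> \<omega>) = B (V \<omega>)" for \<omega>
    by (rule poly_span_cong[OF A0], force simp: V_def) (rule poly_span_cong[OF B0], force simp: V_def)
  have P_eq: "P (\<Xi> \<omega>) = A (V \<omega>) + \<xi> i \<omega> * B (V \<omega>)" for \<omega>
    using affine_in_coordinate[OF P i, of "\<Xi> \<omega>"] by (simp add: A_def[symmetric] B_def[symmetric] AV BV)
  \<comment> \<open>Independence compares variables of one type, so \<open>\<xi>\<^sub>i\<close> is also treated as a point of a product space.\<close>
  define U where "U \<omega> = restrict (\<Xi> \<omega>) {i}" for \<omega>
  let ?L = "Pi\<^sub>M {i} (\<lambda>_. borel) :: (nat \<Rightarrow> real) measure"
  have ind: "indep_var ?L U ?N V"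
    unfolding U_def [abs_def] V_def [abs_def] by (rule indep_var_restrict[OF indep]) (use i in auto)
  have V[measurable]: "V \<in> measurable M ?N" and U[measurable]: "U \<in> measurable M ?L"
    using indep_var_rv1[OF ind] indep_var_rv2[OF ind] by simp_all
  let ?\<mu> = "std_normal_distribution" and ?\<kappa> = "distr M ?N V" and ?\<eta> = "distr M ?L U"
  have joint: "?\<eta> \<Otimes>\<^sub>M ?\<kappa> = distr M (?L \<Otimes>\<^sub>M ?N) (\<lambda>\<omega>. (U \<omega>, V \<omega>))"
    using ind by (simp add: indep_var_distribution_eq)
  have eval_i[measurable]: "(\<lambda>u. u i) \<in> borel_measurable ?L"
    by (rule measurable_component_singleton) simp
  have U_i: "distr ?\<eta> borel (\<lambda>u. u i) = ?\<mu>"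
    by (subst distr_distr) (simp_all add: comp_def U_def distr_xi[OF i])
  interpret \<eta>: prob_space ?\<eta> by (rule prob_space_distr[OF U])
  interpret \<kappa>: prob_space ?\<kappa> by (rule prob_space_distr[OF V])
  interpret pair: pair_sigma_finite ?\<eta> ?\<kappa> ..
  have fubini: "(CLINT \<omega>|M. f (\<xi> i \<omega>) (V \<omega>)) = (CLINT v|?\<kappa>. CLINT x|?\<mu>. f x v)"
    if f[measurable]: "case_prod f \<in> borel_measurable (borel \<Otimes>\<^sub>M ?N)"
      and int: "integrable M (\<lambda>\<omega>. f (\<xi> i \<omega>) (V \<omega>))" for f :: "real \<Rightarrow> (nat \<Rightarrow> real) \<Rightarrow> complex"
  proof -
    have U_apply: "U \<omega> i = \<xi> i \<omega>" for \<omega> by (simp add: U_def)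
    have meas: "(\<lambda>(u, v). f (u i) v) \<in> borel_measurable (?L \<Otimes>\<^sub>M ?N)"
      by measurable
    have "integrable (?\<eta> \<Otimes>\<^sub>M ?\<kappa>) (\<lambda>(u, v). f (u i) v)"
      unfolding joint using int meas by (subst integrable_distr_eq) (auto simp: U_apply)
    from pair.integral_snd[OF this] have "(CLINT v|?\<kappa>. CLINT u|?\<eta>. f (u i) v)
        = (CLINT z|distr M (?L \<Otimes>\<^sub>M ?N) (\<lambda>\<omega>. (U \<omega>, V \<omega>)). (\<lambda>(u, v). f (u i) v) z)"
      unfolding joint .
    also have "\<dots> = (CLINT \<omega>|M. f (\<xi> i \<omega>) (V \<omega>))"
      using meas by (subst integral_distr) (auto simp: U_apply)
    also have "(CLINT v|?\<kappa>. CLINT u|?\<eta>. f (u i) v) = (CLINT v|?\<kappa>. CLINT x|?\<mu>. f x v)"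
    proof (intro Bochner_Integration.integral_cong refl)
      fix v assume "v \<in> space ?\<kappa>"
      then have [measurable]: "(\<lambda>x. f x v) \<in> borel_measurable borel" by simp
      show "(CLINT u|?\<eta>. f (u i) v) = (CLINT x|?\<mu>. f x v)"
        unfolding U_i[symmetric] by (subst integral_distr) auto
    qed
    finally show ?thesis by simp
  qed
  have pP: "is_poly m P" and pB: "is_poly m B"
    using P B0 by (auto intro: poly_span_is_poly)
  note [measurable] = measurable_poly[OF pP] measurable_poly[OF pB] measurable_xi[OF i]
  have "(CLINT \<omega>|M. complex_of_real (\<xi> i \<omega> * B (\<Xi> \<omega>)) * iexp (s * P (\<Xi> \<omega>)))
      = (CLINT v|?\<kappa>. CLINT x|?\<mu>. complex_of_real (x * B v) * iexp (s * (A v + x * B v)))"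
  proof -
    have "integrable M (\<lambda>\<omega>. \<xi> i \<omega> * B (\<Xi> \<omega>))"
      by (rule integrable_poly[of "\<lambda>x. x i * B x"]) (intro is_poly_intros pB i)
    then have "integrable M (\<lambda>\<omega>. complex_of_real (\<xi> i \<omega> * B (\<Xi> \<omega>)) * iexp (s * P (\<Xi> \<omega>)))"
      by (rule Bochner_Integration.integrable_bound) (auto simp: norm_mult)
    then show ?thesis unfolding P_eq BV by (intro fubini) auto
  qed
  also have "\<dots> = (CLINT v|?\<kappa>. CLINT x|?\<mu>. \<i> * complex_of_real (s * (B v)\<^sup>2) * iexp (s * (A v + x * B v)))"
  proof (rule Bochner_Integration.integral_cong[OF refl])
    fix v
    have "(CLINT x|?\<mu>. complex_of_real (x * B v) * iexp (s * (A v + x * B v)))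
        = (CLINT x|?\<mu>. (complex_of_real (B v) * iexp (s * A v)) * (complex_of_real x * iexp ((s * B v) * x)))"
      by (intro Bochner_Integration.integral_cong refl) (simp add: exp_add algebra_simps)
    also have "\<dots> = complex_of_real (B v) * iexp (s * A v)
        * (\<i> * complex_of_real (s * B v) * char ?\<mu> (s * B v))"
      by (simp only: integral_mult_right_zero std_normal_stein)
    also have "\<dots> = (\<i> * complex_of_real (s * (B v)\<^sup>2) * iexp (s * A v)) * char ?\<mu> (s * B v)"
      by (simp add: power2_eq_square algebra_simps)
    also have "\<dots> = (CLINT x|?\<mu>. (\<i> * complex_of_real (s * (B v)\<^sup>2) * iexp (s * A v)) * iexp ((s * B v) * x))"
      by (simp only: integral_mult_right_zero char_def)
    also have "\<dots> = (CLINT x|?\<mu>. \<i> * complex_of_real (s * (B v)\<^sup>2) * iexp (s * (A v + x * B v)))"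
      by (intro Bochner_Integration.integral_cong refl) (simp add: exp_add algebra_simps)
    finally show "(CLINT x|?\<mu>. complex_of_real (x * B v) * iexp (s * (A v + x * B v)))
      = (CLINT x|?\<mu>. \<i> * complex_of_real (s * (B v)\<^sup>2) * iexp (s * (A v + x * B v)))" .
  qed
  also have "\<dots> = (CLINT \<omega>|M. \<i> * complex_of_real (s * (B (\<Xi> \<omega>))\<^sup>2) * iexp (s * P (\<Xi> \<omega>)))"
  proof -
    have "integrable M (\<lambda>\<omega>. s * (B (\<Xi> \<omega>))\<^sup>2)"
      by (intro integrable_mult_right integrable_poly[of "\<lambda>x. (B x)\<^sup>2"] is_poly_intros pB)
    then have "integrable M (\<lambda>\<omega>. \<i> * complex_of_real (s * (B (\<Xi> \<omega>))\<^sup>2) * iexp (s * P (\<Xi> \<omega>)))"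
      by (rule Bochner_Integration.integrable_bound) (auto simp: norm_mult norm_power abs_mult)
    then show ?thesis unfolding P_eq BV by (intro fubini[symmetric]) auto
  qed
  finally show ?thesis unfolding B_def .
qed

text \<open>
  The formula \<open>E[P \<phi>(P)] = E[\<Gamma> \<phi>'(P)]\<close> for \<open>\<phi>(x) = exp(i s x)\<close>.  Euler's identity expresses \<open>q P\<close> by
  the products \<open>x\<^sub>i \<partial>\<^sub>i P\<close>, and \<open>stein_coordinate\<close> applies to each of them.
\<close>

theorem stein_identity_char:
  assumes P: "poly_span m (multilinear_homogeneous m q) P" and "q > 0"
  shows "(CLINT \<omega>|M. complex_of_real (P (\<Xi> \<omega>)) * iexp (s * P (\<Xi> \<omega>)))
    = \<i> * complex_of_real s * (CLINT \<omega>|M. complex_of_real (stein_kernel m q P (\<Xi> \<omega>)) * iexp (s * P (\<Xi> \<omega>)))"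
proof -
  have pP: "is_poly m P" using P by (rule poly_span_is_poly)
  have Pi: "poly_span m {\<alpha>. \<alpha> i \<le> 1} P" for i
    using P by (rule poly_span_mono) (auto simp: multilinear_homogeneous_def)
  note pB = is_poly_partial[OF pP]
  note [measurable] = measurable_poly[OF pP] measurable_poly[OF pB]
  have int: "integrable M (\<lambda>\<omega>. complex_of_real (F (\<Xi> \<omega>)) * iexp (s * P (\<Xi> \<omega>)))"
    if "is_poly m F" for F
    using integrable_poly[OF that] measurable_poly[OF that]
    by (elim Bochner_Integration.integrable_bound) (auto simp: norm_mult)
  have int1: "integrable M (\<lambda>\<omega>. complex_of_real (\<xi> i \<omega> * partial i P (\<Xi> \<omega>)) * iexp (s * P (\<Xi> \<omega>)))"
    if "i < m" for i
    by (rule int[of "\<lambda>x. x i * partial i P x"]) (intro is_poly_mult is_poly_coord pB that)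
  have int2: "integrable M (\<lambda>\<omega>. \<i> * complex_of_real (s * (partial i P (\<Xi> \<omega>))\<^sup>2) * iexp (s * P (\<Xi> \<omega>)))"
    if "i < m" for i
  proof -
    have "integrable M (\<lambda>\<omega>. complex_of_real ((partial i P (\<Xi> \<omega>))\<^sup>2) * iexp (s * P (\<Xi> \<omega>)))"
      by (rule int[of "\<lambda>x. (partial i P x)\<^sup>2"]) (intro is_poly_power pB that)
    from integrable_mult_right[OF this, of "\<i> * complex_of_real s"]
    show ?thesis by (simp add: mult.assoc)
  qed
  have euler: "(\<Sum>i<m. x i * partial i P x) = real q * P x" for x
    by (intro euler_homogeneous poly_span_mono[OF P]) (auto simp: multilinear_homogeneous_def)
  have "complex_of_real (real q) * (CLINT \<omega>|M. complex_of_real (P (\<Xi> \<omega>)) * iexp (s * P (\<Xi> \<omega>)))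
      = (CLINT \<omega>|M. complex_of_real (real q * P (\<Xi> \<omega>)) * iexp (s * P (\<Xi> \<omega>)))"
    by (simp add: integral_mult_right_zero[symmetric] mult.assoc del: integral_mult_right_zero)
  also have "\<dots> = (CLINT \<omega>|M. \<Sum>i<m. complex_of_real (\<xi> i \<omega> * partial i P (\<Xi> \<omega>)) * iexp (s * P (\<Xi> \<omega>)))"
    unfolding euler[symmetric] by (simp add: sum_distrib_right)
  also have "\<dots> = (\<Sum>i<m. CLINT \<omega>|M. complex_of_real (\<xi> i \<omega> * partial i P (\<Xi> \<omega>)) * iexp (s * P (\<Xi> \<omega>)))"
    by (rule Bochner_Integration.integral_sum) (use int1 in auto)
  also have "\<dots> = (\<Sum>i<m. CLINT \<omega>|M. \<i> * complex_of_real (s * (partial i P (\<Xi> \<omega>))\<^sup>2) * iexp (s * P (\<Xi> \<omega>)))"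
    by (intro sum.cong stein_coordinate Pi) auto
  also have "\<dots> = (CLINT \<omega>|M. \<Sum>i<m. \<i> * complex_of_real (s * (partial i P (\<Xi> \<omega>))\<^sup>2) * iexp (s * P (\<Xi> \<omega>)))"
    by (rule Bochner_Integration.integral_sum[symmetric]) (use int2 in auto)
  also have "\<dots> = (CLINT \<omega>|M. \<i> * complex_of_real (s * (\<Sum>i<m. (partial i P (\<Xi> \<omega>))\<^sup>2)) * iexp (s * P (\<Xi> \<omega>)))"
    by (simp add: sum_distrib_left sum_distrib_right)
  also have "\<dots> = (CLINT \<omega>|M. (complex_of_real (real q) * (\<i> * complex_of_real s)) *
      (complex_of_real (stein_kernel m q P (\<Xi> \<omega>)) * iexp (s * P (\<Xi> \<omega>))))"
  proof (intro Bochner_Integration.integral_cong refl)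
    fix \<omega>
    have "(\<Sum>i<m. (partial i P (\<Xi> \<omega>))\<^sup>2) = real q * stein_kernel m q P (\<Xi> \<omega>)"
      using \<open>q > 0\<close> by (simp add: stein_kernel_def)
    then show "\<i> * complex_of_real (s * (\<Sum>i<m. (partial i P (\<Xi> \<omega>))\<^sup>2)) * iexp (s * P (\<Xi> \<omega>))
      = (complex_of_real (real q) * (\<i> * complex_of_real s)) *
      (complex_of_real (stein_kernel m q P (\<Xi> \<omega>)) * iexp (s * P (\<Xi> \<omega>)))"
      by (simp add: mult_ac)
  qed
  also have "\<dots> = complex_of_real (real q) * (\<i> * complex_of_real s *
      (CLINT \<omega>|M. complex_of_real (stein_kernel m q P (\<Xi> \<omega>)) * iexp (s * P (\<Xi> \<omega>))))"
    by (simp only: integral_mult_right_zero mult.assoc)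
  finally show ?thesis using \<open>q > 0\<close> by (simp only: mult_cancel_left of_real_eq_0_iff of_nat_eq_0_iff) simp
qed

end

section \<open>The centered Gamma law\<close>

text \<open>
  The identity \<open>E[X \<phi>(X)] = E[(2 X + 2 \<nu>) \<phi>'(X)]\<close>, tested on \<open>\<phi>(x) = exp(i s x)\<close> only.
\<close>

definition gamma_stein_equation :: "real \<Rightarrow> real measure \<Rightarrow> bool" where
  "gamma_stein_equation \<nu> \<mu> \<longleftrightarrow>
    (\<forall>s. (CLINT x|\<mu>. complex_of_real x * iexp (s * x))
      = \<i> * complex_of_real s *
        (2 * (CLINT x|\<mu>. complex_of_real x * iexp (s * x)) + 2 * complex_of_real \<nu> * char \<mu> s))"

text \<open>
  As \<open>i E[X exp(i s X)]\<close> is the derivative of the characteristic function, the Stein equation is the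
  linear differential equation \<open>(1 - 2 i s) \<phi>' = - 2 \<nu> s \<phi>\<close>.
\<close>

lemma char_gamma_stein:
  assumes "real_distribution \<mu>" and int: "integrable \<mu> (\<lambda>x. x\<^sup>2)" and stein: "gamma_stein_equation \<nu> \<mu>"
  shows "char \<mu> s = exp (- \<i> * \<nu> * s - \<nu> / 2 * Ln (1 - 2 * \<i> * s))"
proof -
  interpret real_distribution \<mu> by fact
  \<comment> \<open>the integrating factor, the reciprocal of the claimed solution\<close>
  define E where "E z = exp (\<i> * \<nu> * z + \<nu> / 2 * Ln (1 - 2 * \<i> * z))" for z :: complex
  define E' where "E' t = 2 * \<nu> * t / (1 - 2 * \<i> * t) * E (complex_of_real t)" for t :: real
  have nz: "1 - 2 * \<i> * complex_of_real t \<noteq> 0" for t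
    by (auto simp: complex_eq_iff)
  have dE: "((\<lambda>t. E (complex_of_real t)) has_vector_derivative E' t) (at t)" for t
  proof (rule has_vector_derivative_real_field)
    have "1 - 2 * \<i> * complex_of_real t \<notin> \<real>\<^sub>\<le>\<^sub>0"
      by (auto simp: complex_nonpos_Reals_iff)
    then have "(E has_field_derivative
        (\<i> * \<nu> + \<nu> / 2 * (- 2 * \<i> / (1 - 2 * \<i> * complex_of_real t))) * E (complex_of_real t)) (at (complex_of_real t))"
      unfolding E_def by (auto intro!: derivative_eq_intros simp: field_simps)
    moreover have "\<i> * \<nu> + \<nu> / 2 * (- 2 * \<i> / (1 - 2 * \<i> * complex_of_real t))
        = 2 * \<nu> * t / (1 - 2 * \<i> * complex_of_real t)"
      using nz[of t] by (simp add: field_simps)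
    ultimately show "(E has_field_derivative E' t) (at (complex_of_real t))"
      by (simp add: E'_def)
  qed
  have dchar: "(char \<mu> has_vector_derivative - (2 * \<nu> * t / (1 - 2 * \<i> * t)) * char \<mu> t) (at t)" for t
  proof -
    let ?I = "CLINT x|\<mu>. complex_of_real x * iexp (t * x)"
    have "?I = \<i> * complex_of_real t * (2 * ?I + 2 * complex_of_real \<nu> * char \<mu> t)"
      using stein unfolding gamma_stein_equation_def by blast
    then have "(1 - 2 * \<i> * complex_of_real t) * ?I = 2 * \<i> * complex_of_real t * complex_of_real \<nu> * char \<mu> t"
      by (simp add: algebra_simps)
    then have "?I = 2 * \<i> * complex_of_real t * complex_of_real \<nu> * char \<mu> t / (1 - 2 * \<i> * complex_of_real t)"
      using nz[of t] by (metis nonzero_mult_div_cancel_left)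
    then have "\<i> * ?I = \<i> * (2 * \<i> * complex_of_real t * complex_of_real \<nu> * char \<mu> t / (1 - 2 * \<i> * complex_of_real t))"
      by (rule arg_cong)
    also have "\<dots> = (\<i> * \<i>) * (2 * \<nu> * t * char \<mu> t / (1 - 2 * \<i> * t))"
      by (simp only: mult_ac times_divide_eq_right of_real_mult of_real_numeral)
    also have "\<dots> = - (2 * \<nu> * t / (1 - 2 * \<i> * t)) * char \<mu> t"
      by (simp only: i_squared) simp
    finally have "\<i> * ?I = - (2 * \<nu> * t / (1 - 2 * \<i> * t)) * char \<mu> t" .
    moreover have "(CLINT x|\<mu>. \<i> * complex_of_real x * iexp (t * x)) = \<i> * ?I"
      by (simp only: integral_mult_right_zero mult.assoc)
    ultimately show ?thesis
      using char_has_vector_derivative[OF int, of t] by simp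
  qed
  have "((\<lambda>t. char \<mu> t * E (complex_of_real t)) has_vector_derivative 0) (at t within UNIV)" for t
  proof -
    have "((\<lambda>t. char \<mu> t * E (complex_of_real t)) has_vector_derivative
        (char \<mu> t * E' t + - (2 * \<nu> * t / (1 - 2 * \<i> * t)) * char \<mu> t * E (complex_of_real t))) (at t)"
      by (rule has_vector_derivative_mult[OF dchar dE])
    then show ?thesis by (simp add: E'_def)
  qed
  then obtain c where c: "\<And>t. char \<mu> t * E (complex_of_real t) = c"
    using has_vector_derivative_zero_constant[of UNIV "\<lambda>t. char \<mu> t * E (complex_of_real t)"] by auto
  from c[of 0] have "c = 1" by (simp add: char_zero E_def)
  with c[of s] have "char \<mu> s * E (complex_of_real s) = 1" by simp
  then have "char \<mu> s = inverse (E (complex_of_real s))"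
    by (metis inverse_unique mult.commute)
  then show ?thesis
    by (simp add: E_def exp_minus[symmetric])
qed

lemma gamma_stein_unique:
  assumes "real_distribution \<mu>" "integrable \<mu> (\<lambda>x. x\<^sup>2)" "gamma_stein_equation \<nu> \<mu>"
    and "real_distribution \<eta>" "integrable \<eta> (\<lambda>x. x\<^sup>2)" "gamma_stein_equation \<nu> \<eta>"
  shows "\<mu> = \<eta>"
proof (rule Levy_uniqueness)
  show "char \<mu> = char \<eta>"
    using char_gamma_stein[OF assms(1-3)] char_gamma_stein[OF assms(4-6)] by (simp add: fun_eq_iff)
qed fact+

context
  fixes \<alpha> :: real
  assumes \<alpha>: "\<alpha> > 0"
begin

lemma gamma_density_nonneg: "gamma_density \<alpha> x \<ge> 0"
  using \<alpha> by (simp add: gamma_density_def Gamma_real_pos less_imp_le)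

lemma gamma_density_measurable [measurable]: "gamma_density \<alpha> \<in> borel_measurable borel"
  unfolding gamma_density_def [abs_def] by measurable

lemma gamma_density_moment:
  "has_bochner_integral lborel (\<lambda>x. gamma_density \<alpha> x * x ^ k) (pochhammer \<alpha> k)"
proof (rule has_bochner_integral_nn_integral)
  have pos: "Gamma \<alpha> > 0" using \<alpha> by (rule Gamma_real_pos)
  have "(\<integral>\<^sup>+x. ennreal (gamma_density \<alpha> x * x ^ k) \<partial>lborel)
      = (\<integral>\<^sup>+x. ennreal (1 / Gamma \<alpha>) * ennreal (indicator {0..} x * x powr (\<alpha> + real k - 1) / exp x) \<partial>lborel)"
  proof (rule nn_integral_cong)
    fix x :: real
    show "ennreal (gamma_density \<alpha> x * x ^ k)
        = ennreal (1 / Gamma \<alpha>) * ennreal (indicator {0..} x * x powr (\<alpha> + real k - 1) / exp x)"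
    proof (cases "x > 0")
      case True
      then have "x powr (\<alpha> - 1) * x ^ k = x powr (\<alpha> + real k - 1)"
        by (simp add: powr_realpow[symmetric] powr_add[symmetric] algebra_simps)
      then have "gamma_density \<alpha> x * x ^ k = 1 / Gamma \<alpha> * (x powr (\<alpha> + real k - 1) / exp x)"
        using True by (simp add: gamma_density_def exp_minus field_simps)
      then show ?thesis using True pos by (subst ennreal_mult[symmetric]) auto
    next
      case False
      then have "indicator {0..} x * x powr (\<alpha> + real k - 1) / exp x = 0"
        by (cases "x = 0") auto
      moreover have "gamma_density \<alpha> x * x ^ k = 0" using False by (simp add: gamma_density_def)
      ultimately show ?thesis by (simp only: ennreal_0 mult_zero_right)
    qed
  qed
  also have "\<dots> = ennreal (1 / Gamma \<alpha>) * ennreal (Gamma (\<alpha> + real k))"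
    using \<alpha> by (subst nn_integral_cmult) (simp_all add: Gamma_conv_nn_integral_real)
  also have "\<dots> = ennreal (pochhammer \<alpha> k)"
  proof -
    have "\<alpha> \<notin> \<int>\<^sub>\<le>\<^sub>0" using \<alpha> by (auto elim: nonpos_Ints_cases)
    then show ?thesis using pos \<alpha> by (subst ennreal_mult[symmetric]) (auto simp: pochhammer_Gamma Gamma_real_pos less_imp_le)
  qed
  finally show "(\<integral>\<^sup>+x. ennreal (gamma_density \<alpha> x * x ^ k) \<partial>lborel) = ennreal (pochhammer \<alpha> k)" .
  have "gamma_density \<alpha> x * x ^ k \<ge> 0" for x
    by (cases "x > 0") (auto simp: gamma_density_nonneg, simp add: gamma_density_def)
  then show "AE x in lborel. 0 \<le> gamma_density \<alpha> x * x ^ k" by simp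
  show "0 \<le> pochhammer \<alpha> k" using \<alpha> by (simp add: pochhammer_nonneg)
qed simp

definition gamma_law :: "real measure" where
  "gamma_law = density lborel (\<lambda>x. ennreal (gamma_density \<alpha> x))"

lemma sets_gamma_law [simp, measurable_cong]: "sets gamma_law = sets borel"
  and space_gamma_law [simp]: "space gamma_law = UNIV"
  by (simp_all add: gamma_law_def)

lemma gamma_law_moment:
  shows integrable_gamma_law: "integrable gamma_law (\<lambda>x. x ^ k)"
    and integral_gamma_law: "(\<integral>x. x ^ k \<partial>gamma_law) = pochhammer \<alpha> k"
  using gamma_density_moment[of k] unfolding gamma_law_def
  by (simp_all add: has_bochner_integral_iff integrable_density integral_density gamma_density_nonneg)

lemma prob_space_gamma_law: "prob_space gamma_law"
proof
  have "ennreal (\<integral>x. gamma_density \<alpha> x * x ^ 0 \<partial>lborel) = (\<integral>\<^sup>+x. ennreal (gamma_density \<alpha> x * x ^ 0) \<partial>lborel)"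
    using gamma_density_moment[of 0]
    by (intro nn_integral_eq_integral[symmetric]) (auto simp: has_bochner_integral_iff gamma_density_nonneg)
  then have "(\<integral>\<^sup>+x. ennreal (gamma_density \<alpha> x) \<partial>lborel) = 1"
    using gamma_density_moment[of 0] by (simp add: has_bochner_integral_iff)
  then show "emeasure gamma_law (space gamma_law) = 1"
    by (simp add: gamma_law_def emeasure_density)
qed

text \<open>
  The function \<open>x \<gamma>(x) exp(i t x)\<close>, where \<open>\<gamma>\<close> is the density, vanishes at \<open>0\<close> and at \<open>\<infinity>\<close>, and its derivative
  is \<open>\<gamma>(x) (\<alpha> - x + i t x) exp(i t x)\<close>.
\<close>

lemma gamma_law_stein:
  "(CLINT x|gamma_law. complex_of_real (x - \<alpha>) * iexp (t * x))
    = \<i> * complex_of_real t * (CLINT x|gamma_law. complex_of_real x * iexp (t * x))"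
proof -
  define g where "g x = x powr \<alpha> * exp (- x) / Gamma \<alpha>" for x
  define F where "F x = g x *\<^sub>R iexp (t * x)" for x
  define f where "f x = gamma_density \<alpha> x *\<^sub>R
      ((complex_of_real (\<alpha> - x) + \<i> * complex_of_real t * complex_of_real x) * iexp (t * x))" for x
  have "Gamma \<alpha> > 0" using \<alpha> by (rule Gamma_real_pos)
  interpret prob_space gamma_law by (rule prob_space_gamma_law)
  have int1: "integrable gamma_law (\<lambda>x. x)" using integrable_gamma_law[of 1] by simp
  have intI: "integrable gamma_law (\<lambda>x. complex_of_real x * iexp (t * x))"
    by (rule Bochner_Integration.integrable_bound[OF int1]) (auto simp: norm_mult)
  have intJ: "integrable gamma_law (\<lambda>x. complex_of_real (\<alpha> - x) * iexp (t * x))"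
  proof (rule Bochner_Integration.integrable_bound)
    show "integrable gamma_law (\<lambda>x. \<alpha> - x)"
      by (intro Bochner_Integration.integrable_diff int1) simp
    show "AE x in gamma_law. norm (complex_of_real (\<alpha> - x) * iexp (t * x)) \<le> norm (\<alpha> - x)"
      by (simp only: norm_mult norm_of_real norm_exp_i_times real_norm_def) simp
  qed measurable
  have intf: "integrable gamma_law (\<lambda>x. complex_of_real (\<alpha> - x) * iexp (t * x)
      + \<i> * complex_of_real t * (complex_of_real x * iexp (t * x)))"
    by (intro Bochner_Integration.integrable_add integrable_mult_right intI intJ)
  have f_eq: "f x = gamma_density \<alpha> x *\<^sub>R (complex_of_real (\<alpha> - x) * iexp (t * x)
      + \<i> * complex_of_real t * (complex_of_real x * iexp (t * x)))" for x
    by (simp add: f_def algebra_simps)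
  have intf': "integrable lborel f"
    using intf unfolding gamma_law_def f_eq
    by (subst (asm) integrable_density) (auto simp: gamma_density_nonneg)
  have f_ind: "indicator {0<..} x *\<^sub>R f x = f x" for x
    by (auto simp: f_def gamma_density_def indicator_def)
  have "(LBINT x=0..\<infinity>. f x) = 0 - 0"
  proof (rule interval_integral_FTC_integrable)
    show "(F has_vector_derivative f x) (at x)" if "0 < ereal x" for x
    proof -
      from that have "x > 0" by simp
      then have "(g has_real_derivative (\<alpha> * x powr (\<alpha> - 1) * exp (- x) - x powr \<alpha> * exp (- x)) / Gamma \<alpha>) (at x)"
        using \<open>Gamma \<alpha> > 0\<close> unfolding g_def
        by (auto intro!: derivative_eq_intros simp: field_simps)
      moreover have "x powr \<alpha> = x powr (\<alpha> - 1) * x"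
        using \<open>x > 0\<close> by (simp add: powr_diff)
      ultimately have dg: "(g has_real_derivative gamma_density \<alpha> x * (\<alpha> - x)) (at x)"
        using \<open>x > 0\<close> by (simp add: gamma_density_def field_simps)
      have gx: "g x = gamma_density \<alpha> x * x"
        using \<open>x > 0\<close> by (simp add: g_def gamma_density_def powr_diff)
      have "((\<lambda>z. exp (\<i> * (complex_of_real t * z))) has_field_derivative
          (\<i> * complex_of_real t * iexp (t * x))) (at (complex_of_real x))"
        by (auto intro!: derivative_eq_intros)
      from has_vector_derivative_real_field[OF this]
      have "((\<lambda>x. iexp (t * x)) has_vector_derivative (\<i> * complex_of_real t * iexp (t * x))) (at x)"
        by simp
      from has_vector_derivative_scaleR[OF dg this]
      show ?thesis
        unfolding F_def [abs_def] f_def gx by (simp add: scaleR_conv_of_real algebra_simps)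
    qed
    show "isCont f x" if "0 < ereal x" for x
    proof -
      from that have "x > 0" by simp
      have "isCont (\<lambda>x. (x powr (\<alpha> - 1) * exp (- x) / Gamma \<alpha>) *\<^sub>R
          ((complex_of_real (\<alpha> - x) + \<i> * complex_of_real t * complex_of_real x) * iexp (t * x))) x"
        using \<open>x > 0\<close> \<open>Gamma \<alpha> > 0\<close> by (intro continuous_intros) auto
      moreover have "\<forall>\<^sub>F y in nhds x. f y = (y powr (\<alpha> - 1) * exp (- y) / Gamma \<alpha>) *\<^sub>R
          ((complex_of_real (\<alpha> - y) + \<i> * complex_of_real t * complex_of_real y) * iexp (t * y))"
        using eventually_nhds_in_open[of "{0<..}" x] \<open>x > 0\<close>
        by (auto elim!: eventually_mono simp: f_def gamma_density_def)
      ultimately show ?thesis by (simp add: isCont_cong)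
    qed
    show "set_integrable lborel (einterval 0 \<infinity>) f"
      using intf' by (simp add: set_integrable_def zero_ereal_def f_ind)
    have norm_F: "norm (F x) = \<bar>g x\<bar>" for x by (simp add: F_def)
    have "((\<lambda>x. x powr \<alpha> * exp (- x)) \<longlongrightarrow> 0) (at_right 0)" using \<alpha> by real_asymp
    moreover have "((\<lambda>x. x powr \<alpha> * exp (- x)) \<longlongrightarrow> 0) at_top" using \<alpha> by real_asymp
    ultimately have "(g \<longlongrightarrow> 0) (at_right 0)" "(g \<longlongrightarrow> 0) at_top"
      unfolding g_def by (auto intro: tendsto_divide_zero)
    then have "(F \<longlongrightarrow> 0) (at_right 0)" "(F \<longlongrightarrow> 0) at_top"
      by (auto simp: norm_F tendsto_rabs_zero_iff intro!: tendsto_norm_zero_cancel[of F])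
    then show "((F \<circ> real_of_ereal) \<longlongrightarrow> 0) (at_right 0)" "((F \<circ> real_of_ereal) \<longlongrightarrow> 0) (at_left \<infinity>)"
      by (simp_all add: zero_ereal_def ereal_tendsto_simps)
  qed simp
  then have "(CLINT x|lborel. f x) = 0"
    by (simp add: interval_lebesgue_integral_def set_lebesgue_integral_def zero_ereal_def f_ind)
  then have "(CLINT x|gamma_law. complex_of_real (\<alpha> - x) * iexp (t * x)
      + \<i> * complex_of_real t * (complex_of_real x * iexp (t * x))) = 0"
    unfolding gamma_law_def f_eq by (subst integral_density) (auto simp: gamma_density_nonneg)
  then have "(CLINT x|gamma_law. complex_of_real (\<alpha> - x) * iexp (t * x))
      + \<i> * complex_of_real t * (CLINT x|gamma_law. complex_of_real x * iexp (t * x)) = 0"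
    by (simp only: Bochner_Integration.integral_add intJ intI integrable_mult_right integral_mult_right_zero)
  moreover have "(CLINT x|gamma_law. complex_of_real (x - \<alpha>) * iexp (t * x))
      = - (CLINT x|gamma_law. complex_of_real (\<alpha> - x) * iexp (t * x))"
    unfolding Bochner_Integration.integral_minus[symmetric]
    by (rule Bochner_Integration.integral_cong) (auto simp: algebra_simps)
  ultimately show ?thesis by (simp add: add_eq_0_iff)
qed

end

lemma centered_gamma_eq: "centered_gamma \<nu> = distr (gamma_law (\<nu> / 2)) borel (\<lambda>x. 2 * x - \<nu>)"
  if "\<nu> > 0"
  using that by (simp add: centered_gamma_def gamma_law_def)

context
  fixes \<nu> :: real
  assumes \<nu>: "\<nu> > 0"
begin

lemma real_distribution_centered_gamma: "real_distribution (centered_gamma \<nu>)"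
proof -
  interpret prob_space "gamma_law (\<nu> / 2)" using \<nu> by (intro prob_space_gamma_law) simp
  show ?thesis unfolding centered_gamma_eq[OF \<nu>]
    by (rule real_distribution_distr) (use \<nu> in simp)
qed

text \<open>
  The affine image of \<open>gamma_law_stein\<close> with \<open>\<alpha> = \<nu> / 2\<close> and \<open>t = 2 s\<close>.
\<close>

lemma centered_gamma_stein: "gamma_stein_equation \<nu> (centered_gamma \<nu>)"
  unfolding gamma_stein_equation_def
proof
  fix s
  let ?G = "gamma_law (\<nu> / 2)"
  have pos: "\<nu> / 2 > 0" using \<nu> by simp
  interpret prob_space ?G by (rule prob_space_gamma_law[OF pos])
  have meas: "(\<lambda>x. 2 * x - \<nu>) \<in> measurable ?G borel"
    using pos by (simp add: measurable_cong_sets[OF sets_gamma_law refl])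
  have int1: "integrable ?G (\<lambda>x. x)" using integrable_gamma_law[OF pos, of 1] by simp
  have e: "iexp (s * (2 * x - \<nu>)) = iexp (- s * \<nu>) * iexp ((2 * s) * x)" for x
    by (simp add: exp_add[symmetric] algebra_simps)
  have inte: "integrable ?G (\<lambda>x. iexp (u * x))" for u
    by (rule integrable_iexp) (use pos in auto)
  have intI: "integrable ?G (\<lambda>x. complex_of_real x * iexp (u * x))" for u
    by (rule Bochner_Integration.integrable_bound[OF int1]) (use pos in \<open>auto simp: norm_mult\<close>)
  define I where "I = (CLINT x|?G. complex_of_real x * iexp ((2 * s) * x))"
  define J where "J = (CLINT x|?G. complex_of_real (x - \<nu> / 2) * iexp ((2 * s) * x))"
  define K where "K = (CLINT x|?G. iexp ((2 * s) * x))"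
  have J1: "J = \<i> * complex_of_real (2 * s) * I"
    unfolding J_def I_def by (rule gamma_law_stein[OF pos])
  have J2: "J = I - complex_of_real (\<nu> / 2) * K"
  proof -
    have "J = (CLINT x|?G. complex_of_real x * iexp ((2 * s) * x) - complex_of_real (\<nu> / 2) * iexp ((2 * s) * x))"
      unfolding J_def by (intro Bochner_Integration.integral_cong) (auto simp: algebra_simps)
    also have "\<dots> = I - complex_of_real (\<nu> / 2) * K"
      unfolding I_def K_def
      by (simp only: Bochner_Integration.integral_diff intI inte integrable_mult_right integral_mult_right_zero)
    finally show ?thesis .
  qed
  have L: "(CLINT x|centered_gamma \<nu>. complex_of_real x * iexp (s * x)) = 2 * iexp (- s * \<nu>) * J"
  proof -
    have "(CLINT x|centered_gamma \<nu>. complex_of_real x * iexp (s * x))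
        = (CLINT x|?G. complex_of_real (2 * x - \<nu>) * iexp (s * (2 * x - \<nu>)))"
      unfolding centered_gamma_eq[OF \<nu>] by (subst integral_distr[OF meas]) auto
    also have "\<dots> = (CLINT x|?G. (2 * iexp (- s * \<nu>)) * (complex_of_real (x - \<nu> / 2) * iexp ((2 * s) * x)))"
      unfolding e by (intro Bochner_Integration.integral_cong) (auto simp: algebra_simps)
    finally show ?thesis unfolding J_def by (simp only: integral_mult_right_zero)
  qed
  have C: "char (centered_gamma \<nu>) s = iexp (- s * \<nu>) * K"
  proof -
    have "char (centered_gamma \<nu>) s = (CLINT x|?G. iexp (s * (2 * x - \<nu>)))"
      unfolding centered_gamma_eq[OF \<nu>] char_def by (subst integral_distr[OF meas]) auto
    then show ?thesis unfolding e K_def by (simp only: integral_mult_right_zero)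
  qed
  have "2 * (2 * iexp (- s * \<nu>) * J) + 2 * complex_of_real \<nu> * (iexp (- s * \<nu>) * K) = 4 * iexp (- s * \<nu>) * I"
    unfolding J2 by (simp add: algebra_simps)
  then show "(CLINT x|centered_gamma \<nu>. complex_of_real x * iexp (s * x)) = \<i> * complex_of_real s *
        (2 * (CLINT x|centered_gamma \<nu>. complex_of_real x * iexp (s * x))
          + 2 * complex_of_real \<nu> * char (centered_gamma \<nu>) s)"
    unfolding L C by (simp add: J1)
qed

lemma centered_gamma_moments:
  shows "integrable (centered_gamma \<nu>) (\<lambda>x. x ^ k)"
    and "(\<integral>x. x\<^sup>2 \<partial>centered_gamma \<nu>) = 2 * \<nu>"
    and "(\<integral>x. x ^ 3 \<partial>centered_gamma \<nu>) = 8 * \<nu>"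
    and "(\<integral>x. x ^ 4 \<partial>centered_gamma \<nu>) = 48 * \<nu> + 12 * \<nu>\<^sup>2"
proof -
  let ?G = "gamma_law (\<nu> / 2)"
  have pos: "\<nu> / 2 > 0" using \<nu> by simp
  note [simp] = integrable_gamma_law[OF pos] integral_gamma_law[OF pos]
  have [simp]: "integrable ?G (\<lambda>x. x)" "(\<integral>x. x \<partial>?G) = \<nu> / 2"
    using integrable_gamma_law[OF pos, of 1] integral_gamma_law[OF pos, of 1] by simp_all
  interpret prob_space ?G by (rule prob_space_gamma_law[OF pos])
  have meas: "(\<lambda>x. 2 * x - \<nu>) \<in> measurable ?G borel"
    using pos by (simp add: measurable_cong_sets[OF sets_gamma_law refl])
  have binom: "(2 * x - \<nu>) ^ k = (\<Sum>j\<le>k. real (k choose j) * 2 ^ j * (- \<nu>) ^ (k - j) * x ^ j)" for x k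
    using binomial_ring[of "2 * x" "- \<nu>" k] by (simp add: power_mult_distrib algebra_simps)
  show "integrable (centered_gamma \<nu>) (\<lambda>x. x ^ k)" for k
    unfolding centered_gamma_eq[OF \<nu>] by (subst integrable_distr_eq[OF meas]) (auto simp: binom)
  have m: "(\<integral>x. x ^ k \<partial>centered_gamma \<nu>)
      = (\<Sum>j\<le>k. real (k choose j) * 2 ^ j * (- \<nu>) ^ (k - j) * pochhammer (\<nu> / 2) j)" for k
    unfolding centered_gamma_eq[OF \<nu>] by (subst integral_distr[OF meas]) (auto simp: binom)
  show "(\<integral>x. x\<^sup>2 \<partial>centered_gamma \<nu>) = 2 * \<nu>"
    unfolding m by (simp add: numeral_eq_Suc pochhammer_Suc field_simps)
  show "(\<integral>x. x ^ 3 \<partial>centered_gamma \<nu>) = 8 * \<nu>"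
    unfolding m by (simp add: numeral_eq_Suc pochhammer_Suc field_simps)
  show "(\<integral>x. x ^ 4 \<partial>centered_gamma \<nu>) = 48 * \<nu> + 12 * \<nu>\<^sup>2"
    unfolding m by (simp add: numeral_eq_Suc pochhammer_Suc field_simps)
qed

lemma centered_gamma_eqI:
  assumes "real_distribution \<mu>" "integrable \<mu> (\<lambda>x. x\<^sup>2)" "gamma_stein_equation \<nu> \<mu>"
  shows "\<mu> = centered_gamma \<nu>"
  by (intro gamma_stein_unique[of _ \<nu>] assms real_distribution_centered_gamma
      centered_gamma_moments centered_gamma_stein)

end

section \<open>Passage to the limit\<close>

context prob_space
begin

lemma integrable_power_le:
  assumes "random_variable borel X" "integrable M (\<lambda>\<omega>. X \<omega> ^ 6)" "r \<le> 6"
  shows "integrable M (\<lambda>\<omega>. (X \<omega> :: real) ^ r)"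
proof (rule Bochner_Integration.integrable_bound)
  show "integrable M (\<lambda>\<omega>. 1 + X \<omega> ^ 6)" using assms(2) by simp
  show "AE \<omega> in M. norm (X \<omega> ^ r) \<le> norm (1 + X \<omega> ^ 6)"
  proof (rule AE_I2)
    fix \<omega>
    have "\<bar>X \<omega>\<bar> ^ r \<le> 1 + \<bar>X \<omega>\<bar> ^ 6"
    proof (cases "\<bar>X \<omega>\<bar> \<le> 1")
      case True
      then have "\<bar>X \<omega>\<bar> ^ r \<le> 1" by (simp add: power_le_one)
      then show ?thesis by (simp add: add_increasing2)
    next
      case False
      then have "\<bar>X \<omega>\<bar> ^ r \<le> \<bar>X \<omega>\<bar> ^ 6" using assms(3) by (intro power_increasing) auto
      then show ?thesis by simp
    qed
    then show "norm (X \<omega> ^ r) \<le> norm (1 + X \<omega> ^ 6)"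
      by (simp add: power_abs abs_of_nonneg)
  qed
qed (use assms(1) in measurable)

text \<open>
  A consequence of Young's inequality \<open>\<bar>u v\<bar> \<le> u\<^sup>2 / (2 d) + d v\<^sup>2 / 2\<close>, in which \<open>d\<close> is chosen small first.
\<close>

lemma expectation_product_tendsto_0:
  fixes U Q :: "nat \<Rightarrow> 'a \<Rightarrow> real"
  assumes U: "\<And>k. U k \<in> borel_measurable M" "\<And>k. integrable M (\<lambda>\<omega>. (U k \<omega>)\<^sup>2)"
    and Q: "\<And>k. Q k \<in> borel_measurable M" "\<And>k. integrable M (\<lambda>\<omega>. (Q k \<omega>)\<^sup>2)"
    and U0: "(\<lambda>k. expectation (\<lambda>\<omega>. (U k \<omega>)\<^sup>2)) \<longlonglongrightarrow> 0"
    and B: "\<And>k. expectation (\<lambda>\<omega>. (Q k \<omega>)\<^sup>2) \<le> B"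
  shows "integrable M (\<lambda>\<omega>. U k \<omega> * Q k \<omega>)"
    and "(\<lambda>k. expectation (\<lambda>\<omega>. \<bar>U k \<omega> * Q k \<omega>\<bar>)) \<longlonglongrightarrow> 0"
proof -
  have young: "\<bar>u * v\<bar> \<le> u\<^sup>2 / (2 * e) + e * v\<^sup>2 / 2" if "e > 0" for u v e :: real
  proof -
    have "0 \<le> (\<bar>u\<bar> - e * \<bar>v\<bar>)\<^sup>2" by simp
    then have "2 * e * \<bar>u * v\<bar> \<le> u\<^sup>2 + e * e * v\<^sup>2"
      by (simp add: power2_diff power_mult_distrib abs_mult power2_eq_square[of e] algebra_simps)
    then show ?thesis using that by (simp add: field_simps)
  qed
  show int: "integrable M (\<lambda>\<omega>. U k \<omega> * Q k \<omega>)" for k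
  proof (rule Bochner_Integration.integrable_bound)
    show "integrable M (\<lambda>\<omega>. (U k \<omega>)\<^sup>2 / (2 * 1) + 1 * (Q k \<omega>)\<^sup>2 / 2)" using U(2) Q(2) by simp
    show "AE \<omega> in M. norm (U k \<omega> * Q k \<omega>) \<le> norm ((U k \<omega>)\<^sup>2 / (2 * 1) + 1 * (Q k \<omega>)\<^sup>2 / 2)"
      unfolding real_norm_def by (intro AE_I2 order_trans[OF young[OF zero_less_one] abs_ge_self])
  qed (intro borel_measurable_times U(1) Q(1))
  have "B \<ge> 0" using B[of 0] by (rule order_trans[rotated]) simp
  show "(\<lambda>k. expectation (\<lambda>\<omega>. \<bar>U k \<omega> * Q k \<omega>\<bar>)) \<longlonglongrightarrow> 0"
  proof (rule LIMSEQ_I)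
    fix e :: real assume "e > 0"
    define d where "d = e / (B + 1)"
    have "d > 0" using \<open>e > 0\<close> \<open>B \<ge> 0\<close> by (simp add: d_def)
    then have "d * e > 0" using \<open>e > 0\<close> by simp
    then obtain N where "\<forall>k\<ge>N. norm (expectation (\<lambda>\<omega>. (U k \<omega>)\<^sup>2) - 0) < d * e"
      using LIMSEQ_D[OF U0] by blast
    then have N: "expectation (\<lambda>\<omega>. (U k \<omega>)\<^sup>2) < d * e" if "k \<ge> N" for k
      using that by (simp add: abs_less_iff)
    have "norm (expectation (\<lambda>\<omega>. \<bar>U k \<omega> * Q k \<omega>\<bar>) - 0) < e" if "k \<ge> N" for k
    proof -
      have "expectation (\<lambda>\<omega>. \<bar>U k \<omega> * Q k \<omega>\<bar>) \<le> expectation (\<lambda>\<omega>. (U k \<omega>)\<^sup>2 / (2 * d) + d * (Q k \<omega>)\<^sup>2 / 2)"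
      proof (rule integral_mono)
        show "integrable M (\<lambda>\<omega>. \<bar>U k \<omega> * Q k \<omega>\<bar>)" using int[of k] by (rule integrable_abs)
        show "integrable M (\<lambda>\<omega>. (U k \<omega>)\<^sup>2 / (2 * d) + d * (Q k \<omega>)\<^sup>2 / 2)"
          using U(2)[of k] Q(2)[of k] by simp
      qed (rule young[OF \<open>d > 0\<close>])
      also have "\<dots> = expectation (\<lambda>\<omega>. (U k \<omega>)\<^sup>2) / (2 * d) + d * expectation (\<lambda>\<omega>. (Q k \<omega>)\<^sup>2) / 2"
        using U(2)[of k] Q(2)[of k] by simp
      also have "\<dots> < d * e / (2 * d) + d * (B + 1) / 2"
        using N[OF that] B[of k] \<open>d > 0\<close>
        by (intro add_strict_mono divide_strict_right_mono mult_strict_left_mono) auto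
      also have "\<dots> = e"
      proof -
        have "d * (B + 1) = e" using \<open>B \<ge> 0\<close> by (simp add: d_def)
        then show ?thesis using \<open>d > 0\<close> by simp
      qed
      finally show ?thesis by simp
    qed
    then show "\<exists>N. \<forall>k\<ge>N. norm (expectation (\<lambda>\<omega>. \<bar>U k \<omega> * Q k \<omega>\<bar>) - 0) < e" by blast
  qed
qed

end

text \<open>
  In \<open>L\<^sup>2\<close> convergence alone the fourth moments may fail to converge.  Bounded sixth moments exclude
  this: a difference \<open>X\<^sub>n\<^sup>r - X\<^sup>r\<close> with \<open>r \<le> 4\<close> is \<open>X\<^sub>n - X\<close> times a factor of degree at most three, whose
  square is controlled by the sixth moments.
\<close>

locale bounded_L2_limit = prob_space M for M :: "'w measure" +
  fixes X\<^sub>n :: "nat \<Rightarrow> 'w \<Rightarrow> real" and X :: "'w \<Rightarrow> real" and C :: real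
  assumes meas [measurable]: "\<And>k. X\<^sub>n k \<in> borel_measurable M" "X \<in> borel_measurable M"
    and int6: "\<And>k. integrable M (\<lambda>\<omega>. X\<^sub>n k \<omega> ^ 6)"
    and bound6: "\<And>k. expectation (\<lambda>\<omega>. X\<^sub>n k \<omega> ^ 6) \<le> C"
    and int2: "integrable M (\<lambda>\<omega>. (X \<omega>)\<^sup>2)"
    and L2: "L2_tendsto M X\<^sub>n X"
begin

lemma integrable_diff_square: "integrable M (\<lambda>\<omega>. (X\<^sub>n k \<omega> - X \<omega>)\<^sup>2)"
proof (rule Bochner_Integration.integrable_bound)
  show "integrable M (\<lambda>\<omega>. 2 * (X\<^sub>n k \<omega>)\<^sup>2 + 2 * (X \<omega>)\<^sup>2)"
    using int2 integrable_power_le[OF meas(1) int6, of 2] by simp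
  show "AE \<omega> in M. norm ((X\<^sub>n k \<omega> - X \<omega>)\<^sup>2) \<le> norm (2 * (X\<^sub>n k \<omega>)\<^sup>2 + 2 * (X \<omega>)\<^sup>2)"
  proof (rule AE_I2)
    fix \<omega>
    have "0 \<le> (X\<^sub>n k \<omega> + X \<omega>)\<^sup>2" by simp
    then have "(X\<^sub>n k \<omega> - X \<omega>)\<^sup>2 \<le> 2 * (X\<^sub>n k \<omega>)\<^sup>2 + 2 * (X \<omega>)\<^sup>2"
      by (simp add: power2_sum power2_diff)
    then show "norm ((X\<^sub>n k \<omega> - X \<omega>)\<^sup>2) \<le> norm (2 * (X\<^sub>n k \<omega>)\<^sup>2 + 2 * (X \<omega>)\<^sup>2)" by simp
  qed
qed measurable

lemma expectation_diff_square: "(\<lambda>k. expectation (\<lambda>\<omega>. (X\<^sub>n k \<omega> - X \<omega>)\<^sup>2)) \<longlonglongrightarrow> 0"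
proof -
  have "(\<integral>\<^sup>+\<omega>. ennreal ((X\<^sub>n k \<omega> - X \<omega>)\<^sup>2) \<partial>M) = ennreal (expectation (\<lambda>\<omega>. (X\<^sub>n k \<omega> - X \<omega>)\<^sup>2))" for k
    by (intro nn_integral_eq_integral integrable_diff_square) simp
  then have "(\<lambda>k. ennreal (expectation (\<lambda>\<omega>. (X\<^sub>n k \<omega> - X \<omega>)\<^sup>2))) \<longlonglongrightarrow> 0"
    using L2 by (simp add: L2_tendsto_def)
  then show ?thesis by (subst (asm) ennreal_tendsto_0_iff) auto
qed

text \<open>
  Fatou's lemma along a subsequence that converges almost everywhere.
\<close>

lemma integrable_limit_sixth: "integrable M (\<lambda>\<omega>. X \<omega> ^ 6)"
proof -
  obtain r :: "nat \<Rightarrow> nat" where r: "AE \<omega> in M. (\<lambda>k. (X\<^sub>n (r k) \<omega> - X \<omega>)\<^sup>2) \<longlonglongrightarrow> 0"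
    using tendsto_L1_AE_subseq[of M "\<lambda>k \<omega>. (X\<^sub>n k \<omega> - X \<omega>)\<^sup>2"]
      integrable_diff_square expectation_diff_square by auto
  have lim: "AE \<omega> in M. ennreal (X \<omega> ^ 6) = liminf (\<lambda>k. ennreal (X\<^sub>n (r k) \<omega> ^ 6))"
    using r
  proof eventually_elim
    case (elim \<omega>)
    have "(\<lambda>k. sqrt ((X\<^sub>n (r k) \<omega> - X \<omega>)\<^sup>2)) \<longlonglongrightarrow> sqrt 0"
      using elim by (rule tendsto_real_sqrt)
    then have "(\<lambda>k. X\<^sub>n (r k) \<omega> - X \<omega>) \<longlonglongrightarrow> 0"
      by (simp add: tendsto_rabs_zero_iff)
    then have "(\<lambda>k. X\<^sub>n (r k) \<omega>) \<longlonglongrightarrow> X \<omega>" by (simp add: LIM_zero_iff)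
    then have "(\<lambda>k. ennreal (X\<^sub>n (r k) \<omega> ^ 6)) \<longlonglongrightarrow> ennreal (X \<omega> ^ 6)"
      by (intro tendsto_intros)
    then show ?case by (rule lim_imp_Liminf[OF sequentially_bot, symmetric])
  qed
  have "(\<integral>\<^sup>+\<omega>. ennreal (X \<omega> ^ 6) \<partial>M) = (\<integral>\<^sup>+\<omega>. liminf (\<lambda>k. ennreal (X\<^sub>n (r k) \<omega> ^ 6)) \<partial>M)"
    by (rule nn_integral_cong_AE[OF lim])
  also have "\<dots> \<le> liminf (\<lambda>k. \<integral>\<^sup>+\<omega>. ennreal (X\<^sub>n (r k) \<omega> ^ 6) \<partial>M)"
    by (rule nn_integral_liminf) measurable
  also have "\<dots> \<le> liminf (\<lambda>k. ennreal C)"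
  proof (intro Liminf_mono always_eventually allI)
    fix k
    have "(\<integral>\<^sup>+\<omega>. ennreal (X\<^sub>n (r k) \<omega> ^ 6) \<partial>M) = ennreal (expectation (\<lambda>\<omega>. X\<^sub>n (r k) \<omega> ^ 6))"
      by (intro nn_integral_eq_integral int6) simp
    then show "(\<integral>\<^sup>+\<omega>. ennreal (X\<^sub>n (r k) \<omega> ^ 6) \<partial>M) \<le> ennreal C"
      using bound6 by (simp add: ennreal_leI)
  qed
  also have "\<dots> < \<infinity>" by (simp add: Liminf_const)
  finally show ?thesis by (intro integrableI_bounded) auto
qed

lemma L2_product_tendsto_0:
  assumes "\<And>k. Q k \<in> borel_measurable M" "\<And>k. integrable M (\<lambda>\<omega>. (Q k \<omega>)\<^sup>2)"
    and "\<And>k. expectation (\<lambda>\<omega>. (Q k \<omega>)\<^sup>2) \<le> B"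
  shows "(\<lambda>k. expectation (\<lambda>\<omega>. \<bar>(X\<^sub>n k \<omega> - X \<omega>) * Q k \<omega>\<bar>)) \<longlonglongrightarrow> 0"
    and "integrable M (\<lambda>\<omega>. (X\<^sub>n k \<omega> - X \<omega>) * Q k \<omega>)"
  using expectation_product_tendsto_0[of "\<lambda>k \<omega>. X\<^sub>n k \<omega> - X \<omega>" Q B] assms
    integrable_diff_square expectation_diff_square by auto

lemma moment_tendsto:
  assumes "r \<le> 4"
  shows "(\<lambda>k. expectation (\<lambda>\<omega>. X\<^sub>n k \<omega> ^ r)) \<longlonglongrightarrow> expectation (\<lambda>\<omega>. X \<omega> ^ r)"
proof -
  define Q where "Q k \<omega> = (\<Sum>i<r. X \<omega> ^ (r - Suc i) * X\<^sub>n k \<omega> ^ i)" for k \<omega>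
  have diff: "X\<^sub>n k \<omega> ^ r - X \<omega> ^ r = (X\<^sub>n k \<omega> - X \<omega>) * Q k \<omega>" for k \<omega>
    unfolding Q_def by (rule power_diff_sumr2)
  have Q2: "(Q k \<omega>)\<^sup>2 \<le> (real r)\<^sup>2 * (1 + X\<^sub>n k \<omega> ^ 6 + X \<omega> ^ 6)" for k \<omega>
  proof -
    define m where "m = max 1 (max \<bar>X\<^sub>n k \<omega>\<bar> \<bar>X \<omega>\<bar>)"
    have m: "1 \<le> m" "\<bar>X\<^sub>n k \<omega>\<bar> \<le> m" "\<bar>X \<omega>\<bar> \<le> m" by (auto simp: m_def)
    have "\<bar>Q k \<omega>\<bar> \<le> (\<Sum>i<r. \<bar>X \<omega> ^ (r - Suc i) * X\<^sub>n k \<omega> ^ i\<bar>)" unfolding Q_def by (rule sum_abs)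
    also have "\<dots> \<le> (\<Sum>i<r. m ^ 3)"
    proof (rule sum_mono)
      fix i assume "i \<in> {..<r}"
      have "\<bar>X \<omega> ^ (r - Suc i) * X\<^sub>n k \<omega> ^ i\<bar> \<le> m ^ (r - Suc i) * m ^ i"
        unfolding abs_mult power_abs using m by (intro mult_mono power_mono) auto
      also have "\<dots> \<le> m ^ 3"
        unfolding power_add[symmetric] using m assms \<open>i \<in> {..<r}\<close> by (intro power_increasing) auto
      finally show "\<bar>X \<omega> ^ (r - Suc i) * X\<^sub>n k \<omega> ^ i\<bar> \<le> m ^ 3" .
    qed
    finally have "\<bar>Q k \<omega>\<bar> \<le> real r * m ^ 3" by simp
    then have "\<bar>Q k \<omega>\<bar>\<^sup>2 \<le> (real r * m ^ 3)\<^sup>2" by (rule power_mono) simp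
    then have "(Q k \<omega>)\<^sup>2 \<le> (real r)\<^sup>2 * m ^ 6" by (simp add: power_mult_distrib flip: power_mult)
    also have "m ^ 6 \<le> 1 + X\<^sub>n k \<omega> ^ 6 + X \<omega> ^ 6"
    proof -
      have "m = 1 \<or> m = \<bar>X\<^sub>n k \<omega>\<bar> \<or> m = \<bar>X \<omega>\<bar>" by (auto simp: m_def max_def)
      moreover have "X\<^sub>n k \<omega> ^ 6 \<ge> 0" "X \<omega> ^ 6 \<ge> 0" by simp_all
      ultimately show ?thesis by (auto simp: power_even_abs)
    qed
    finally show ?thesis by (simp add: mult_left_mono)
  qed
  have Qm[measurable]: "Q k \<in> borel_measurable M" for k unfolding Q_def by measurable
  have dom: "integrable M (\<lambda>\<omega>. (real r)\<^sup>2 * (1 + X\<^sub>n k \<omega> ^ 6 + X \<omega> ^ 6))" for k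
    using int6 integrable_limit_sixth by simp
  have Qi: "integrable M (\<lambda>\<omega>. (Q k \<omega>)\<^sup>2)" for k
    by (rule Bochner_Integration.integrable_bound[OF dom[of k]])
      (use Q2 in \<open>auto intro!: AE_I2 order_trans[OF _ abs_ge_self]\<close>)
  have QB: "expectation (\<lambda>\<omega>. (Q k \<omega>)\<^sup>2) \<le> (real r)\<^sup>2 * (1 + C + expectation (\<lambda>\<omega>. X \<omega> ^ 6))" for k
  proof -
    have "expectation (\<lambda>\<omega>. (Q k \<omega>)\<^sup>2) \<le> expectation (\<lambda>\<omega>. (real r)\<^sup>2 * (1 + X\<^sub>n k \<omega> ^ 6 + X \<omega> ^ 6))"
      by (rule integral_mono[OF Qi dom Q2])
    also have "\<dots> = (real r)\<^sup>2 * (1 + expectation (\<lambda>\<omega>. X\<^sub>n k \<omega> ^ 6) + expectation (\<lambda>\<omega>. X \<omega> ^ 6))"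
      using int6 integrable_limit_sixth by (simp add: prob_space)
    also have "\<dots> \<le> (real r)\<^sup>2 * (1 + C + expectation (\<lambda>\<omega>. X \<omega> ^ 6))"
      using bound6 by (intro mult_left_mono add_mono) auto
    finally show ?thesis .
  qed
  note lim = L2_product_tendsto_0[OF Qm Qi QB]
  have "(\<lambda>k. expectation (\<lambda>\<omega>. X\<^sub>n k \<omega> ^ r) - expectation (\<lambda>\<omega>. X \<omega> ^ r)) \<longlonglongrightarrow> 0"
  proof (rule Lim_null_comparison[OF _ lim(1)], intro always_eventually allI)
    fix k
    have "integrable M (\<lambda>\<omega>. X\<^sub>n k \<omega> ^ r)" "integrable M (\<lambda>\<omega>. X \<omega> ^ r)"
      using assms by (auto intro: integrable_power_le[OF _ int6] integrable_power_le[OF _ integrable_limit_sixth])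
    then have "expectation (\<lambda>\<omega>. X\<^sub>n k \<omega> ^ r) - expectation (\<lambda>\<omega>. X \<omega> ^ r)
        = expectation (\<lambda>\<omega>. (X\<^sub>n k \<omega> - X \<omega>) * Q k \<omega>)"
      unfolding diff[symmetric] by (rule Bochner_Integration.integral_diff[symmetric])
    then show "norm (expectation (\<lambda>\<omega>. X\<^sub>n k \<omega> ^ r) - expectation (\<lambda>\<omega>. X \<omega> ^ r))
        \<le> expectation (\<lambda>\<omega>. \<bar>(X\<^sub>n k \<omega> - X \<omega>) * Q k \<omega>\<bar>)"
      by (simp only: real_norm_def integral_abs_bound)
  qed
  then show ?thesis by (simp add: LIM_zero_iff)
qed

lemma integrable_limit: "integrable M X" and integrable_approx: "integrable M (X\<^sub>n k)"
  using integrable_power_le[OF meas(2) integrable_limit_sixth, of 1]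
    integrable_power_le[OF meas(1) int6, of 1] by simp_all

lemma iexp_lipschitz: "norm (iexp a - iexp b) \<le> \<bar>a - b\<bar>"
proof -
  have "iexp a - iexp b = iexp b * (iexp (a - b) - 1)"
    by (simp add: right_diff_distrib exp_add[symmetric])
  then have "norm (iexp a - iexp b) = norm (iexp (a - b) - 1)" by (simp add: norm_mult)
  also have "\<dots> \<le> \<bar>a - b\<bar>" using iexp_approx1[of "a - b" 0] by simp
  finally show ?thesis .
qed

text \<open>
  \<open>L\<^sup>2\<close> convergence is enough for integrands that are Lipschitz functions of the approximated
  variable, even if the Lipschitz factor is only square integrable.
\<close>

lemma complex_expectation_tendsto:
  fixes F :: "nat \<Rightarrow> 'w \<Rightarrow> complex"
  assumes "\<And>k. integrable M (F k)" "integrable M G"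
    and Q: "Q \<in> borel_measurable M" "integrable M (\<lambda>\<omega>. (Q \<omega>)\<^sup>2)"
    and le: "\<And>k \<omega>. norm (F k \<omega> - G \<omega>) \<le> \<bar>(X\<^sub>n k \<omega> - X \<omega>) * Q \<omega>\<bar>"
  shows "(\<lambda>k. CLINT \<omega>|M. F k \<omega>) \<longlonglongrightarrow> (CLINT \<omega>|M. G \<omega>)"
proof -
  note lim = L2_product_tendsto_0[of "\<lambda>_. Q", OF Q order_refl]
  have "(\<lambda>k. (CLINT \<omega>|M. F k \<omega>) - (CLINT \<omega>|M. G \<omega>)) \<longlonglongrightarrow> 0"
  proof (rule Lim_null_comparison[OF _ lim(1)], intro always_eventually allI)
    fix k
    have "norm ((CLINT \<omega>|M. F k \<omega>) - (CLINT \<omega>|M. G \<omega>)) = norm (CLINT \<omega>|M. F k \<omega> - G \<omega>)"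
      using assms(1,2) by simp
    also have "\<dots> \<le> expectation (\<lambda>\<omega>. norm (F k \<omega> - G \<omega>))" by (rule integral_norm_bound)
    also have "\<dots> \<le> expectation (\<lambda>\<omega>. \<bar>(X\<^sub>n k \<omega> - X \<omega>) * Q \<omega>\<bar>)"
      using assms(1,2) lim(2) le by (intro integral_mono) auto
    finally show "norm ((CLINT \<omega>|M. F k \<omega>) - (CLINT \<omega>|M. G \<omega>))
        \<le> expectation (\<lambda>\<omega>. \<bar>(X\<^sub>n k \<omega> - X \<omega>) * Q \<omega>\<bar>)" .
  qed
  then show ?thesis by (simp add: LIM_zero_iff)
qed

lemma expectation_iexp_tendsto:
  "(\<lambda>k. CLINT \<omega>|M. iexp (s * X\<^sub>n k \<omega>)) \<longlonglongrightarrow> (CLINT \<omega>|M. iexp (s * X \<omega>))"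
proof (rule complex_expectation_tendsto)
  show "norm (iexp (s * X\<^sub>n k \<omega>) - iexp (s * X \<omega>)) \<le> \<bar>(X\<^sub>n k \<omega> - X \<omega>) * s\<bar>" for k \<omega>
    using iexp_lipschitz[of "s * X\<^sub>n k \<omega>" "s * X \<omega>"] by (simp add: algebra_simps)
qed (auto intro!: integrable_iexp)

lemma expectation_times_iexp_tendsto:
  "(\<lambda>k. CLINT \<omega>|M. complex_of_real (X\<^sub>n k \<omega>) * iexp (s * X\<^sub>n k \<omega>))
    \<longlonglongrightarrow> (CLINT \<omega>|M. complex_of_real (X \<omega>) * iexp (s * X \<omega>))"
proof (rule complex_expectation_tendsto)
  show "integrable M (\<lambda>\<omega>. complex_of_real (X\<^sub>n k \<omega>) * iexp (s * X\<^sub>n k \<omega>))" for k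
    by (rule Bochner_Integration.integrable_bound[OF integrable_approx[of k]]) (auto simp: norm_mult)
  show "integrable M (\<lambda>\<omega>. complex_of_real (X \<omega>) * iexp (s * X \<omega>))"
    by (rule Bochner_Integration.integrable_bound[OF integrable_limit]) (auto simp: norm_mult)
  show "integrable M (\<lambda>\<omega>. (1 + \<bar>s\<bar> * \<bar>X \<omega>\<bar>)\<^sup>2)"
    using int2 integrable_limit by (simp add: power2_sum power_mult_distrib)
  show "norm (complex_of_real (X\<^sub>n k \<omega>) * iexp (s * X\<^sub>n k \<omega>) - complex_of_real (X \<omega>) * iexp (s * X \<omega>))
      \<le> \<bar>(X\<^sub>n k \<omega> - X \<omega>) * (1 + \<bar>s\<bar> * \<bar>X \<omega>\<bar>)\<bar>" for k \<omega>
  proof -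
    have "complex_of_real (X\<^sub>n k \<omega>) * iexp (s * X\<^sub>n k \<omega>) - complex_of_real (X \<omega>) * iexp (s * X \<omega>)
        = complex_of_real (X\<^sub>n k \<omega> - X \<omega>) * iexp (s * X\<^sub>n k \<omega>)
          + complex_of_real (X \<omega>) * (iexp (s * X\<^sub>n k \<omega>) - iexp (s * X \<omega>))"
      by (simp add: algebra_simps)
    also have "norm \<dots> \<le> norm (complex_of_real (X\<^sub>n k \<omega> - X \<omega>) * iexp (s * X\<^sub>n k \<omega>))
        + norm (complex_of_real (X \<omega>) * (iexp (s * X\<^sub>n k \<omega>) - iexp (s * X \<omega>)))"
      by (rule norm_triangle_ineq)
    also have "norm (complex_of_real (X\<^sub>n k \<omega> - X \<omega>) * iexp (s * X\<^sub>n k \<omega>)) = \<bar>X\<^sub>n k \<omega> - X \<omega>\<bar>"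
      by (simp only: norm_mult norm_of_real norm_exp_i_times) simp
    also have "norm (complex_of_real (X \<omega>) * (iexp (s * X\<^sub>n k \<omega>) - iexp (s * X \<omega>)))
        \<le> \<bar>X \<omega>\<bar> * \<bar>s * X\<^sub>n k \<omega> - s * X \<omega>\<bar>"
      unfolding norm_mult norm_of_real by (intro mult_left_mono iexp_lipschitz) simp
    also have "\<bar>X \<omega>\<bar> * \<bar>s * X\<^sub>n k \<omega> - s * X \<omega>\<bar> = \<bar>X\<^sub>n k \<omega> - X \<omega>\<bar> * (\<bar>s\<bar> * \<bar>X \<omega>\<bar>)"
      by (simp add: right_diff_distrib[symmetric] abs_mult)
    finally show ?thesis by (simp add: abs_mult distrib_left)
  qed
qed measurable

end

text \<open>
  For a centered variable this is \<open>\<kappa>\<^sub>4 - 12 \<kappa>\<^sub>3 + 24 \<kappa>\<^sub>2\<close> in terms of the cumulants, which explains its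
  additivity over independent sums.
\<close>

definition cumulant_defect :: "'w measure \<Rightarrow> ('w \<Rightarrow> real) \<Rightarrow> real" where
  "cumulant_defect M X = (\<integral>\<omega>. X \<omega> ^ 4 \<partial>M) - 3 * (\<integral>\<omega>. (X \<omega>)\<^sup>2 \<partial>M)\<^sup>2
    - 12 * (\<integral>\<omega>. X \<omega> ^ 3 \<partial>M) + 24 * (\<integral>\<omega>. (X \<omega>)\<^sup>2 \<partial>M)"

text \<open>
  The number of variables and the Gaussian family may change along the sequence, as the grids of the
  elementary integrals do.
\<close>

definition chaos_limit :: "'w measure \<Rightarrow> nat \<Rightarrow> ('w \<Rightarrow> real) \<Rightarrow> bool" where
  "chaos_limit M q X \<longleftrightarrow> X \<in> borel_measurable M \<and>
    (\<exists>m \<xi> P. (\<forall>k. gaussian_family M (m k) (\<xi> k) \<and>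
        poly_span (m k) (multilinear_homogeneous (m k) q) (P k)) \<and>
      L2_tendsto M (\<lambda>k \<omega>. P k (\<lambda>i. \<xi> k i \<omega>)) X)"

context prob_space
begin

text \<open>
  All four claims are limits of statements about polynomials.  In the last one, a vanishing defect
  forces the discrepancies \<open>D k\<close> to tend to \<open>0\<close> in \<open>L\<^sup>2\<close>, so \<open>\<Gamma>\<close> may be replaced by \<open>2 P + E[P\<^sup>2]\<close> in
  \<open>stein_identity_char\<close> before the limit is taken.
\<close>

theorem chaos_limit_properties:
  assumes chaos: "chaos_limit M q X" and "q > 0" and int2: "integrable M (\<lambda>\<omega>. (X \<omega>)\<^sup>2)"
  shows "integrable M (\<lambda>\<omega>. X \<omega> ^ 6)" and "expectation X = 0" and "cumulant_defect M X \<ge> 0"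
    and "cumulant_defect M X = 0 \<Longrightarrow>
      gamma_stein_equation (expectation (\<lambda>\<omega>. (X \<omega>)\<^sup>2) / 2) (distr M borel X)"
proof -
  have X: "X \<in> borel_measurable M" using chaos by (simp add: chaos_limit_def)
  obtain m0 \<xi>0 P0 where 0: "\<And>k. gaussian_family M (m0 k) (\<xi>0 k)"
      "\<And>k. poly_span (m0 k) (multilinear_homogeneous (m0 k) q) (P0 k)"
    and L2_0: "L2_tendsto M (\<lambda>k \<omega>. P0 k (\<lambda>i. \<xi>0 k i \<omega>)) X"
    using chaos unfolding chaos_limit_def by blast
  define X0 where "X0 k \<omega> = P0 k (\<lambda>i. \<xi>0 k i \<omega>)" for k \<omega>
  have X0m: "X0 k \<in> borel_measurable M" for k
    unfolding X0_def [abs_def]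
    by (rule gaussian_family.measurable_poly[OF 0(1) poly_span_is_poly[OF 0(2)]])
  have X0i: "integrable M (\<lambda>\<omega>. X0 k \<omega> ^ r)" for k r
    unfolding X0_def
    by (rule gaussian_family.integrable_poly[OF 0(1)], rule is_poly_power, rule poly_span_is_poly[OF 0(2)])
  have L2_0': "(\<lambda>k. \<integral>\<^sup>+\<omega>. ennreal ((X0 k \<omega> - X \<omega>)\<^sup>2) \<partial>M) \<longlonglongrightarrow> 0"
    using L2_0 by (simp add: L2_tendsto_def X0_def)
  define c where "c = 2 + 2 * expectation (\<lambda>\<omega>. (X \<omega>)\<^sup>2)"
  have "\<forall>\<^sub>F k in sequentially. (\<integral>\<^sup>+\<omega>. ennreal ((X0 k \<omega> - X \<omega>)\<^sup>2) \<partial>M) < 1"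
    using L2_0' by (rule order_tendstoD) simp
  then obtain N where N: "\<And>k. k \<ge> N \<Longrightarrow> (\<integral>\<^sup>+\<omega>. ennreal ((X0 k \<omega> - X \<omega>)\<^sup>2) \<partial>M) < 1"
    by (auto simp: eventually_sequentially)
  have second: "expectation (\<lambda>\<omega>. (X0 k \<omega>)\<^sup>2) \<le> c" if "k \<ge> N" for k
  proof -
    have "ennreal (expectation (\<lambda>\<omega>. (X0 k \<omega>)\<^sup>2)) = (\<integral>\<^sup>+\<omega>. ennreal ((X0 k \<omega>)\<^sup>2) \<partial>M)"
      by (intro nn_integral_eq_integral[symmetric] X0i) simp
    also have "\<dots> \<le> (\<integral>\<^sup>+\<omega>. 2 * ennreal ((X0 k \<omega> - X \<omega>)\<^sup>2) + 2 * ennreal ((X \<omega>)\<^sup>2) \<partial>M)"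
    proof (rule nn_integral_mono)
      fix \<omega>
      have "0 \<le> (X0 k \<omega> - X \<omega> - X \<omega>)\<^sup>2" by simp
      then have "(X0 k \<omega>)\<^sup>2 \<le> 2 * (X0 k \<omega> - X \<omega>)\<^sup>2 + 2 * (X \<omega>)\<^sup>2"
        by (simp add: power2_eq_square algebra_simps)
      then have "ennreal ((X0 k \<omega>)\<^sup>2) \<le> ennreal (2 * (X0 k \<omega> - X \<omega>)\<^sup>2 + 2 * (X \<omega>)\<^sup>2)"
        by (rule ennreal_leI)
      also have "\<dots> = 2 * ennreal ((X0 k \<omega> - X \<omega>)\<^sup>2) + 2 * ennreal ((X \<omega>)\<^sup>2)"
        by (simp add: ennreal_plus ennreal_mult)
      finally show "ennreal ((X0 k \<omega>)\<^sup>2) \<le> 2 * ennreal ((X0 k \<omega> - X \<omega>)\<^sup>2) + 2 * ennreal ((X \<omega>)\<^sup>2)" .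
    qed
    also have "\<dots> = 2 * (\<integral>\<^sup>+\<omega>. ennreal ((X0 k \<omega> - X \<omega>)\<^sup>2) \<partial>M) + 2 * (\<integral>\<^sup>+\<omega>. ennreal ((X \<omega>)\<^sup>2) \<partial>M)"
      using X0m[of k] X by (simp add: nn_integral_add nn_integral_cmult)
    also have "(\<integral>\<^sup>+\<omega>. ennreal ((X \<omega>)\<^sup>2) \<partial>M) = ennreal (expectation (\<lambda>\<omega>. (X \<omega>)\<^sup>2))"
      by (intro nn_integral_eq_integral int2) simp
    also have "2 * (\<integral>\<^sup>+\<omega>. ennreal ((X0 k \<omega> - X \<omega>)\<^sup>2) \<partial>M) + 2 * ennreal (expectation (\<lambda>\<omega>. (X \<omega>)\<^sup>2))
        \<le> 2 * 1 + 2 * ennreal (expectation (\<lambda>\<omega>. (X \<omega>)\<^sup>2))"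
      using N[OF that] by (intro add_mono mult_left_mono) auto
    also have "\<dots> = ennreal c"
      by (simp add: c_def ennreal_plus ennreal_mult)
    finally show ?thesis by (subst (asm) ennreal_le_iff) (simp_all add: c_def)
  qed
  \<comment> \<open>The sequence is restarted at \<open>N\<close>, from where on its second moments are bounded by \<open>c\<close>.\<close>
  define m where "m k = m0 (k + N)" for k
  define \<xi> where "\<xi> k = \<xi>0 (k + N)" for k
  define P where "P k = P0 (k + N)" for k
  define Xn where "Xn k \<omega> = P k (\<lambda>i. \<xi> k i \<omega>)" for k \<omega>
  have G: "gaussian_family M (m k) (\<xi> k)" for k unfolding m_def \<xi>_def by (rule 0)
  have P: "poly_span (m k) (multilinear_homogeneous (m k) q) (P k)" for k unfolding m_def P_def by (rule 0)
  have Xn_X0: "Xn k = X0 (k + N)" for k by (simp add: fun_eq_iff Xn_def X0_def P_def \<xi>_def)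
  have poly: "is_poly (m k) (P k)" for k by (rule poly_span_is_poly[OF P])
  have deg: "poly_deg (m k) q (P k)" for k
    by (rule poly_span_mono[OF P]) (auto simp: multilinear_homogeneous_def exponents_upto_def)
  have Ex_eq: "gaussian_family.\<E> M (\<xi> k) (\<lambda>x. P k x ^ r) = expectation (\<lambda>\<omega>. Xn k \<omega> ^ r)" for k r
    by (simp add: gaussian_family.\<E>_def[OF G] Xn_def)
  have L2: "L2_tendsto M Xn X"
    using LIMSEQ_ignore_initial_segment[OF L2_0', of N] by (simp add: L2_tendsto_def Xn_X0)
  have bound6: "expectation (\<lambda>\<omega>. Xn k \<omega> ^ 6) \<le> 125 ^ q * c ^ 3" for k
  proof -
    have "expectation (\<lambda>\<omega>. Xn k \<omega> ^ 6) \<le> 125 ^ q * expectation (\<lambda>\<omega>. (Xn k \<omega>)\<^sup>2) ^ 3"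
      using gaussian_family.multilinear_sixth_moment[OF G order_refl
          poly_span_mono[OF P multilinear_homogeneous_subset]] by (simp only: Ex_eq)
    also have "\<dots> \<le> 125 ^ q * c ^ 3"
      unfolding Xn_X0 by (intro mult_left_mono power_mono second) auto
    finally show ?thesis .
  qed
  interpret bounded_L2_limit M Xn X "125 ^ q * c ^ 3"
    by unfold_locales (use X X0m X0i int2 L2 bound6 in \<open>auto simp: Xn_X0\<close>)
  show "integrable M (\<lambda>\<omega>. X \<omega> ^ 6)" by (rule integrable_limit_sixth)
  have eigen: "number_op (m k) (P k) x = real q * P k x" for k x
    by (rule multilinear_number_op[OF P])
  have "expectation (Xn k) = 0" for k
    using gaussian_family.Ex_power_Suc[OF G[of k] poly eigen \<open>q > 0\<close>, of 0] Ex_eq[of k 1] by simp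
  then show "expectation X = 0"
    using moment_tendsto[of 1] by (simp add: LIMSEQ_const_iff)
  define v where "v k = expectation (\<lambda>\<omega>. (Xn k \<omega>)\<^sup>2)" for k
  define \<Gamma> where "\<Gamma> k \<omega> = stein_kernel (m k) q (P k) (\<lambda>i. \<xi> k i \<omega>)" for k \<omega>
  define D where "D k \<omega> = \<Gamma> k \<omega> - 2 * Xn k \<omega> - v k" for k \<omega>
  have D_poly: "is_poly (m k) (\<lambda>x. stein_kernel (m k) q (P k) x - 2 * P k x - v k)" for k
    by (intro poly_span_diff poly_span_scale is_poly_stein_kernel poly is_poly_const)
  have D_meas: "D k \<in> borel_measurable M" for k
    using gaussian_family.measurable_poly[OF G D_poly] by (simp add: D_def [abs_def] \<Gamma>_def Xn_def)
  have D_int: "integrable M (\<lambda>\<omega>. (D k \<omega>)\<^sup>2)" for k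
    using gaussian_family.integrable_poly[OF G is_poly_power[OF D_poly, of _ 2]]
    by (simp add: D_def \<Gamma>_def Xn_def)
  have D_le: "expectation (\<lambda>\<omega>. (D k \<omega>)\<^sup>2) \<le> cumulant_defect M (Xn k) / 3" for k
  proof -
    have "gaussian_family.\<E> M (\<xi> k) (\<lambda>x. (stein_kernel (m k) q (P k) x - 2 * P k x - v k)\<^sup>2)
        \<le> cumulant_defect M (Xn k) / 3"
      using gaussian_family.stein_discrepancy_bound[OF G deg eigen \<open>q > 0\<close>]
      unfolding Ex_eq v_def cumulant_defect_def .
    then show ?thesis by (simp add: gaussian_family.\<E>_def[OF G] D_def \<Gamma>_def Xn_def)
  qed
  have defect_lim: "(\<lambda>k. cumulant_defect M (Xn k)) \<longlonglongrightarrow> cumulant_defect M X"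
    unfolding cumulant_defect_def by (intro tendsto_intros moment_tendsto) auto
  have "0 \<le> cumulant_defect M (Xn k)" for k
  proof -
    have "0 \<le> expectation (\<lambda>\<omega>. (D k \<omega>)\<^sup>2)" by simp
    with D_le[of k] show ?thesis by linarith
  qed
  then show "cumulant_defect M X \<ge> 0"
    by (intro tendsto_lowerbound[OF defect_lim]) auto
  assume zero: "cumulant_defect M X = 0"
  have D0: "(\<lambda>k. expectation (\<lambda>\<omega>. (D k \<omega>)\<^sup>2)) \<longlonglongrightarrow> 0"
  proof (rule tendsto_sandwich[where f="\<lambda>_. 0" and h="\<lambda>k. cumulant_defect M (Xn k) / 3"])
    show "(\<lambda>k. cumulant_defect M (Xn k) / 3) \<longlonglongrightarrow> 0"
      using tendsto_divide_zero[of "\<lambda>k. cumulant_defect M (Xn k)" sequentially 3] defect_lim zero by simp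
    show "\<forall>\<^sub>F k in sequentially. expectation (\<lambda>\<omega>. (D k \<omega>)\<^sup>2) \<le> cumulant_defect M (Xn k) / 3"
      using D_le by simp
  qed simp_all
  have D1: "(\<lambda>k. expectation (\<lambda>\<omega>. \<bar>D k \<omega> * 1\<bar>)) \<longlonglongrightarrow> 0" and D1i: "\<And>k. integrable M (\<lambda>\<omega>. D k \<omega> * 1)"
    by (rule expectation_product_tendsto_0[of D "\<lambda>_ _. 1" 1]; use D_meas D_int D0 in \<open>simp add: prob_space\<close>)+
  show "gamma_stein_equation (expectation (\<lambda>\<omega>. (X \<omega>)\<^sup>2) / 2) (distr M borel X)"
    unfolding gamma_stein_equation_def
  proof
    fix s
    define e where "e k \<omega> = iexp (s * Xn k \<omega>)" for k \<omega>
    define a where "a k = (CLINT \<omega>|M. complex_of_real (Xn k \<omega>) * e k \<omega>)" for k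
    define b where "b k = (CLINT \<omega>|M. e k \<omega>)" for k
    define d where "d k = (CLINT \<omega>|M. complex_of_real (D k \<omega>) * e k \<omega>)" for k
    have e_meas: "e k \<in> borel_measurable M" for k
      unfolding e_def [abs_def] by measurable
    have norm_e: "norm (e k \<omega>) = 1" for k \<omega> unfolding e_def by (rule norm_exp_i_times)
    have e_int: "integrable M (\<lambda>\<omega>. complex_of_real (F \<omega>) * e k \<omega>)" if "integrable M F" for F k
      by (rule Bochner_Integration.integrable_bound[OF that])
        (use that e_meas[of k] in \<open>auto simp: norm_mult norm_e\<close>)
    have eq: "a k = \<i> * complex_of_real s * (d k + (2 * a k + complex_of_real (v k) * b k))" for k
    proof -
      have "a k = \<i> * complex_of_real s * (CLINT \<omega>|M. complex_of_real (\<Gamma> k \<omega>) * e k \<omega>)"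
        unfolding a_def e_def Xn_def \<Gamma>_def
        by (rule gaussian_family.stein_identity_char[OF G P \<open>q > 0\<close>])
      also have "(CLINT \<omega>|M. complex_of_real (\<Gamma> k \<omega>) * e k \<omega>)
          = (CLINT \<omega>|M. complex_of_real (D k \<omega>) * e k \<omega> +
              (2 * (complex_of_real (Xn k \<omega>) * e k \<omega>) + complex_of_real (v k) * e k \<omega>))"
        by (intro Bochner_Integration.integral_cong) (auto simp: D_def algebra_simps)
      also have "\<dots> = d k + (2 * a k + complex_of_real (v k) * b k)"
      proof -
        have 1: "integrable M (\<lambda>\<omega>. complex_of_real (D k \<omega>) * e k \<omega>)"
          using D1i[of k] by (intro e_int) simp
        have 2: "integrable M (\<lambda>\<omega>. complex_of_real (Xn k \<omega>) * e k \<omega>)"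
          by (intro e_int integrable_approx)
        have 3: "integrable M (\<lambda>\<omega>. e k \<omega>)"
          using e_int[of "\<lambda>_. 1" k] by simp
        show ?thesis unfolding a_def b_def d_def
          by (simp only: Bochner_Integration.integral_add Bochner_Integration.integrable_add
              integrable_mult_right integral_mult_right_zero 1 2 3)
      qed
      finally show ?thesis .
    qed
    have "d \<longlonglongrightarrow> 0"
    proof (rule Lim_null_comparison[OF _ D1], intro always_eventually allI)
      fix k
      have "norm (d k) \<le> expectation (\<lambda>\<omega>. norm (complex_of_real (D k \<omega>) * e k \<omega>))"
        unfolding d_def by (rule integral_norm_bound)
      then show "norm (d k) \<le> expectation (\<lambda>\<omega>. \<bar>D k \<omega> * 1\<bar>)"
        by (simp add: norm_mult norm_e)
    qed
    moreover have a_lim: "a \<longlonglongrightarrow> (CLINT \<omega>|M. complex_of_real (X \<omega>) * iexp (s * X \<omega>))"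
      using expectation_times_iexp_tendsto[of s] by (simp add: a_def [abs_def] e_def)
    moreover have "b \<longlonglongrightarrow> (CLINT \<omega>|M. iexp (s * X \<omega>))"
      unfolding b_def [abs_def] e_def [abs_def] by (rule expectation_iexp_tendsto)
    moreover have "v \<longlonglongrightarrow> expectation (\<lambda>\<omega>. (X \<omega>)\<^sup>2)"
      using moment_tendsto[of 2] by (simp add: v_def [abs_def])
    ultimately have "(\<lambda>k. \<i> * complex_of_real s * (d k + (2 * a k + complex_of_real (v k) * b k)))
        \<longlonglongrightarrow> \<i> * complex_of_real s * (0 + (2 * (CLINT \<omega>|M. complex_of_real (X \<omega>) * iexp (s * X \<omega>))
          + complex_of_real (expectation (\<lambda>\<omega>. (X \<omega>)\<^sup>2)) * (CLINT \<omega>|M. iexp (s * X \<omega>))))"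
      by (intro tendsto_intros)
    then have "a \<longlonglongrightarrow> \<i> * complex_of_real s * (0 + (2 * (CLINT \<omega>|M. complex_of_real (X \<omega>) * iexp (s * X \<omega>))
          + complex_of_real (expectation (\<lambda>\<omega>. (X \<omega>)\<^sup>2)) * (CLINT \<omega>|M. iexp (s * X \<omega>))))"
      unfolding eq[symmetric] .
    from LIMSEQ_unique[OF a_lim this]
    show "(CLINT x|distr M borel X. complex_of_real x * iexp (s * x)) = \<i> * complex_of_real s *
        (2 * (CLINT x|distr M borel X. complex_of_real x * iexp (s * x))
          + 2 * complex_of_real (expectation (\<lambda>\<omega>. (X \<omega>)\<^sup>2) / 2) * char (distr M borel X) s)"
      unfolding char_def by (simp add: integral_distr)
  qed
qed

end

section \<open>Multiple integrals are limits of multilinear polynomials\<close>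

text \<open>
  Each index \<open>\<sigma>\<close> is injective, so its product of increments contains no variable twice; the standard
  deviations of the increments are moved into the coefficients.
\<close>

lemma elementary_integral_polynomial:
  fixes W :: "real \<Rightarrow> 'w \<Rightarrow> real"
  assumes "strict_mono_on {..m} p"
  shows "\<exists>P. poly_span m (multilinear_homogeneous m q) P \<and> elementary_integral W q m p a
      = (\<lambda>\<omega>. P (\<lambda>i. (W (p (Suc i)) \<omega> - W (p i) \<omega>) / sqrt (p (Suc i) - p i)))"
proof (intro exI conjI ext)
  define s where "s i = sqrt (p (Suc i) - p i)" for i
  define \<alpha> where "\<alpha> \<sigma> = (\<lambda>i. if i \<in> \<sigma> ` {..<q} then 1 else 0 :: nat)" for \<sigma> :: "nat \<Rightarrow> nat"
  define P where "P x = (\<Sum>\<sigma>\<in>off_diagonal_indices q m.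
      (a \<sigma> * (\<Prod>j<q. s (\<sigma> j))) * monomial m (\<alpha> \<sigma>) x)" for x
  have index: "\<sigma> ` {..<q} \<subseteq> {..<m}" "inj_on \<sigma> {..<q}" if "\<sigma> \<in> off_diagonal_indices q m" for \<sigma>
    using that by (auto simp: off_diagonal_indices_def)
  have mon: "monomial m (\<alpha> \<sigma>) x = (\<Prod>j<q. x (\<sigma> j))" if "\<sigma> \<in> off_diagonal_indices q m" for \<sigma> x
  proof -
    have "monomial m (\<alpha> \<sigma>) x = (\<Prod>i<m. if i \<in> \<sigma> ` {..<q} then x i else 1)"
      unfolding monomial_def by (rule prod.cong) (auto simp: \<alpha>_def)
    also have "\<dots> = (\<Prod>i\<in>{..<m} \<inter> \<sigma> ` {..<q}. x i)"
      by (rule prod.inter_restrict[symmetric]) simp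
    also have "{..<m} \<inter> \<sigma> ` {..<q} = \<sigma> ` {..<q}" using index[OF that] by blast
    finally show ?thesis using index[OF that] by (simp add: prod.reindex)
  qed
  show "poly_span m (multilinear_homogeneous m q) P"
    unfolding P_def [abs_def]
  proof (intro poly_span_sum poly_span_monomial)
    fix \<sigma> assume \<sigma>: "\<sigma> \<in> off_diagonal_indices q m"
    have "sum (\<alpha> \<sigma>) {..<m} = card ({..<m} \<inter> \<sigma> ` {..<q})"
      unfolding \<alpha>_def by (simp add: sum.inter_restrict[symmetric])
    also have "{..<m} \<inter> \<sigma> ` {..<q} = \<sigma> ` {..<q}" using index[OF \<sigma>] by blast
    also have "card (\<sigma> ` {..<q}) = q" using index[OF \<sigma>] by (simp add: card_image)
    finally show "\<alpha> \<sigma> \<in> multilinear_homogeneous m q"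
      using index[OF \<sigma>] by (auto simp: multilinear_homogeneous_def \<alpha>_def)
  qed
  show "elementary_integral W q m p a \<omega> = P (\<lambda>i. (W (p (Suc i)) \<omega> - W (p i) \<omega>) / sqrt (p (Suc i) - p i))" for \<omega>
    unfolding elementary_integral_def P_def
  proof (rule sum.cong)
    fix \<sigma> assume \<sigma>: "\<sigma> \<in> off_diagonal_indices q m"
    have "W (p (Suc (\<sigma> j))) \<omega> - W (p (\<sigma> j)) \<omega>
        = s (\<sigma> j) * ((W (p (Suc (\<sigma> j))) \<omega> - W (p (\<sigma> j)) \<omega>) / s (\<sigma> j))" if "j < q" for j
    proof -
      have "\<sigma> j < m" using index[OF \<sigma>] that by auto
      then have "p (\<sigma> j) < p (Suc (\<sigma> j))" by (intro strict_mono_onD[OF assms]) auto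
      then show ?thesis by (simp add: s_def)
    qed
    then have "(\<Prod>j<q. W (p (Suc (\<sigma> j))) \<omega> - W (p (\<sigma> j)) \<omega>)
        = (\<Prod>j<q. s (\<sigma> j) * ((W (p (Suc (\<sigma> j))) \<omega> - W (p (\<sigma> j)) \<omega>) / s (\<sigma> j)))"
      by (intro prod.cong) auto
    then show "a \<sigma> * (\<Prod>j<q. W (p (Suc (\<sigma> j))) \<omega> - W (p (\<sigma> j)) \<omega>)
      = (a \<sigma> * (\<Prod>j<q. s (\<sigma> j))) *
        monomial m (\<alpha> \<sigma>) (\<lambda>i. (W (p (Suc i)) \<omega> - W (p i) \<omega>) / sqrt (p (Suc i) - p i))"
      unfolding mon[OF \<sigma>] s_def[symmetric] by (simp only: prod.distrib mult.assoc)
  qed simp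
qed

context wiener_process
begin

lemma normalized_increments:
  assumes p: "strict_mono_on {..m} p" "p ` {..m} \<subseteq> T"
  shows "gaussian_family M m (\<lambda>i \<omega>. (W (p (Suc i)) \<omega> - W (p i) \<omega>) / sqrt (p (Suc i) - p i))"
proof unfold_locales
  show "indep_vars (\<lambda>_. borel) (\<lambda>i \<omega>. (W (p (Suc i)) \<omega> - W (p i) \<omega>) / sqrt (p (Suc i) - p i)) {..<m}"
    by (rule indep_vars_compose2[OF independent_increments[OF p],
        of "\<lambda>i x. x / sqrt (p (Suc i) - p i)"]) simp
  fix i assume "i < m"
  then have "p i < p (Suc i)" by (intro strict_mono_onD[OF p(1)]) auto
  moreover have "p i \<in> T" "p (Suc i) \<in> T" using p(2) \<open>i < m\<close> by auto
  ultimately have "distributed M lborel (\<lambda>\<omega>. W (p (Suc i)) \<omega> - W (p i) \<omega>)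
      (\<lambda>x. ennreal (normal_density 0 (sqrt (p (Suc i) - p i)) x))"
    by (intro gaussian_increments)
  then show "distributed M lborel (\<lambda>\<omega>. (W (p (Suc i)) \<omega> - W (p i) \<omega>) / sqrt (p (Suc i) - p i))
      (\<lambda>x. ennreal (std_normal_density x))"
    using \<open>p i < p (Suc i)\<close> normal_standard_normal_convert[of "sqrt (p (Suc i) - p i)"
        "\<lambda>\<omega>. W (p (Suc i)) \<omega> - W (p i) \<omega>" 0] by simp
qed

lemma multiple_integral_chaos_limit:
  assumes "is_multiple_integral M T W q f X"
  shows "chaos_limit M q X"
proof -
  obtain m p a where grid: "\<And>k. strict_mono_on {..m k} (p k)" "\<And>k. p k ` {..m k} \<subseteq> T"
    and X: "X \<in> borel_measurable M"
    and L2: "L2_tendsto M (\<lambda>k. elementary_integral W q (m k) (p k) (a k)) X"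
    using assms unfolding is_multiple_integral_def by blast
  let ?\<xi> = "\<lambda>k i \<omega>. (W (p k (Suc i)) \<omega> - W (p k i) \<omega>) / sqrt (p k (Suc i) - p k i)"
  have "\<exists>P. poly_span (m k) (multilinear_homogeneous (m k) q) P \<and>
      elementary_integral W q (m k) (p k) (a k) = (\<lambda>\<omega>. P (\<lambda>i. ?\<xi> k i \<omega>))" for k
    by (rule elementary_integral_polynomial[OF grid(1)])
  then have "\<exists>P. \<forall>k. poly_span (m k) (multilinear_homogeneous (m k) q) (P k) \<and>
      elementary_integral W q (m k) (p k) (a k) = (\<lambda>\<omega>. P k (\<lambda>i. ?\<xi> k i \<omega>))"
    by (intro choice allI)
  then obtain P where P: "\<And>k. poly_span (m k) (multilinear_homogeneous (m k) q) (P k)"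
      "\<And>k. elementary_integral W q (m k) (p k) (a k) = (\<lambda>\<omega>. P k (\<lambda>i. ?\<xi> k i \<omega>))"
    by blast
  have "L2_tendsto M (\<lambda>k \<omega>. P k (\<lambda>i. ?\<xi> k i \<omega>)) X" using L2 unfolding P(2) .
  then show ?thesis
    unfolding chaos_limit_def using X P(1) normalized_increments[OF grid]
    by (intro conjI exI[of _ m] exI[of _ ?\<xi>] exI[of _ P]) auto
qed

end

section \<open>Independent summands of a Gamma variable\<close>

text \<open>
  In the expansions of the moments of \<open>X + Y\<close>, the terms that contain a mean drop out, and the product
  \<open>6 E[X\<^sup>2] E[Y\<^sup>2]\<close> in the fourth moment is cancelled by \<open>3 E[(X + Y)\<^sup>2]\<^sup>2\<close>.
\<close>

lemma (in prob_space) cumulant_defect_add: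
  assumes ind: "indep_var borel X borel Y"
    and int: "integrable M (\<lambda>\<omega>. X \<omega> ^ 6)" "integrable M (\<lambda>\<omega>. Y \<omega> ^ 6)"
    and mean: "expectation X = 0" "expectation Y = 0"
  shows "cumulant_defect M (\<lambda>\<omega>. X \<omega> + Y \<omega>) = cumulant_defect M X + cumulant_defect M Y"
proof -
  have [measurable]: "X \<in> borel_measurable M" "Y \<in> borel_measurable M"
    using indep_var_rv1[OF ind] indep_var_rv2[OF ind] by simp_all
  have Xi: "integrable M (\<lambda>\<omega>. X \<omega> ^ i)" and Yi: "integrable M (\<lambda>\<omega>. Y \<omega> ^ i)" if "i \<le> 6" for i
    using that by (auto intro: integrable_power_le[OF _ int(1)] integrable_power_le[OF _ int(2)])
  have prod: "integrable M (\<lambda>\<omega>. X \<omega> ^ i * Y \<omega> ^ j) \<and>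
      expectation (\<lambda>\<omega>. X \<omega> ^ i * Y \<omega> ^ j) = expectation (\<lambda>\<omega>. X \<omega> ^ i) * expectation (\<lambda>\<omega>. Y \<omega> ^ j)"
    if "i \<le> 6" "j \<le> 6" for i j
  proof -
    have "indep_var borel ((\<lambda>x. x ^ i) \<circ> X) borel ((\<lambda>x. x ^ j) \<circ> Y)"
      by (rule indep_var_compose[OF ind]) simp_all
    then have "indep_var borel (\<lambda>\<omega>. X \<omega> ^ i) borel (\<lambda>\<omega>. Y \<omega> ^ j)" by (simp add: comp_def)
    then show ?thesis
      using indep_var_integrable indep_var_lebesgue_integral Xi[OF that(1)] Yi[OF that(2)] by blast
  qed
  have power: "expectation (\<lambda>\<omega>. (X \<omega> + Y \<omega>) ^ r)
      = (\<Sum>i\<le>r. real (r choose i) * (expectation (\<lambda>\<omega>. X \<omega> ^ i) * expectation (\<lambda>\<omega>. Y \<omega> ^ (r - i))))"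
    if "r \<le> 4" for r
  proof -
    have "expectation (\<lambda>\<omega>. (X \<omega> + Y \<omega>) ^ r)
        = expectation (\<lambda>\<omega>. \<Sum>i\<le>r. real (r choose i) * (X \<omega> ^ i * Y \<omega> ^ (r - i)))"
      by (simp add: binomial_ring mult.assoc)
    also have "\<dots> = (\<Sum>i\<le>r. expectation (\<lambda>\<omega>. real (r choose i) * (X \<omega> ^ i * Y \<omega> ^ (r - i))))"
      by (rule Bochner_Integration.integral_sum) (use prod that in auto)
    also have "\<dots> = (\<Sum>i\<le>r. real (r choose i) * (expectation (\<lambda>\<omega>. X \<omega> ^ i) * expectation (\<lambda>\<omega>. Y \<omega> ^ (r - i))))"
      by (rule sum.cong) (use prod that in auto)
    finally show ?thesis .
  qed
  note sums = power[of 2] power[of 3] power[of 4]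
  have c: "4 choose 2 = (6::nat)" "4 choose 3 = (4::nat)" "3 choose 2 = (3::nat)"
    by (simp_all add: numeral_eq_Suc)
  show ?thesis
    using sums mean unfolding cumulant_defect_def
    by (simp add: eval_nat_numeral prob_space power2_eq_square algebra_simps)
qed

lemma cumulant_defect_centered_gamma:
  assumes "\<nu> > 0" "Z \<in> borel_measurable M" "distr M borel Z = centered_gamma \<nu>"
  shows "cumulant_defect M Z = 0"
proof -
  have moment: "(\<integral>\<omega>. Z \<omega> ^ r \<partial>M) = (\<integral>x. x ^ r \<partial>centered_gamma \<nu>)" for r
    unfolding assms(3)[symmetric] using assms(2) by (subst integral_distr) auto
  show ?thesis
    unfolding cumulant_defect_def moment centered_gamma_moments(2-4)[OF assms(1)]
    by (simp add: power2_eq_square)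
qed

theorem theorem3:
  fixes M :: "'w measure" and T :: "real set" and W :: "real \<Rightarrow> 'w \<Rightarrow> real"
    and q\<^sub>1 q\<^sub>2 :: nat and f h :: "(nat \<Rightarrow> real) \<Rightarrow> real"
    and X Y Z :: "'w \<Rightarrow> real" and \<nu> \<nu>\<^sub>1 \<nu>\<^sub>2 :: real
  assumes "wiener_process M T W"
    and "\<nu> > 0" and "\<nu>\<^sub>1 > 0" and "\<nu>\<^sub>2 > 0" and "\<nu> = \<nu>\<^sub>1 + \<nu>\<^sub>2"
    and "q\<^sub>1 \<ge> 2" and "q\<^sub>2 \<ge> 2"
    and "square_integrable (cube_measure T q\<^sub>1) f" and "symmetric_kernel T q\<^sub>1 f"
    and "square_integrable (cube_measure T q\<^sub>2) h" and "symmetric_kernel T q\<^sub>2 h"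
    and "is_multiple_integral M T W q\<^sub>1 f X"
    and "is_multiple_integral M T W q\<^sub>2 h Y"
    and "Z = (\<lambda>\<omega>. X \<omega> + Y \<omega>)"
    and "prob_space.indep_var M borel X borel Y"
    and "prob_space.expectation M (\<lambda>\<omega>. (Z \<omega>)\<^sup>2) = 2 * \<nu>"
    and "prob_space.expectation M (\<lambda>\<omega>. (X \<omega>)\<^sup>2) = fact q\<^sub>1 * (L2_norm (cube_measure T q\<^sub>1) f)\<^sup>2"
    and "fact q\<^sub>1 * (L2_norm (cube_measure T q\<^sub>1) f)\<^sup>2 = 2 * \<nu>\<^sub>1"
    and "prob_space.expectation M (\<lambda>\<omega>. (Y \<omega>)\<^sup>2) = fact q\<^sub>2 * (L2_norm (cube_measure T q\<^sub>2) h)\<^sup>2"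
    and "fact q\<^sub>2 * (L2_norm (cube_measure T q\<^sub>2) h)\<^sup>2 = 2 * \<nu>\<^sub>2"
    and "distr M borel Z = centered_gamma \<nu>"
  shows "distr M borel X = centered_gamma \<nu>\<^sub>1 \<and> distr M borel Y = centered_gamma \<nu>\<^sub>2"
proof -
  interpret wiener_process M T W by fact
  have chaos: "chaos_limit M q\<^sub>1 X" "chaos_limit M q\<^sub>2 Y"
    using multiple_integral_chaos_limit assms(12,13) by blast+
  have meas: "X \<in> borel_measurable M" "Y \<in> borel_measurable M"
    using chaos by (auto simp: chaos_limit_def)
  have second: "expectation (\<lambda>\<omega>. (X \<omega>)\<^sup>2) = 2 * \<nu>\<^sub>1" "expectation (\<lambda>\<omega>. (Y \<omega>)\<^sup>2) = 2 * \<nu>\<^sub>2"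
    using assms(17-20) by simp_all
  \<comment> \<open>The Bochner integral of a non-integrable function is \<open>0\<close>, so a positive second moment is finite.\<close>
  have int2: "integrable M (\<lambda>\<omega>. (X \<omega>)\<^sup>2)" "integrable M (\<lambda>\<omega>. (Y \<omega>)\<^sup>2)"
    using second \<open>\<nu>\<^sub>1 > 0\<close> \<open>\<nu>\<^sub>2 > 0\<close> not_integrable_integral_eq by force+
  have "q\<^sub>1 > 0" "q\<^sub>2 > 0" using assms(6,7) by simp_all
  note X = chaos_limit_properties[OF chaos(1) \<open>q\<^sub>1 > 0\<close> int2(1)]
  note Y = chaos_limit_properties[OF chaos(2) \<open>q\<^sub>2 > 0\<close> int2(2)]
  have "cumulant_defect M X + cumulant_defect M Y = cumulant_defect M Z"
    unfolding assms(14) by (rule cumulant_defect_add[symmetric, OF assms(15) X(1) Y(1) X(2) Y(2)])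
  also have "\<dots> = 0"
    using assms(2,14,21) meas by (intro cumulant_defect_centered_gamma[of \<nu>]) auto
  finally have defect: "cumulant_defect M X = 0" "cumulant_defect M Y = 0"
    using X(3) Y(3) by linarith+
  have "distr M borel V = centered_gamma n"
    if "V \<in> borel_measurable M" "integrable M (\<lambda>\<omega>. (V \<omega>)\<^sup>2)" "n > 0"
      "gamma_stein_equation n (distr M borel V)" for V n
    using that
    by (intro centered_gamma_eqI real_distribution_distr) (auto simp: integrable_distr_eq)
  then show ?thesis
    using meas int2 \<open>\<nu>\<^sub>1 > 0\<close> \<open>\<nu>\<^sub>2 > 0\<close> X(4)[OF defect(1)] Y(4)[OF defect(2)] second by simp
qed

end
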